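(* Let $q\in(0,1)$ and let $a,b,c,d$ be generic complex parameters satisfying the standing assumptions of the context, with dual parameters $\tilde a,\tilde b,\tilde c,\tilde d$. Then the non-symmetric Askey--Wilson function $\mathfrak{E}(\gamma;z;a,b,c,d)$ can be expressed in terms of symmetric Askey--Wilson functions $\mathfrak{E}^+$ by the following identity of meromorphic functions of $(\gamma,z)\in\mathbb{C}^*\times\mathbb{C}^*$: $$\mathfrak{E}(\gamma;z;a,b,c,d)=\mathfrak{E}^+(\gamma;z;a,b,c,d)-\frac{\sqrt{qab^{-1}cd}}{(1-ab)(1-qab)(1-ac)(1-ad)}\,\gamma^{-1}(1-\tilde a\gamma)(1-\tilde b\gamma)\,z^{-1}(1-az)(1-bz)\,\mathfrak{E}^+(\gamma;z;qa,qb,c,d).$$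
   Context: Notation: $\mathbb{C}^*=\mathbb{C}\setminus\{0\}$; $q\in(0,1)$ is fixed; $(x;q)_n=\prod_{j=0}^{n-1}(1-xq^j)$ for $n\in\{0,1,2,\dots\}\cup\{\infty\}$, $(x_1,\dots,x_r;q)_n=\prod_i (x_i;q)_n$; ${}_4\phi_3\left({a_1,a_2,a_3,a_4\atop b_1,b_2,b_3};q,q\right)=\sum_{k\ge0}\frac{(a_1,a_2,a_3,a_4;q)_k}{(b_1,b_2,b_3,q;q)_k}q^k$. Square roots are principal on $\mathbb{C}\setminus(-\infty,0]$ (positive on positive reals). Standing assumptions on parameters: $a,b,c,d\in\mathbb{C}^*$; $a,b,c,d,ab,ab^{-1},cd,cd^{-1}$ have real part $>0$; and $a,b,c,d$ are generic: they and their inverses are all distinct, and no denominator below vanishes identically (it suffices that $xy^{\pm1}\notin q^{\mathbb Z}$ for distinct $x,y$ among the parameters $a,b,c,d$, and $abcd^{-1}\notin q^{\mathbb Z}$). Dual parameters: $\tilde a=\sqrt{q^{-1}abcd}$, $\tilde b=ab/\tilde a$, $\tilde c=ac/\tilde a$, $\tilde d=ad/\tilde a$. When $\mathfrak{E}^+$ or $\mathfrak{E}$ is evaluated at other parameters, the dual parameters in its definition are those of the new parameters. Symmetric Askey--Wilson function: the meromorphic function of $(\gamma,z)$ $$\mathfrak{E}^+(\gamma;z;a,b,c,d)={}_4\phi_3\left({az,az^{-1},\tilde a\gamma,\tilde a\gamma^{-1}\atop ab,ac,ad};q,q\right)+\frac{(az,az^{-1},\tilde a\gamma,\tilde a\gamma^{-1},qbd^{-1},qcd^{-1},qa^{-1}d^{-1};q)_\infty}{(qd^{-1}z,qd^{-1}z^{-1},q\tilde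 d^{-1}\gamma,q\tilde d^{-1}\gamma^{-1},ab,ac,q^{-1}ad;q)_\infty}\,{}_4\phi_3\left({qd^{-1}z,qd^{-1}z^{-1},q\tilde d^{-1}\gamma,q\tilde d^{-1}\gamma^{-1}\atop qbd^{-1},qcd^{-1},q^2a^{-1}d^{-1}};q,q\right).$$ (For $|\gamma|>|q\tilde d^{-1}|$ it equals the very-well-poised ${}_8W_7$ expression $\frac{(q\gamma\tilde a d^{-1}z,\,q\gamma\tilde a d^{-1}z^{-1},\,qad^{-1},\,qa^{-1}d^{-1};q)_\infty}{(q\gamma\tilde a ad^{-1},\,\gamma\tilde a^{-1}bc,\,qd^{-1}z,\,qd^{-1}z^{-1};q)_\infty}\,{}_8W_7(\gamma\tilde a ad^{-1};az,az^{-1},\gamma\tilde a,\gamma\tilde a^{-1}ab,\gamma\tilde a^{-1}ac)$. It also equals the expansion $$\frac{(bc,qad^{-1},qbd^{-1},qcd^{-1},qa^{-1}d^{-1};q)_\infty}{(qabcd^{-1};q)_\infty(qd^{-1}z,qd^{-1}z^{-1},q\tilde d^{-1}\gamma,q\tilde d^{-1}\gamma^{-1};q)_\infty}\sum_{m=0}^\infty (-1)^m(ad)^{-m}q^{\frac12m(m+1)}\frac{1-q^{2m}abcd^{-1}}{1-abcd^{-1}}\frac{(ab,ac,abcd^{-1};q)_m}{(qbd^{-1},qcd^{-1},q;q)_m}E_m^+(z;a,b,c,qd^{-1})E_m^+(\gamma;\tilde a,\tilde b,\tilde c,q\tilde d^{-1}),$$ a known result of Stokman, with $E_m^+$ as below.)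 Askey--Wilson polynomials: $E_n^+(z;a,b,c,d)={}_4\phi_3\left({q^{-n},q^{n-1}abcd,az,az^{-1}\atop ab,ac,ad};q,q\right)$, $n\ge0$. Put $E_n^-(z;a,b,c,d)=z^{-1}(1-az)(1-bz)E_{n-1}^+(z;qa,qb,c,d)$, $n\ge1$. Non-symmetric Askey--Wilson polynomials (normalized to be $1$ at $z=a^{-1}$): $E_0=1$ and for $n\ge1$ $$E_{-n}(z;a,b,c,d)=E_n^+(z;a,b,c,d)-\frac{(1-q^nab)(1-q^{n-1}abcd)}{q^{n-1}b(1-ab)(1-qab)(1-ac)(1-ad)}E_n^-(z;a,b,c,d),$$ $$E_{n}(z;a,b,c,d)=E_n^+(z;a,b,c,d)-\frac{a(1-q^n)(1-q^{n-1}cd)}{q^{n-1}(1-ab)(1-qab)(1-ac)(1-ad)}E_n^-(z;a,b,c,d).$$ Non-symmetric Askey--Wilson function (rank one Cherednik kernel): $$\mathfrak{E}(\gamma;z;a,b,c,d)=\frac{(bc,qad^{-1},qbd^{-1},qcd^{-1},qa^{-1}d^{-1};q)_\infty}{(qabcd^{-1};q)_\infty(qd^{-1}z,qd^{-1}z^{-1},q\tilde d^{-1}\gamma,q\tilde d^{-1}\gamma^{-1};q)_\infty}\sum_{m=0}^\infty\frac{(-1)^m(ad)^{-m}q^{\frac12m(m+1)}}{(1-ab)(1-abcd^{-1})}\frac{(ab,ac,abcd^{-1};q)_m}{(qbd^{-1},qcd^{-1},q;q)_m}$$ $$\times\Big(-ab(1-q^m)(1-q^mcd^{-1})E_{-m}(z;a,b,c,qd^{-1})E_{-m}(\gamma;\tilde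 a,\tilde b,\tilde c,q\tilde d^{-1})+(1-q^mab)(1-q^mabcd^{-1})E_m(z;a,b,c,qd^{-1})E_m(\gamma;\tilde a,\tilde b,\tilde c,q\tilde d^{-1})\Big),$$ where the first term in the big brackets is zero for $m=0$; the sum converges absolutely and uniformly on compacta of $\mathbb{C}^*\times\mathbb{C}^*$. *)

theory Defs
  imports "HOL-Analysis.Analysis"
begin

section \<open>Basic hypergeometric series\<close>

definition qpoch :: "real \<Rightarrow> complex \<Rightarrow> nat \<Rightarrow> complex" where
  "qpoch q x n = (\<Prod>j<n. 1 - x * of_real q ^ j)"

definition qpoch_inf :: "real \<Rightarrow> complex \<Rightarrow> complex" where
  "qpoch_inf q x = prodinf (\<lambda>j. 1 - x * of_real q ^ j)"

text \<open>Multi-parameter versions \<open>(x\<^sub>1, \<dots>, x\<^sub>r; q)\<close>.\<close>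

definition qpochs :: "real \<Rightarrow> complex list \<Rightarrow> nat \<Rightarrow> complex" where
  "qpochs q xs n = (\<Prod>x\<leftarrow>xs. qpoch q x n)"

definition qpochs_inf :: "real \<Rightarrow> complex list \<Rightarrow> complex" where
  "qpochs_inf q xs = (\<Prod>x\<leftarrow>xs. qpoch_inf q x)"

text \<open>The series \<open>\<^sub>4\<phi>\<^sub>3\<close> with base and argument both equal to \<open>q\<close>. The two lists are the upper
  and the lower parameters.\<close>

definition phi43 :: "real \<Rightarrow> complex list \<Rightarrow> complex list \<Rightarrow> complex" where
  "phi43 q as bs = (\<Sum>k. qpochs q as k / qpochs q (bs @ [of_real q]) k * of_real q ^ k)"


section \<open>Parameters\<close>

definition dual_a :: "real \<Rightarrow> complex \<Rightarrow> complex \<Rightarrow> complex \<Rightarrow> complex \<Rightarrow> complex" where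
  "dual_a q a b c d = csqrt (a * b * c * d / of_real q)"

definition dual_b :: "real \<Rightarrow> complex \<Rightarrow> complex \<Rightarrow> complex \<Rightarrow> complex \<Rightarrow> complex" where
  "dual_b q a b c d = a * b / dual_a q a b c d"

definition dual_c :: "real \<Rightarrow> complex \<Rightarrow> complex \<Rightarrow> complex \<Rightarrow> complex \<Rightarrow> complex" where
  "dual_c q a b c d = a * c / dual_a q a b c d"

definition dual_d :: "real \<Rightarrow> complex \<Rightarrow> complex \<Rightarrow> complex \<Rightarrow> complex \<Rightarrow> complex" where
  "dual_d q a b c d = a * d / dual_a q a b c d"

text \<open>Genericity: the parameters and their inverses are distinct, and none of the \<open>\<gamma>\<close>- and
  \<open>z\<close>-independent factors \<open>(x; q)\<^sub>k\<close>, \<open>(x; q)\<^sub>\<infinity>\<close>, \<open>1 - x\<close> in a denominator of the functions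
  below vanishes; these reduce to \<open>x q\<^sup>k \<noteq> 1\<close> for the \<open>x\<close> in the list. Here \<open>b c\<close> arises as the
  product of the dual parameters \<open>\<tilde>a\<close> and \<open>q/\<tilde>d\<close>. The factors for the parameters
  \<open>(q a, q b, c, d)\<close> are covered as well, and a denominator depending on \<open>\<gamma>\<close> or \<open>z\<close> never
  vanishes identically.\<close>

definition aw_generic :: "real \<Rightarrow> complex \<Rightarrow> complex \<Rightarrow> complex \<Rightarrow> complex \<Rightarrow> bool" where
  "aw_generic q a b c d \<longleftrightarrow>
     distinct [a, b, c, d, inverse a, inverse b, inverse c, inverse d] \<and>
     (\<forall>x \<in> {a * b, a * c, b * c,
            a * d / of_real q, of_real q ^ 2 / (a * d),
            of_real q * a / d, of_real q * b / d, of_real q * c / d,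
            a * b * c / d}.
        \<forall>k::nat. x * of_real q ^ k \<noteq> 1)"

text \<open>The usual sufficient condition for genericity.\<close>

lemma aw_genericI:
  assumes q: "0 < q"
    and dist: "distinct [a, b, c, d, inverse a, inverse b, inverse c, inverse d]"
    and notin: "\<And>n::int. of_real q powi n \<notin> {a * b, a * c, a * d, b * c,
                  a / d, b / d, c / d, a * b * c / d}"
  shows "aw_generic q a b c d"
proof -
  let ?q = "of_real q :: complex"
  have q0: "?q \<noteq> 0" using q by simp
  have key: False if "x * ?q powi i * ?q ^ k = 1"
    and "\<And>n::int. ?q powi n \<noteq> x" for x i and k :: nat
  proof -
    have "?q powi (- i - int k) * (?q powi i * ?q ^ k) = 1"
      using q0 by (simp add: power_int_minus power_int_diff field_simps)
    then have "?q powi (- i - int k) = x"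
      using that(1) q0 by (metis mult.assoc mult_cancel_right no_zero_divisors power_int_not_zero power_not_zero)
    then show False using that(2) by blast
  qed
  have inv: "?q powi n \<noteq> inverse (a * d)" for n
    using notin[of "- n"] by (auto simp: power_int_minus)
  have *: "x * ?q ^ k \<noteq> 1" if "x \<in> {a * b, a * c, b * c, a * d / ?q, ?q ^ 2 / (a * d),
      ?q * a / d, ?q * b / d, ?q * c / d, a * b * c / d}" for x and k :: nat
  proof
    assume eq: "x * ?q ^ k = 1"
    consider "x = a * b" | "x = a * c" | "x = b * c" | "x = a * b * c / d"
      | "x = a * d / ?q" | "x = ?q ^ 2 / (a * d)"
      | "x = ?q * a / d" | "x = ?q * b / d" | "x = ?q * c / d"
      using \<open>x \<in> _\<close> by blast
    then show False
    proof cases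
      case 1 then show False using key[of "a * b" 0 k] eq notin by simp
    next
      case 2 then show False using key[of "a * c" 0 k] eq notin by simp
    next
      case 3 then show False using key[of "b * c" 0 k] eq notin by simp
    next
      case 4 then show False using key[of "a * b * c / d" 0 k] eq notin by simp
    next
      case 5 then show False using key[of "a * d" "-1" k] eq notin
        by (simp add: power_int_minus divide_inverse)
    next
      case 6 then show False using key[of "inverse (a * d)" 2 k] eq inv
        by (simp add: divide_inverse mult_ac)
    next
      case 7 then show False using key[of "a / d" 1 k] eq notin by (simp add: mult_ac)
    next
      case 8 then show False using key[of "b / d" 1 k] eq notin by (simp add: mult_ac)
    next
      case 9 then show False using key[of "c / d" 1 k] eq notin by (simp add: mult_ac)
    qed
  qed
  show ?thesis unfolding aw_generic_def using dist * by blast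
qed

definition aw_parameters :: "real \<Rightarrow> complex \<Rightarrow> complex \<Rightarrow> complex \<Rightarrow> complex \<Rightarrow> bool" where
  "aw_parameters q a b c d \<longleftrightarrow>
     a \<noteq> 0 \<and> b \<noteq> 0 \<and> c \<noteq> 0 \<and> d \<noteq> 0 \<and>
     (\<forall>x \<in> {a, b, c, d, a * b, a / b, c * d, c / d}. Re x > 0) \<and>
     aw_generic q a b c d"

text \<open>Points \<open>(\<gamma>, z)\<close> off the polar divisor
  \<open>(q z/d, q/(d z), q \<gamma>/\<tilde>d, q/(\<tilde>d \<gamma>); q)\<^sub>\<infinity> = 0\<close>. The divisor is the same for the parameters
  \<open>(q a, q b, c, d)\<close>, since \<open>\<tilde>d\<close> is unchanged.\<close>

definition aw_regular_point ::
  "real \<Rightarrow> complex \<Rightarrow> complex \<Rightarrow> complex \<Rightarrow> complex \<Rightarrow> complex \<Rightarrow> complex \<Rightarrow> bool" where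
  "aw_regular_point q a b c d \<gamma> z \<longleftrightarrow>
     \<gamma> \<noteq> 0 \<and> z \<noteq> 0 \<and>
     (\<forall>x \<in> {of_real q / d * z, of_real q / d / z,
            of_real q / dual_d q a b c d * \<gamma>, of_real q / dual_d q a b c d / \<gamma>}.
        \<forall>k::nat. x * of_real q ^ k \<noteq> 1)"


section \<open>The symmetric Askey--Wilson function\<close>

definition aw_fun_sym ::
  "real \<Rightarrow> complex \<Rightarrow> complex \<Rightarrow> complex \<Rightarrow> complex \<Rightarrow> complex \<Rightarrow> complex \<Rightarrow> complex" where
  "aw_fun_sym q \<gamma> z a b c d =
    (let q' = of_real q; a' = dual_a q a b c d; d' = dual_d q a b c d in
       phi43 q [a * z, a / z, a' * \<gamma>, a' / \<gamma>] [a * b, a * c, a * d]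
       + qpochs_inf q [a * z, a / z, a' * \<gamma>, a' / \<gamma>, q' * b / d, q' * c / d, q' / (a * d)]
         / qpochs_inf q [q' / d * z, q' / d / z, q' / d' * \<gamma>, q' / d' / \<gamma>,
                         a * b, a * c, a * d / q']
         * phi43 q [q' / d * z, q' / d / z, q' / d' * \<gamma>, q' / d' / \<gamma>]
                   [q' * b / d, q' * c / d, q' ^ 2 / (a * d)])"


section \<open>Askey--Wilson polynomials\<close>

definition aw_poly_plus ::
  "real \<Rightarrow> nat \<Rightarrow> complex \<Rightarrow> complex \<Rightarrow> complex \<Rightarrow> complex \<Rightarrow> complex \<Rightarrow> complex" where
  "aw_poly_plus q n z a b c d =
     phi43 q [of_real q powi (- int n), of_real q powi (int n - 1) * a * b * c * d, a * z, a / z]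
             [a * b, a * c, a * d]"

text \<open>Only meaningful for \<open>n \<ge> 1\<close>.\<close>

definition aw_poly_minus ::
  "real \<Rightarrow> nat \<Rightarrow> complex \<Rightarrow> complex \<Rightarrow> complex \<Rightarrow> complex \<Rightarrow> complex \<Rightarrow> complex" where
  "aw_poly_minus q n z a b c d =
     inverse z * (1 - a * z) * (1 - b * z) *
     aw_poly_plus q (n - 1) z (of_real q * a) (of_real q * b) c d"

text \<open>Non-symmetric polynomials, indexed by the integers.\<close>

definition aw_poly ::
  "real \<Rightarrow> int \<Rightarrow> complex \<Rightarrow> complex \<Rightarrow> complex \<Rightarrow> complex \<Rightarrow> complex \<Rightarrow> complex" where
  "aw_poly q m z a b c d =
    (let q' = of_real q; n = nat \<bar>m\<bar>;
         D = (1 - a * b) * (1 - q' * a * b) * (1 - a * c) * (1 - a * d) in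
     if m = 0 then 1
     else if m < 0 then
       aw_poly_plus q n z a b c d
       - (1 - q' ^ n * a * b) * (1 - q' ^ (n - 1) * a * b * c * d) / (q' ^ (n - 1) * b * D)
         * aw_poly_minus q n z a b c d
     else
       aw_poly_plus q n z a b c d
       - a * (1 - q' ^ n) * (1 - q' ^ (n - 1) * c * d) / (q' ^ (n - 1) * D)
         * aw_poly_minus q n z a b c d)"


section \<open>The non-symmetric Askey--Wilson function\<close>

text \<open>For \<open>m = 0\<close> the first term in the large bracket is zero because of its factor \<open>1 - q\<^sup>m\<close>.\<close>

definition aw_fun ::
  "real \<Rightarrow> complex \<Rightarrow> complex \<Rightarrow> complex \<Rightarrow> complex \<Rightarrow> complex \<Rightarrow> complex \<Rightarrow> complex" where
  "aw_fun q \<gamma> z a b c d =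
    (let q' = of_real q; a' = dual_a q a b c d; b' = dual_b q a b c d;
         c' = dual_c q a b c d; d' = dual_d q a b c d in
       qpochs_inf q [b * c, q' * a / d, q' * b / d, q' * c / d, q' / (a * d)]
       / (qpoch_inf q (q' * a * b * c / d)
          * qpochs_inf q [q' / d * z, q' / d / z, q' / d' * \<gamma>, q' / d' / \<gamma>])
       * (\<Sum>m::nat.
            (- 1) ^ m * (a * d) powi (- int m) * q' ^ (m * (m + 1) div 2)
            / ((1 - a * b) * (1 - a * b * c / d))
            * (qpochs q [a * b, a * c, a * b * c / d] m
               / qpochs q [q' * b / d, q' * c / d, q'] m)
            * (- a * b * (1 - q' ^ m) * (1 - q' ^ m * c / d)
                 * aw_poly q (- int m) z a b c (q' / d)
                 * aw_poly q (- int m) \<gamma> a' b' c' (q' / d')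
               + (1 - q' ^ m * a * b) * (1 - q' ^ m * a * b * c / d)
                 * aw_poly q (int m) z a b c (q' / d)
                 * aw_poly q (int m) \<gamma> a' b' c' (q' / d'))))"

end

theory Submission
  imports Defs "HOL-Complex_Analysis.Conformal_Mappings"
begin

text \<open>
  The core is Stokman's expansion of the symmetric function in products of Askey--Wilson
  polynomials. Put \<open>u = ab\<close>, \<open>v = ac\<close>, \<open>r = ad/q\<close> and replace \<open>az\<close>, \<open>a/z\<close>,
  \<open>\<tilde>a\<gamma>\<close>, \<open>\<tilde>a/\<gamma>\<close> by four independent variables \<open>A\<^sub>1, A\<^sub>2, G\<^sub>1, G\<^sub>2\<close>. Cleared of its
  poles, each side of the expansion is an entire function of \<open>A\<^sub>1\<close> and of \<open>G\<^sub>1\<close>. If \<open>A\<^sub>1\<close> and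
  \<open>G\<^sub>1\<close> both lie in \<open>{q\<^sup>-\<^sup>n, r q\<^sup>-\<^sup>n}\<close>, both sides are finite sums, and they agree by a limit of
  Rogers' \<open>\<^sub>6\<phi>\<^sub>5\<close> sum together with the Sears and \<open>q\<close>-Saalschuetz formulas. The quotient of the
  difference by \<open>(A\<^sub>1, A\<^sub>1/r; q)\<^sub>M\<close> tends to \<open>0\<close> on circles of radius proportional to \<open>q\<^sup>-\<^sup>M\<close>,
  so the maximum principle extends the equality to all \<open>G\<^sub>1\<close>, and then to all \<open>A\<^sub>1\<close>. Since
  the variables are independent, the interpolation points are distinct even for parameters where
  \<open>(az, a/z, qz/d, q/(dz); q)\<^sub>\<infinity>\<close> has double zeros.

  In the series of the non-symmetric function, insert the expressions of \<open>E\<^sub>\<plusminus>\<^sub>m\<close> in terms of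
  \<open>E\<^sup>+\<^sub>m\<close> and \<open>E\<^sup>-\<^sub>m\<close>. The mixed products cancel. The products of two \<open>E\<^sup>+\<^sub>m\<close> give the
  expansion for \<open>(a, b, c, d)\<close>, and those of two \<open>E\<^sup>-\<^sub>m\<close> give the one for \<open>(qa, qb, c, d)\<close>.
\<close>

section \<open>Finite sums\<close>

text \<open>Vanishing at all nodes is not enough for interpolation, since (A1, A1/r; q)_\<infinity>
  vanishes there too; growth has to decide. On |A1| = \<rho> q^-M the product (A1, A1/r; q)_M has
  size q^(-M^2) up to exponential factors. The series side stays below q^(-M^2/2) up to exponential
  factors, but each 4phi3 term is smaller than the product only by a factor q^(M/2), and this narrow
  margin shapes the estimates. A second obstacle is the size of the polynomials in m: estimated term
  by term they defeat the Gaussian factor of the weights, so bounds C B^m with explicit dependence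
  on A1 are needed. The map (u, v, r) -> (u/r, v/r, 1/r) exchanges a and q/d. It swaps the two 4phi3
  terms and preserves the series, so the nodes r q^-n follow from the nodes q^-n. At a mixed pair of
  nodes, one of each kind, both 4phi3 terms vanish, and the series must be shown to vanish as well.
  The square root in the final constant is not the one defining the dual parameter; the half-plane
  conditions decide the sign that relates them.\<close>

locale q_series =
  fixes q :: real
  assumes q0: "0 < q" and q1: "q < 1"
begin

abbreviation Q :: complex where "Q \<equiv> complex_of_real q"
abbreviation poi :: "complex \<Rightarrow> complex" where "poi \<equiv> qpoch_inf q"
abbreviation po :: "complex \<Rightarrow> nat \<Rightarrow> complex" where "po \<equiv> qpoch q"

text \<open>The homogeneous form x^n (y/x; q)_n, which stays meaningful at x = 0. It lets limits and
  reversed sums be written without division.\<close>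

definition hpo where
  "hpo x y n = (\<Prod>j<n. x - y * Q ^ j)"

lemma q_nz [simp]: "q \<noteq> 0"
  using q0 by simp

lemma Q_pow_neq_1: "n > 0 \<Longrightarrow> Q ^ n \<noteq> 1"
proof -
  assume "n > 0"
  have "norm (Q ^ n) < 1"
    using q0 q1 \<open>n > 0\<close> by (simp add: norm_power power_less_one_iff)
  then show ?thesis by auto
qed

lemma po_0 [simp]: "po x 0 = 1"
  by (simp add: qpoch_def)

lemma po_Suc: "po x (Suc n) = po x n * (1 - x * Q ^ n)"
  by (simp add: qpoch_def)

lemma po_rec: "po x (Suc n) = (1 - x) * po (x * Q) n"
  by (simp add: qpoch_def prod.lessThan_Suc_shift mult_ac del: prod.lessThan_Suc)

lemma po_add: "po x (m + n) = po x m * po (x * Q ^ m) n"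
  by (induction n) (simp_all add: po_Suc power_add mult_ac)

lemma po_split: "k \<le> n \<Longrightarrow> po x n = po x k * po (x * Q ^ k) (n - k)"
  using po_add[of x k "n - k"] by simp

lemma po_eq_0_iff: "po x n = 0 \<longleftrightarrow> (\<exists>k<n. x * Q ^ k = 1)"
  by (auto simp: qpoch_def)

lemma po_nz: "(\<And>k. x * Q ^ k \<noteq> 1) \<Longrightarrow> po x n \<noteq> 0"
  by (simp add: po_eq_0_iff)

lemma po_Q_nz [simp]: "po Q n \<noteq> 0"
  using Q_pow_neq_1[of "Suc _"] by (simp add: po_eq_0_iff)

lemma po_zero [simp]: "po 0 n = 1"
  by (simp add: qpoch_def)

lemma po_minus_pow_eq_0: "m < k \<Longrightarrow> po (1 / Q ^ m) k = 0"
  unfolding po_eq_0_iff using q0 by (intro exI[of _ m]) simp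

lemma hpo_0 [simp]: "hpo x y 0 = 1"
  by (simp add: hpo_def)

lemma hpo_Suc: "hpo x y (Suc n) = hpo x y n * (x - y * Q ^ n)"
  by (simp add: hpo_def)

lemma hpo_rec: "hpo x y (Suc n) = (x - y) * hpo x (y * Q) n"
  by (simp add: hpo_def prod.lessThan_Suc_shift mult_ac del: prod.lessThan_Suc)

lemma hpo_1: "hpo 1 y n = po y n"
  by (simp add: hpo_def qpoch_def)

lemma hpo_scale: "hpo (c * x) (c * y) n = c ^ n * hpo x y n"
  by (induction n) (simp_all add: hpo_Suc algebra_simps)

lemma hpo_po: "x \<noteq> 0 \<Longrightarrow> hpo x y n = x ^ n * po (y / x) n"
  using hpo_scale[of x 1 "y / x" n] by (simp add: hpo_1)

section \<open>Gaussian binomials and terminating summations\<close>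

definition qbin :: "nat \<Rightarrow> nat \<Rightarrow> complex" where
  "qbin n k = (if k \<le> n then po Q n / (po Q k * po Q (n - k)) else 0)"

lemma qbin_0 [simp]: "qbin n 0 = 1"
  by (simp add: qbin_def)

lemma qbin_self [simp]: "qbin n n = 1"
  by (simp add: qbin_def)

lemma qbin_gt: "k > n \<Longrightarrow> qbin n k = 0"
  by (simp add: qbin_def)

lemma qbin_sym: "k \<le> n \<Longrightarrow> qbin n (n - k) = qbin n k"
  by (simp add: qbin_def)

lemma po_Q_Suc: "po Q (Suc n) = po Q n * (1 - Q ^ Suc n)"
  by (simp add: po_Suc)

lemma qbin_absorb: "(1 - Q ^ Suc k) * qbin n (Suc k) = (1 - Q ^ (n - k)) * qbin n k"
proof (cases "k < n")
  case True
  then obtain m where m: "n = Suc (k + m)"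
    using less_imp_Suc_add by blast
  have 1: "1 - Q ^ Suc k \<noteq> 0" "1 - Q ^ Suc m \<noteq> 0"
    using Q_pow_neq_1[of "Suc _"] by force+
  have d: "n - k = Suc m" "n - Suc k = m" using m by auto
  show ?thesis
    using True 1 unfolding qbin_def d po_Q_Suc by (simp add: field_simps d)
next
  case False
  then show ?thesis by (cases "k = n") (simp_all add: qbin_gt)
qed

lemma qbin_Pascal: "qbin (Suc n) (Suc k) = qbin n (Suc k) + Q ^ (n - k) * qbin n k"
proof (cases "k \<le> n")
  case True
  have 1: "1 - Q ^ Suc k \<noteq> 0" using Q_pow_neq_1[of "Suc k"] by force
  have "(1 - Q ^ Suc k) * qbin (Suc n) (Suc k) = (1 - Q ^ Suc n) * qbin n k"
    using True 1 by (simp add: qbin_def po_Q_Suc del: power_Suc)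
  also have "Q ^ Suc n = Q ^ (n - k) * Q ^ Suc k"
    using True by (simp flip: power_add del: power_Suc)
  finally have "(1 - Q ^ Suc k) * qbin (Suc n) (Suc k) =
      (1 - Q ^ Suc k) * (qbin n (Suc k) + Q ^ (n - k) * qbin n k)"
    unfolding distrib_left qbin_absorb by (simp add: algebra_simps del: power_Suc)
  then show ?thesis using 1 by (simp only: mult_cancel_left simp_thms)
qed (simp add: qbin_gt)

text \<open>Pascal's rule in summed form. It is the induction step for any sum over a row of
  Gaussian binomials.\<close>

lemma qbin_sum_Suc:
  "(\<Sum>k\<le>Suc n. qbin (Suc n) k * f k) = (\<Sum>k\<le>n. qbin n k * (f k + Q ^ (n - k) * f (Suc k)))"
proof -
  have "(\<Sum>k\<le>Suc n. qbin (Suc n) k * f k) =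
      f 0 + (\<Sum>k\<le>n. qbin n (Suc k) * f (Suc k)) + (\<Sum>k\<le>n. Q ^ (n - k) * qbin n k * f (Suc k))"
    by (simp add: sum.atMost_Suc_shift qbin_Pascal algebra_simps sum.distrib del: sum.atMost_Suc)
  also have "f 0 + (\<Sum>k\<le>n. qbin n (Suc k) * f (Suc k)) = (\<Sum>k\<le>Suc n. qbin n k * f k)"
    by (simp add: sum.atMost_Suc_shift del: sum.atMost_Suc)
  also have "\<dots> = (\<Sum>k\<le>n. qbin n k * f k)"
    by (simp add: qbin_gt)
  finally show ?thesis
    by (simp add: algebra_simps sum.distrib)
qed

text \<open>A discrete summation by parts: in the induction for \<open>saalschuetz\<close> it makes
  the correction terms cancel in pairs.\<close>

lemma qbin_sum_absorb:
  "(\<Sum>k\<le>n. (1 - Q ^ k) * qbin n k * f k) = (\<Sum>k\<le>n. (1 - Q ^ (n - k)) * qbin n k * f (Suc k))"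
proof -
  have "(\<Sum>k\<le>n. (1 - Q ^ k) * qbin n k * f k) = (\<Sum>k\<le>Suc n. (1 - Q ^ k) * qbin n k * f k)"
    by (simp add: qbin_gt)
  also have "\<dots> = (\<Sum>k\<le>n. (1 - Q ^ Suc k) * qbin n (Suc k) * f (Suc k))"
    by (simp add: sum.atMost_Suc_shift del: sum.atMost_Suc power_Suc)
  finally show ?thesis by (simp only: qbin_absorb)
qed

(* For sigma = 1 this is the q-Saalschuetz sum; keeping sigma free also covers its reversed form. *)
lemma saalschuetz:
  assumes "\<sigma> * C = t * A * B"
  shows "(\<Sum>k\<le>n. qbin n k * (po A k * po B k * t ^ k * hpo \<sigma> t (n - k) * po (C * Q ^ k) (n - k)))
    = (\<Prod>i<n. \<sigma> + t * C * (Q ^ i) ^ 2 - t * (A + B) * Q ^ i)"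
proof (induction n)
  case 0
  show ?case by simp
next
  case (Suc n)
  define f where "f k = po A k * po B k * t ^ k * hpo \<sigma> t (Suc n - k) * po (C * Q ^ k) (Suc n - k)" for k
  define b where "b k = po A k * po B k * t ^ k * hpo \<sigma> t (n - k) * po (C * Q ^ k) (n - k)" for k
  \<comment> \<open>\<open>g\<close> acts as a certificate: one Pascal step applied to
    \<open>f\<close> gives the expected factor times \<open>b\<close>, plus a difference that sums
    to zero by \<open>qbin_sum_absorb\<close>.\<close>
  define g where "g k = po A k * po B k * t ^ k * hpo \<sigma> t (Suc n - k) * po (C * Q ^ k) (n - k) * (C * Q ^ n)" for k
  have key: "f k + Q ^ (n - k) * f (Suc k) =
      b k * (\<sigma> + t * C * (Q ^ n) ^ 2 - t * (A + B) * Q ^ n)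
      - (1 - Q ^ k) * g k + (1 - Q ^ (n - k)) * g (Suc k)" if "k \<le> n" for k
  proof -
    define N where "N = n - k"
    have n: "n = k + N" using that N_def by simp
    define x y where "x = Q ^ k" and "y = Q ^ N"
    have qn: "Q ^ n = x * y" by (simp add: n power_add x_def y_def)
    define c where "c = po A k * po B k * t ^ k"
    define H where "H = hpo \<sigma> t N"
    define R where "R = po (C * x) N"
    define R' where "R' = po (C * (Q * x)) N"
    \<comment> \<open>The value at N = 0 is arbitrary, because R'' only occurs multiplied by 1 - y,
      which is then 0.\<close>
    define R'' where "R'' = (if N = 0 then 1 else po (C * (Q * x)) (N - 1))"
    have RR: "(1 - C * x) * R' = R * (1 - C * (x * y))"
      unfolding R_def R'_def using po_rec[of "C * x" N] po_Suc[of "C * x" N]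
      by (simp add: y_def mult_ac)
    have f: "f k = c * (H * (\<sigma> - t * y)) * (R * (1 - C * (x * y)))"
      by (simp add: f_def n Suc_diff_le hpo_Suc po_Suc c_def H_def R_def x_def y_def mult_ac)
    have f': "f (Suc k) = c * (1 - A * x) * (1 - B * x) * t * H * R'"
      by (simp add: f_def n po_Suc c_def H_def R'_def x_def mult_ac)
    have b: "b k = c * H * R" by (simp add: b_def n c_def H_def R_def x_def)
    have g: "g k = c * (H * (\<sigma> - t * y)) * R * (C * (x * y))"
      by (simp add: g_def n Suc_diff_le hpo_Suc c_def H_def R_def x_def y_def mult_ac power_add)
    have g': "(1 - y) * g (Suc k) = (1 - y) * (c * (1 - A * x) * (1 - B * x) * t * H * R'' * (C * (x * y)))"
    proof (cases N)
      case 0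
      then show ?thesis by (simp add: y_def)
    next
      case (Suc M)
      then show ?thesis
        by (simp add: g_def n po_Suc c_def H_def R''_def x_def mult_ac power_add y_def)
    qed
    have R2: "y * (R' - R) = (1 - y) * R'' * (C * (x * y))"
    proof (cases N)
      case 0
      then show ?thesis by (simp add: y_def R'_def R_def)
    next
      case (Suc M)
      have "R' = R'' * (1 - C * (x * y))"
        by (simp add: R'_def R''_def Suc po_Suc y_def mult_ac)
      moreover have "R = (1 - C * x) * R''"
        by (simp add: R_def R''_def Suc po_rec mult_ac)
      ultimately show ?thesis by (simp only: ) (simp add: algebra_simps)
    qed
    \<comment> \<open>The only place where the balancing condition enters: the two sides differ by a
      multiple of t A B - \<sigma> C.\<close>
    have "(\<sigma> - t * y) * (1 - C * (x * y)) - (\<sigma> + t * C * (x * y) ^ 2 - t * (A + B) * (x * y))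
        = - (\<sigma> - t * y) * C * (x * y) * (1 - x) - (1 - A * x) * (1 - B * x) * t * y
          + (t * A * B - \<sigma> * C) * (x ^ 2 * y)"
      by (simp add: algebra_simps power2_eq_square)
    moreover have "t * A * B - \<sigma> * C = 0"
      using assms by simp
    ultimately have E: "(\<sigma> - t * y) * (1 - C * (x * y)) = - (\<sigma> - t * y) * C * (x * y) * (1 - x)
        - (1 - A * x) * (1 - B * x) * t * y + (\<sigma> + t * C * (x * y) ^ 2 - t * (A + B) * (x * y))"
      by (simp only: mult_zero_left add_0_right diff_eq_eq)
    have "f k + y * f (Suc k) = c * H * R * ((\<sigma> - t * y) * (1 - C * (x * y))) +
        c * (1 - A * x) * (1 - B * x) * t * H * (y * R')"
      unfolding f f' by (simp add: algebra_simps)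
    also have "y * R' = y * R + (1 - y) * R'' * (C * (x * y))"
      using R2 by (simp add: algebra_simps)
    also have "c * H * R * ((\<sigma> - t * y) * (1 - C * (x * y))) +
        c * (1 - A * x) * (1 - B * x) * t * H * (y * R + (1 - y) * R'' * (C * (x * y)))
      = b k * (\<sigma> + t * C * (x * y) ^ 2 - t * (A + B) * (x * y)) - (1 - x) * g k + (1 - y) * g (Suc k)"
      unfolding E b g g' by (simp add: algebra_simps)
    finally show ?thesis by (simp add: qn x_def y_def flip: N_def)
  qed
  define L where "L = \<sigma> + t * C * (Q ^ n) ^ 2 - t * (A + B) * Q ^ n"
  have "(\<Sum>k\<le>Suc n. qbin (Suc n) k * f k) = (\<Sum>k\<le>n. qbin n k * (f k + Q ^ (n - k) * f (Suc k)))"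
    by (rule qbin_sum_Suc)
  also have "\<dots> = (\<Sum>k\<le>n. qbin n k * b k * L
      - (1 - Q ^ k) * qbin n k * g k + (1 - Q ^ (n - k)) * qbin n k * g (Suc k))"
    by (intro sum.cong refl) (simp only: key L_def atMost_iff, simp add: algebra_simps)
  also have "\<dots> = (\<Sum>k\<le>n. qbin n k * b k) * L
      - (\<Sum>k\<le>n. (1 - Q ^ k) * qbin n k * g k) + (\<Sum>k\<le>n. (1 - Q ^ (n - k)) * qbin n k * g (Suc k))"
    by (simp add: sum.distrib sum_subtractf sum_distrib_right)
  also have "\<dots> = (\<Sum>k\<le>n. qbin n k * b k) * L"
    by (simp only: qbin_sum_absorb diff_add_cancel)
  finally show ?case
    using Suc.IH by (simp only: f_def b_def L_def prod.lessThan_Suc)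
qed

text \<open>With C = T A B every factor on the right splits into two linear ones. In this
  denominator-free form the sum is a polynomial identity, valid for all parameters.\<close>

lemma saalschuetz_poly:
  "(\<Sum>k\<le>n. qbin n k * (po A k * po B k * T ^ k * po T (n - k) * po (T * A * B * Q ^ k) (n - k)))
    = po (T * A) n * po (T * B) n"
proof -
  have "(\<Prod>i<n. 1 + T * (T * A * B) * (Q ^ i) ^ 2 - T * (A + B) * Q ^ i) =
      (\<Prod>i<n. (1 - T * A * Q ^ i) * (1 - T * B * Q ^ i))"
    by (rule prod.cong) (simp_all add: algebra_simps power2_eq_square)
  also have "\<dots> = po (T * A) n * po (T * B) n"
    by (simp add: qpoch_def prod.distrib)
  finally show ?thesis
    using saalschuetz[of 1 "T * A * B" T A B n] by (simp add: hpo_1)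
qed

text \<open>The choice \<sigma> = A B, C = t = E splits each factor on the right into (A - E q^i)(B
  - E q^i). This is the same sum read backwards.\<close>

lemma saalschuetz_hpo:
  "(\<Sum>k\<le>n. qbin n k * (po A k * po B k * E ^ k * hpo (A * B) E (n - k) * po (E * Q ^ k) (n - k)))
    = hpo A E n * hpo B E n"
proof -
  have "(\<Prod>i<n. A * B + E * E * (Q ^ i) ^ 2 - E * (A + B) * Q ^ i) =
      (\<Prod>i<n. (A - E * Q ^ i) * (B - E * Q ^ i))"
    by (rule prod.cong) (simp_all add: algebra_simps power2_eq_square)
  also have "\<dots> = hpo A E n * hpo B E n"
    by (simp add: hpo_def prod.distrib)
  finally show ?thesis
    using saalschuetz[of "A * B" E E A B n] by (simp add: mult_ac)
qed

lemma vandermonde: "(\<Sum>k\<le>n. qbin n k * (po A k * T ^ k * po T (n - k))) = po (T * A) n"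
  using saalschuetz_poly[of n A 0 T] by simp

lemma vandermonde_hpo:
  assumes "T \<noteq> 0"
  shows "(\<Sum>k\<le>n. qbin n k * (po T k * hpo T U (n - k))) = po U n"
proof -
  have "(\<Sum>k\<le>n. qbin n k * (po T k * hpo T U (n - k))) =
        (\<Sum>k\<le>n. qbin n (n - k) * (po T (n - k) * hpo T U k))"
    by (rule sum.reindex_bij_witness[of _ "\<lambda>k. n - k" "\<lambda>k. n - k"]) auto
  also have "\<dots> = (\<Sum>k\<le>n. qbin n k * (po (U / T) k * T ^ k * po T (n - k)))"
    using assms by (intro sum.cong) (simp_all add: qbin_sym hpo_po mult_ac)
  finally show ?thesis using vandermonde[of n "U / T" T] assms by simp
qed

section \<open>Terminating series with argument q\<close>

definition hq where
  "hq n k = po (1 / Q ^ n) k / po Q k * Q ^ k"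

text \<open>What allows a double sum over j <= k to be regrouped by j and i = k - j, as needed for
  Sears' transformation.\<close>

lemma hq_split:
  assumes "j + i \<le> n"
  shows "hq n (j + i) * qbin (j + i) j = hq n j * hq (n - j) i"
proof -
  have "1 / Q ^ n * Q ^ j = 1 / Q ^ (n - j)"
    using assms by (simp add: power_diff field_simps)
  then have "po (1 / Q ^ n) (j + i) = po (1 / Q ^ n) j * po (1 / Q ^ (n - j)) i"
    by (simp add: po_add)
  then show ?thesis
    by (simp add: hq_def qbin_def power_add)
qed

text \<open>Taken in reverse order, the factors become 1 - Z/(E q^l) with l running upwards.\<close>

lemma po_reverse:
  assumes "E \<noteq> 0"
  shows "po (Z * Q / (Q ^ M * E)) M = (\<Prod>l<M. - 1 / (E * Q ^ l)) * hpo Z E M"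
proof -
  have "po (Z * Q / (Q ^ M * E)) M = (\<Prod>l<M. 1 - Z * Q / (Q ^ M * E) * Q ^ (M - Suc l))"
    unfolding qpoch_def by (rule prod.nat_diff_reindex[symmetric])
  also have "\<dots> = (\<Prod>l<M. - 1 / (E * Q ^ l) * (Z - E * Q ^ l))"
  proof (rule prod.cong)
    fix l assume "l \<in> {..<M}"
    then have "M = Suc l + (M - Suc l)" by simp
    then have "Q ^ M = Q * Q ^ l * Q ^ (M - Suc l)"
      by (metis power_add power_Suc)
    then show "1 - Z * Q / (Q ^ M * E) * Q ^ (M - Suc l) = - 1 / (E * Q ^ l) * (Z - E * Q ^ l)"
      using assms by (simp add: field_simps)
  qed simp
  finally show ?thesis unfolding hpo_def prod.distrib .
qed

text \<open>The constants left over by \<open>po_reverse\<close> absorb (q^-N; q)_i and leave a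
  Gaussian binomial. This links the terminating form of a sum to its polynomial form.\<close>

lemma hq_reverse:
  assumes "E \<noteq> 0" "i \<le> N"
  shows "hq N i * (\<Prod>l<N - i. - 1 / (E * Q ^ l)) = qbin N i * E ^ i * (\<Prod>l<N. - 1 / (E * Q ^ l))"
  using assms(2)
proof (induction i)
  case 0
  show ?case by (simp add: hq_def)
next
  case (Suc i)
  obtain M where N: "N = Suc (i + M)"
    using Suc.prems less_imp_Suc_add Suc_le_lessD by blast
  define p where "p = (\<Prod>l<M. - 1 / (E * Q ^ l))"
  have n1: "1 - Q ^ Suc i \<noteq> 0" using Q_pow_neq_1[of "Suc i"] by force
  have h: "hq N (Suc i) = hq N i * (1 - 1 / (Q * Q ^ M)) * Q / (1 - Q ^ Suc i)"
    by (simp add: hq_def po_Suc N power_add)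
  have IH: "hq N i * (p * (- 1 / (E * Q ^ M))) = qbin N i * E ^ i * (\<Prod>l<N. - 1 / (E * Q ^ l))"
    using Suc by (simp add: N p_def mult_ac)
  have b: "qbin N (Suc i) = (1 - Q * Q ^ M) * qbin N i / (1 - Q ^ Suc i)"
    using qbin_absorb[of i N] n1 by (simp add: N field_simps)
  have "hq N (Suc i) * p = hq N i * (p * (- 1 / (E * Q ^ M))) * (E * (1 - Q * Q ^ M) / (1 - Q ^ Suc i))"
    unfolding h using assms(1) n1 by (simp add: divide_simps) (simp add: algebra_simps)
  also have "\<dots> = qbin N (Suc i) * E ^ Suc i * (\<Prod>l<N. - 1 / (E * Q ^ l))"
    unfolding IH b by simp
  finally show ?case by (simp add: N p_def)
qed

text \<open>The hypothesis on F says that the series with upper parameters q^-N, A, T and lower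
  parameters E, AF is balanced. Reversing the factors that contain AF reduces it to
  \<open>saalschuetz_hpo\<close>.\<close>

lemma saalschuetz_hq:
  assumes "E \<noteq> 0" and F: "F = T * Q / (Q ^ N * E)"
  shows "(\<Sum>i\<le>N. hq N i * (po A i * po T i * po (E * Q ^ i) (N - i) * po (A * F * Q ^ i) (N - i)))
    = hpo A E N * po F N"
proof -
  define \<kappa> where "\<kappa> M = (\<Prod>l<M. - 1 / (E * Q ^ l))" for M
  have *: "hq N i * po (A * F * Q ^ i) (N - i) = qbin N i * E ^ i * \<kappa> N * hpo (A * T) E (N - i)"
    if "i \<le> N" for i
  proof -
    have "Q ^ N = Q ^ i * Q ^ (N - i)"
      using that by (metis power_add le_add_diff_inverse)
    then have "A * F * Q ^ i = (A * T) * Q / (Q ^ (N - i) * E)"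
      by (simp add: F)
    then have "hq N i * po (A * F * Q ^ i) (N - i) = hq N i * \<kappa> (N - i) * hpo (A * T) E (N - i)"
      using po_reverse[OF assms(1), of "A * T" "N - i"] by (simp add: \<kappa>_def)
    also have "hq N i * \<kappa> (N - i) = qbin N i * E ^ i * \<kappa> N"
      unfolding \<kappa>_def by (rule hq_reverse) (use assms that in auto)
    finally show ?thesis .
  qed
  have "(\<Sum>i\<le>N. hq N i * (po A i * po T i * po (E * Q ^ i) (N - i) * po (A * F * Q ^ i) (N - i)))
     = (\<Sum>i\<le>N. (hq N i * po (A * F * Q ^ i) (N - i)) * (po A i * po T i * po (E * Q ^ i) (N - i)))"
    by (intro sum.cong) (simp_all add: mult_ac)
  also have "\<dots> = (\<Sum>i\<le>N. (qbin N i * E ^ i * \<kappa> N * hpo (A * T) E (N - i)) * (po A i * po T i * po (E * Q ^ i) (N - i)))"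
    by (intro sum.cong) (simp_all only: * atMost_iff)
  also have "\<dots> = \<kappa> N * (hpo A E N * hpo T E N)"
    unfolding saalschuetz_hpo[symmetric] sum_distrib_left by (intro sum.cong) (simp_all add: mult_ac)
  also have "\<kappa> N * hpo T E N = po F N"
    unfolding F \<kappa>_def po_reverse[OF assms(1)] by simp
  then have "\<kappa> N * (hpo A E N * hpo T E N) = hpo A E N * po F N"
    by (metis mult.left_commute)
  finally show ?thesis .
qed

lemma sum_triangle_swap:
  fixes f :: "nat \<Rightarrow> nat \<Rightarrow> 'a :: comm_monoid_add"
  shows "(\<Sum>k\<le>n. \<Sum>j\<le>k. f k j) = (\<Sum>j\<le>n. \<Sum>i\<le>n - j. f (j + i) j)"
  unfolding sum.Sigma[OF finite_atMost ballI[OF finite_atMost]]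
  by (rule sum.reindex_bij_witness[of _ "\<lambda>(j, i). (j + i, j)" "\<lambda>(k, j). (j, k - j)"]) auto

(* The Sears transformation of terminating balanced 4phi3 series, with the denominators cleared
   so that no genericity is required. *)
lemma sears:
  assumes "E \<noteq> 0" and F: "F = T * Q / (Q ^ n * E)"
  shows "(\<Sum>k\<le>n. hq n k * (po A k * po (T * X) k * po (T * Y) k * po (T * X * Y * Q ^ k) (n - k)
            * po (E * Q ^ k) (n - k) * po (A * F * Q ^ k) (n - k)))
    = (\<Sum>j\<le>n. hq n j * (po A j * po X j * po Y j * T ^ j * po (T * X * Y * Q ^ j) (n - j)
            * hpo A E (n - j) * po F (n - j) * Q ^ (j * (n - j))))" (is "?lhs = _")
proof -
  \<comment> \<open>The product (TX, TY; q)_k is itself expanded by a q-Saalschuetz sum over j.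
    After the order of summation is exchanged, the sum over k - j is again of q-Saalschuetz
    type.\<close>
  define f where "f k j = hq n k * (po A k * po (E * Q ^ k) (n - k) * po (A * F * Q ^ k) (n - k)
    * po (T * X * Y * Q ^ k) (n - k) * (qbin k j * (po X j * po Y j * T ^ j * po T (k - j) * po (T * X * Y * Q ^ j) (k - j))))" for k j
  have "?lhs =
       (\<Sum>k\<le>n. hq n k * (po A k * po (E * Q ^ k) (n - k) * po (A * F * Q ^ k) (n - k) * po (T * X * Y * Q ^ k) (n - k))
            * (po (T * X) k * po (T * Y) k))"
    by (intro sum.cong) (simp_all add: mult_ac)
  also have "\<dots> = (\<Sum>k\<le>n. \<Sum>j\<le>k. f k j)"
    unfolding saalschuetz_poly[symmetric] sum_distrib_left f_def
    by (intro sum.cong) (simp_all add: mult_ac)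
  also have "\<dots> = (\<Sum>j\<le>n. \<Sum>i\<le>n - j. f (j + i) j)"
    by (rule sum_triangle_swap)
  also have "\<dots> = (\<Sum>j\<le>n. hq n j * (po A j * po X j * po Y j * T ^ j * po (T * X * Y * Q ^ j) (n - j))
       * (\<Sum>i\<le>n - j. hq (n - j) i * (po (A * Q ^ j) i * po T i * po (E * Q ^ j * Q ^ i) (n - j - i)
            * po (A * Q ^ j * F * Q ^ i) (n - j - i))))"
    unfolding sum_distrib_left
  proof (intro sum.cong refl, goal_cases)
    case (1 j i)
    then have ji: "j + i \<le> n" by auto
    have "po (T * X * Y * Q ^ j) (n - j) = po (T * X * Y * Q ^ j) i * po (T * X * Y * Q ^ (j + i)) (n - (j + i))"
      using po_add[of "T * X * Y * Q ^ j" i "n - (j + i)"] ji by (simp add: power_add mult_ac)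
    moreover have "f (j + i) j = (hq n (j + i) * qbin (j + i) j) * (po A j * po (A * Q ^ j) i
        * po (E * Q ^ (j + i)) (n - (j + i)) * po (A * F * Q ^ (j + i)) (n - (j + i))
        * po (T * X * Y * Q ^ (j + i)) (n - (j + i)) * (po X j * po Y j * T ^ j * po T i * po (T * X * Y * Q ^ j) i))"
      by (simp add: f_def po_add mult_ac)
    ultimately show ?case
      unfolding hq_split[OF ji] by (simp add: power_add mult_ac)
  qed
  also have "\<dots> = (\<Sum>j\<le>n. hq n j * (po A j * po X j * po Y j * T ^ j * po (T * X * Y * Q ^ j) (n - j))
       * (Q ^ (j * (n - j)) * hpo A E (n - j) * po F (n - j)))"
  proof (intro sum.cong refl, goal_cases)
    case (1 j)
    then have "Q ^ n = Q ^ j * Q ^ (n - j)"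
      by (metis power_add le_add_diff_inverse atMost_iff)
    then have "F = T * Q / (Q ^ (n - j) * (E * Q ^ j))"
      by (simp add: F mult_ac)
    then have "(\<Sum>i\<le>n - j. hq (n - j) i * (po (A * Q ^ j) i * po T i * po (E * Q ^ j * Q ^ i) (n - j - i)
            * po (A * Q ^ j * F * Q ^ i) (n - j - i))) = hpo (A * Q ^ j) (E * Q ^ j) (n - j) * po F (n - j)"
      using assms(1) by (intro saalschuetz_hq) simp_all
    also have "hpo (A * Q ^ j) (E * Q ^ j) (n - j) = Q ^ (j * (n - j)) * hpo A E (n - j)"
      using hpo_scale[of "Q ^ j" A E "n - j"] by (simp add: mult_ac power_mult)
    finally show ?case by simp
  qed
  also have "\<dots> = (\<Sum>j\<le>n. hq n j * (po A j * po X j * po Y j * T ^ j * po (T * X * Y * Q ^ j) (n - j)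
            * hpo A E (n - j) * po F (n - j) * Q ^ (j * (n - j))))"
    by (intro sum.cong) (simp_all add: mult_ac)
  finally show ?thesis .
qed

section \<open>Infinite products and a limit of Rogers' sum\<close>

lemma norm_po_le: "norm (po x n) \<le> exp (norm x / (1 - q))"
proof -
  have "norm (po x n) = (\<Prod>j<n. norm (1 - x * Q ^ j))"
    by (simp add: qpoch_def prod_norm)
  also have "\<dots> \<le> (\<Prod>j<n. exp (norm x * q ^ j))"
  proof (intro prod_mono conjI)
    fix j
    have "norm (1 - x * Q ^ j) \<le> 1 + norm x * q ^ j"
      using norm_triangle_ineq4[of 1 "x * Q ^ j"] q0 by (simp add: norm_mult norm_power)
    also have "\<dots> \<le> exp (norm x * q ^ j)"
      by (rule exp_ge_add_one_self)
    finally show "norm (1 - x * Q ^ j) \<le> exp (norm x * q ^ j)" .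
  qed simp
  also have "\<dots> = exp (norm x * (\<Sum>j<n. q ^ j))"
    by (simp add: exp_sum sum_distrib_left)
  also have "\<dots> \<le> exp (norm x * (1 / (1 - q)))"
  proof -
    have "(\<Sum>j<n. q ^ j) \<le> (\<Sum>j. q ^ j)"
      using q0 q1 by (intro sum_le_suminf) (auto intro!: summable_geometric)
    also have "\<dots> = 1 / (1 - q)"
      using q0 q1 by (intro suminf_geometric) auto
    finally show ?thesis by (intro iffD2[OF exp_le_cancel_iff] mult_left_mono) auto
  qed
  finally show ?thesis by simp
qed

lemma convergent_prod_po: "convergent_prod (\<lambda>j. 1 - x * Q ^ j)"
proof (rule abs_convergent_prod_imp_convergent_prod)
  have "summable (\<lambda>j. norm x * q ^ j)"
    using q0 q1 by (intro summable_mult summable_geometric) auto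
  then show "abs_convergent_prod (\<lambda>j. 1 - x * Q ^ j)"
    using q0 by (intro summable_imp_abs_convergent_prod) (simp add: norm_mult norm_power)
qed

lemma po_tendsto: "po x \<longlonglongrightarrow> poi x"
  using convergent_prod_LIMSEQ[OF convergent_prod_po, of x]
  by (simp add: qpoch_def[abs_def] qpoch_inf_def LIMSEQ_lessThan_iff_atMost)

lemma norm_poi_le: "norm (poi x) \<le> exp (norm x / (1 - q))"
  by (rule LIMSEQ_le_const2[OF tendsto_norm[OF po_tendsto[of x]]]) (auto intro: norm_po_le)

lemma poi_nz: "(\<And>k. x * Q ^ k \<noteq> 1) \<Longrightarrow> poi x \<noteq> 0"
  unfolding qpoch_inf_def by (rule prodinf_nonzero[OF convergent_prod_po]) force

lemma poi_split: "poi x = po x n * poi (x * Q ^ n)"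
proof (rule LIMSEQ_unique)
  show "(\<lambda>k. po x (n + k)) \<longlonglongrightarrow> poi x"
    using LIMSEQ_ignore_initial_segment[OF po_tendsto, of x n] by (simp add: add.commute)
  show "(\<lambda>k. po x (n + k)) \<longlonglongrightarrow> po x n * poi (x * Q ^ n)"
    unfolding po_add by (intro tendsto_intros po_tendsto)
qed

lemma poi_eq_0: "x * Q ^ k = 1 \<Longrightarrow> poi x = 0"
  using poi_split[of x "Suc k"] by (auto simp: po_Suc)

text \<open>The reciprocals converge, since the infinite product is not zero, and are therefore
  bounded. This controls denominators uniformly in n.\<close>

lemma po_lower:
  assumes "\<And>k. x * Q ^ k \<noteq> 1"
  obtains \<delta> where "\<delta> > 0" "\<And>n. norm (po x n) \<ge> \<delta>"
proof -
  have "(\<lambda>n. inverse (po x n)) \<longlonglongrightarrow> inverse (poi x)"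
    by (intro tendsto_intros po_tendsto poi_nz assms)
  then have "Bseq (\<lambda>n. inverse (po x n))"
    by (intro convergent_imp_Bseq convergentI)
  then obtain K where K: "K > 0" "\<And>n. norm (inverse (po x n)) \<le> K"
    by (auto simp: Bseq_def)
  show ?thesis
  proof (rule that[of "1 / K"])
    fix n
    have "po x n \<noteq> 0" using assms po_nz by blast
    then show "1 / K \<le> norm (po x n)"
      using K(1) K(2)[of n] by (simp add: norm_inverse norm_divide field_simps)
  qed (use K in auto)
qed

text \<open>Telescopes, because x q^j (x; q)_j is the difference of two consecutive products. It
  presents the infinite product as a series, to which a majorant criterion for holomorphy
  applies.\<close>

lemma sum_power_po: "(\<Sum>j<n. x * Q ^ j * po x j) = 1 - po x n"
  by (induction n) (simp_all add: po_Suc algebra_simps)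

lemma poi_sums: "(\<lambda>j. x * Q ^ j * po x j) sums (1 - poi x)"
proof -
  have "(\<lambda>n. 1 - po x n) \<longlonglongrightarrow> 1 - poi x"
    by (intro tendsto_intros po_tendsto)
  then show ?thesis by (simp add: sums_def sum_power_po)
qed

section \<open>Holomorphy of series and infinite products\<close>

lemma holomorphic_suminf:
  fixes f :: "nat \<Rightarrow> complex \<Rightarrow> complex"
  assumes "\<And>n. f n holomorphic_on UNIV"
    and "\<And>R. \<exists>M. summable M \<and> (\<forall>n x. norm x \<le> R \<longrightarrow> norm (f n x) \<le> M n)"
  shows "(\<lambda>x. \<Sum>n. f n x) holomorphic_on UNIV"
proof (rule holomorphic_uniform_sequence[where f = "\<lambda>N x. \<Sum>n<N. f n x"])
  fix x :: complex
  obtain M where M: "summable M" "\<And>n y. norm y \<le> norm x + 1 \<Longrightarrow> norm (f n y) \<le> M n"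
    using assms(2)[of "norm x + 1"] by blast
  have "uniform_limit (cball x 1) (\<lambda>N x. \<Sum>n<N. f n x) (\<lambda>x. \<Sum>n. f n x) sequentially"
  proof (rule Weierstrass_m_test[OF _ M(1)])
    fix n y assume "y \<in> cball x 1"
    then have "norm (y - x) \<le> 1" by (simp add: dist_norm norm_minus_commute)
    then have "norm y \<le> norm x + 1" using norm_triangle_ineq[of x "y - x"] by simp
    then show "norm (f n y) \<le> M n" by (rule M(2))
  qed
  then show "\<exists>d>0. cball x d \<subseteq> UNIV \<and> uniform_limit (cball x d) (\<lambda>N x. \<Sum>n<N. f n x) (\<lambda>x. \<Sum>n. f n x) sequentially"
    by (intro exI[of _ 1]) auto
qed (use assms(1) in \<open>auto intro!: holomorphic_intros\<close>)

lemma po_holomorphic [holomorphic_intros]: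
  "f holomorphic_on A \<Longrightarrow> (\<lambda>x. po (f x) n) holomorphic_on A"
  unfolding qpoch_def by (intro holomorphic_intros)

lemma poi_holomorphic: "poi holomorphic_on UNIV"
proof -
  have "(\<lambda>x. \<Sum>j. x * Q ^ j * po x j) holomorphic_on UNIV"
  proof (rule holomorphic_suminf)
    fix R :: real
    have *: "norm (x * Q ^ n * po x n) \<le> R * q ^ n * exp (R / (1 - q))" if "norm x \<le> R" for x n
    proof -
      have "norm (po x n) \<le> exp (norm x / (1 - q))" by (rule norm_po_le)
      also have "\<dots> \<le> exp (R / (1 - q))"
        using that q1 by (simp add: divide_right_mono)
      finally have "norm (po x n) \<le> exp (R / (1 - q))" .
      then show ?thesis
        using that q0 order_trans[OF norm_ge_zero that]
        by (auto simp: norm_mult norm_power intro!: mult_mono)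
    qed
    have "summable (\<lambda>n. R * q ^ n * exp (R / (1 - q)))"
      using q0 q1 by (intro summable_mult summable_mult2 summable_geometric) auto
    with * show "\<exists>M. summable M \<and> (\<forall>n x. norm x \<le> R \<longrightarrow> norm (x * Q ^ n * po x n) \<le> M n)"
      by blast
  qed (intro holomorphic_intros)
  then have "(\<lambda>x. 1 - (\<Sum>j. x * Q ^ j * po x j)) holomorphic_on UNIV"
    by (intro holomorphic_intros)
  then show ?thesis
    by (simp add: sums_unique[OF poi_sums, symmetric])
qed

lemma poi_holomorphic' [holomorphic_intros]:
  assumes "f holomorphic_on A"
  shows "(\<lambda>x. poi (f x)) holomorphic_on A"
  using holomorphic_on_compose_gen[OF assms poi_holomorphic] by (simp add: o_def)

section \<open>Exponential growth against the Gaussian factor q^(m(m-1)/2)\<close>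

definition tri :: "nat \<Rightarrow> nat" where "tri m = m * (m - 1) div 2"

lemma tri_0 [simp]: "tri 0 = 0"
  by (simp add: tri_def)

lemma tri_Suc: "tri (Suc m) = tri m + m"
proof -
  have "even (m * (m - 1))" by (cases m) auto
  moreover have "Suc m * m = m * (m - 1) + 2 * m" by (cases m) auto
  ultimately show ?thesis unfolding tri_def by simp
qed

lemma tri_add: "tri (m + n) = tri m + tri n + m * n"
  by (induction n) (simp_all add: tri_Suc)

text \<open>A class closed under products and differences, whose members all become summable when
  multiplied by \<open>Q ^ tri m\<close>. The convergence in m of the weighted series is reduced to
  membership in it.\<close>

definition exp_bd :: "(nat \<Rightarrow> complex) \<Rightarrow> bool" where
  "exp_bd f \<longleftrightarrow> (\<exists>C B. C \<ge> 0 \<and> B \<ge> 1 \<and> (\<forall>m. norm (f m) \<le> C * B ^ m))"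

lemma exp_bdI:
  assumes "\<And>m. norm (f m) \<le> C * B ^ m" "B \<ge> 0"
  shows "exp_bd f"
  unfolding exp_bd_def
proof (intro exI conjI allI)
  fix m
  have C: "C \<ge> 0"
    using assms(1)[of 0] by (simp add: order_trans[OF norm_ge_zero])
  have "norm (f m) \<le> C * B ^ m" by (rule assms)
  also have "\<dots> \<le> max C 0 * max B 1 ^ m"
    using assms(2) C by (intro mult_mono power_mono) auto
  finally show "norm (f m) \<le> max C 0 * max B 1 ^ m" .
qed auto

lemma exp_bdE:
  assumes "exp_bd f"
  obtains C B where "C \<ge> 0" "B \<ge> 1" "\<And>m. norm (f m) \<le> C * B ^ m"
  using assms by (auto simp: exp_bd_def)

lemma exp_bd_const: "exp_bd (\<lambda>m. c)"
  by (rule exp_bdI[of _ "norm c" 1]) auto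

lemma exp_bd_mult:
  assumes "exp_bd f" "exp_bd g"
  shows "exp_bd (\<lambda>m. f m * g m)"
proof -
  obtain C B where f: "C \<ge> 0" "B \<ge> 1" "\<And>m. norm (f m) \<le> C * B ^ m"
    using assms(1) by (rule exp_bdE) blast
  obtain C' B' where g: "C' \<ge> 0" "B' \<ge> 1" "\<And>m. norm (g m) \<le> C' * B' ^ m"
    using assms(2) by (rule exp_bdE) blast
  show ?thesis
  proof (rule exp_bdI)
    fix m
    have "norm (f m * g m) \<le> (C * B ^ m) * (C' * B' ^ m)"
      using f g by (auto simp: norm_mult intro!: mult_mono)
    then show "norm (f m * g m) \<le> (C * C') * (B * B') ^ m"
      by (simp add: power_mult_distrib mult_ac)
  qed (use f g in auto)
qed

lemma exp_bd_diff:
  assumes "exp_bd f" "exp_bd g"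
  shows "exp_bd (\<lambda>m. f m - g m)"
proof -
  obtain C B where f: "C \<ge> 0" "B \<ge> 1" "\<And>m. norm (f m) \<le> C * B ^ m"
    using assms(1) by (rule exp_bdE) blast
  obtain C' B' where g: "C' \<ge> 0" "B' \<ge> 1" "\<And>m. norm (g m) \<le> C' * B' ^ m"
    using assms(2) by (rule exp_bdE) blast
  show ?thesis
  proof (rule exp_bdI)
    fix m
    have "norm (f m - g m) \<le> C * B ^ m + C' * B' ^ m"
      using f(3)[of m] g(3)[of m] norm_triangle_ineq4[of "f m" "g m"] by linarith
    also have "\<dots> \<le> C * max B B' ^ m + C' * max B B' ^ m"
      using f g by (intro add_mono mult_left_mono power_mono) auto
    finally show "norm (f m - g m) \<le> (C + C') * max B B' ^ m"
      by (simp add: algebra_simps)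
  qed (use f g in auto)
qed

lemma exp_bd_prod: "(\<And>i. i \<in> I \<Longrightarrow> exp_bd (f i)) \<Longrightarrow> exp_bd (\<lambda>m. \<Prod>i\<in>I. f i m)"
  by (induction I rule: infinite_finite_induct) (simp_all add: exp_bd_const exp_bd_mult)

lemma exp_bd_power: "exp_bd (\<lambda>m. c ^ m)"
  by (rule exp_bdI[of _ 1 "norm c"]) (auto simp: norm_power)

lemma exp_bd_divide_power: "exp_bd f \<Longrightarrow> exp_bd (\<lambda>m. f m / c ^ m)"
  using exp_bd_mult[OF _ exp_bd_power, of f "1 / c"] by (simp add: power_divide)

lemma exp_bd_po: "exp_bd (po x)"
  by (rule exp_bdI[of _ "exp (norm x / (1 - q))" 1]) (auto intro: norm_po_le)

lemma exp_bd_divide_po: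
  assumes "exp_bd f" "\<And>k. x * Q ^ k \<noteq> 1"
  shows "exp_bd (\<lambda>m. f m / po x m)"
proof -
  obtain \<delta> where d: "\<delta> > 0" "\<And>n. norm (po x n) \<ge> \<delta>"
    using po_lower[OF assms(2)] by blast
  have "exp_bd (\<lambda>m. 1 / po x m)"
  proof (rule exp_bdI[of _ "1 / \<delta>" 1])
    fix m
    have "1 / norm (po x m) \<le> 1 / \<delta>"
      using d(1) d(2)[of m] by (intro divide_left_mono) (auto intro!: mult_pos_pos)
    then show "norm (1 / po x m) \<le> 1 / \<delta> * 1 ^ m" by (simp add: norm_divide)
  qed simp
  from exp_bd_mult[OF assms(1) this] show ?thesis by simp
qed

lemma norm_hpo_le: "norm (hpo x y m) \<le> (norm x + norm y) ^ m"
proof (induction m)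
  case (Suc m)
  have "norm y * q ^ m \<le> norm y"
    using q0 q1 by (intro mult_left_le power_le_one) auto
  moreover have "norm (x - y * Q ^ m) \<le> norm x + norm y * q ^ m"
    using norm_triangle_ineq4[of x "y * Q ^ m"] q0 by (simp add: norm_mult norm_power)
  ultimately have "norm (x - y * Q ^ m) \<le> norm x + norm y"
    by linarith
  then have "norm (hpo x y m) * norm (x - y * Q ^ m) \<le> (norm x + norm y) ^ m * (norm x + norm y)"
    using Suc by (intro mult_mono) auto
  then show ?case
    unfolding hpo_Suc norm_mult by (simp add: mult_ac)
qed simp

lemma exp_bd_hpo: "exp_bd (hpo x y)"
  by (rule exp_bdI[of _ 1 "norm x + norm y"]) (auto intro: norm_hpo_le)

lemmas exp_bd_intros = exp_bd_mult exp_bd_divide_power exp_bd_divide_po exp_bd_power exp_bd_po exp_bd_hpo exp_bd_diff exp_bd_const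

lemma summable_gauss: "summable (\<lambda>m. C * B ^ m * q ^ tri m)" for C B :: real
proof -
  have "(\<lambda>n. \<bar>B\<bar> * q ^ n) \<longlonglongrightarrow> \<bar>B\<bar> * 0"
    using q0 q1 by (intro tendsto_intros LIMSEQ_power_zero) auto
  then have "eventually (\<lambda>n. \<bar>B\<bar> * q ^ n < 1 / 2) sequentially"
    by (rule order_tendstoD) simp
  then obtain N where N: "\<And>n. n \<ge> N \<Longrightarrow> \<bar>B\<bar> * q ^ n < 1 / 2"
    by (auto simp: eventually_sequentially)
  show ?thesis
  proof (rule summable_ratio_test[where c = "1 / 2" and N = N])
    fix n assume "n \<ge> N"
    have "norm (C * B ^ Suc n * q ^ tri (Suc n)) = (\<bar>B\<bar> * q ^ n) * norm (C * B ^ n * q ^ tri n)"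
      using q0 by (simp add: tri_Suc power_add abs_mult mult_ac)
    also have "\<dots> \<le> 1 / 2 * norm (C * B ^ n * q ^ tri n)"
      using N[OF \<open>n \<ge> N\<close>] by (intro mult_right_mono) auto
    finally show "norm (C * B ^ Suc n * q ^ tri (Suc n)) \<le> 1 / 2 * norm (C * B ^ n * q ^ tri n)" .
  qed simp
qed

lemma summable_exp_bd:
  assumes "exp_bd f"
  shows "summable (\<lambda>m. Q ^ tri m * f m)"
proof -
  obtain C B where f: "C \<ge> 0" "B \<ge> 1" "\<And>m. norm (f m) \<le> C * B ^ m"
    using assms(1) by (rule exp_bdE) blast
  show ?thesis
  proof (rule summable_comparison_test'[OF summable_gauss[of C B]])
    fix m
    have "norm (f m) * q ^ tri m \<le> (C * B ^ m) * q ^ tri m"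
      using f(3)[of m] q0 by (intro mult_right_mono) auto
    then show "norm (Q ^ tri m * f m) \<le> C * B ^ m * q ^ tri m"
      using q0 by (simp add: norm_mult norm_power mult_ac)
  qed
qed

text \<open>The very-well-poised 6phi5 term in s with further upper parameters sq/X, sq/Y and a
  third one sent to infinity. Writing X^n (sq/X; q)_n as \<open>hpo\<close> makes X = 0
  admissible.\<close>

definition vwp_term where
  "vwp_term s X Y n = (-1) ^ n * Q ^ tri n / (Q * s) ^ n * ((1 - s * Q ^ (2 * n)) / (1 - s))
     * (po s n / po Q n) * (hpo X (s * Q) n * hpo Y (s * Q) n / (po X n * po Y n))"

lemma vwp_term_summable:
  assumes "\<And>k. X * Q ^ k \<noteq> 1" "\<And>k. Y * Q ^ k \<noteq> 1"
  shows "summable (vwp_term s X Y)"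
proof -
  have "\<And>k. Q * Q ^ k \<noteq> 1"
    using Q_pow_neq_1[of "Suc _"] by simp
  then have "exp_bd (\<lambda>n. (-1) ^ n / (Q * s) ^ n * ((1 - s * (Q ^ 2) ^ n) * (1 / (1 - s)))
     * (po s n / po Q n) * (hpo X (s * Q) n * hpo Y (s * Q) n / po X n / po Y n))"
    using assms
    by (intro exp_bd_intros) assumption+
  from summable_exp_bd[OF this] show ?thesis
    unfolding vwp_term_def[abs_def] power_mult by (simp add: mult_ac)
qed

text \<open>The coefficients 1 - XY/(qs) and 1 - X are dictated by the ratio of the expected closed
  forms at X and Xq. For partial sums the relation holds up to an explicit boundary term.\<close>

lemma vwp_term_telescope:
  assumes "s \<noteq> 0" "s \<noteq> 1" and b: "\<And>k. X * Q ^ k \<noteq> 1" and c: "\<And>k. Y * Q ^ k \<noteq> 1"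
  shows "(1 - X * Y / (Q * s)) * (\<Sum>n<Suc m. vwp_term s (X * Q) Y n) - (1 - X) * (\<Sum>n<Suc m. vwp_term s X Y n)
    = - X * (-1) ^ m * Q ^ tri (Suc m) / (Q * s) ^ Suc m * (po (s * Q) m / po Q m)
      * (hpo Y (s * Q) (Suc m) * hpo X (s * Q) m / (po Y m * po (X * Q) m))"
proof (induction m)
  case 0
  show ?case using assms(1,2) by (simp add: vwp_term_def hpo_Suc tri_Suc field_simps)
next
  case (Suc m)
  define x where "x = Q ^ m"
  define D where "D = (-1) ^ m * Q ^ tri (Suc m) / (Q * s) ^ Suc m * (po (s * Q) m / po Q m)
      * (hpo Y (s * Q) (Suc m) * hpo X (s * Q) m / (po Y m * po (X * Q) m))"
  have n1: "1 - Q * x \<noteq> 0" using Q_pow_neq_1[of "Suc m"] by (simp add: x_def)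
  have n2: "1 - X * Q * x \<noteq> 0" using b[of "Suc m"] by (simp add: x_def mult_ac)
  have n3: "1 - Y * x \<noteq> 0" using c[of m] by (simp add: x_def)
  have n4: "1 - X \<noteq> 0" using b[of 0] by simp
  have pn: "po (X * Q) m \<noteq> 0" "po Y m \<noteq> 0"
    using b[of "Suc _"] c by (auto intro!: po_nz simp: mult_ac)
  have bm: "po X (Suc m) = (1 - X) * po (X * Q) m"
    by (rule po_rec)
  have hb: "hpo (X * Q) (s * Q) (Suc m) = Q ^ Suc m * ((X - s) * hpo X (s * Q) m)"
    using hpo_scale[of Q X s "Suc m"] by (simp add: hpo_rec mult_ac)
  have s1: "po s (Suc m) / (1 - s) = po (s * Q) m"
    using assms(2) by (simp add: po_rec)
  have t1: "vwp_term s (X * Q) Y (Suc m) =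
      - D * (1 - s * (Q * x) ^ 2) * (Q * x * (X - s)) / ((1 - Q * x) * (1 - X * Q * x) * (1 - Y * x))"
  proof -
    have "vwp_term s (X * Q) Y (Suc m) = (-1) ^ Suc m * Q ^ tri (Suc m) / (Q * s) ^ Suc m * (1 - s * Q ^ (2 * Suc m))
     * (po s (Suc m) / (1 - s) / po Q (Suc m)) * (hpo (X * Q) (s * Q) (Suc m) * hpo Y (s * Q) (Suc m) / (po (X * Q) (Suc m) * po Y (Suc m)))"
      by (simp add: vwp_term_def)
    also have "\<dots> = - D * (1 - s * (Q * x) ^ 2) * (Q * x * (X - s)) / ((1 - Q * x) * (1 - X * Q * x) * (1 - Y * x))"
      unfolding s1 hb unfolding D_def po_Suc[of _ m] by (simp add: x_def power_mult power_mult_distrib mult_ac power_even_eq power2_eq_square)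
    finally show ?thesis .
  qed
  have t2: "(1 - X) * vwp_term s X Y (Suc m) =
      - D * (1 - s * (Q * x) ^ 2) * (X - s * Q * x) / ((1 - Q * x) * (1 - Y * x))"
  proof -
    have "(1 - X) * vwp_term s X Y (Suc m) = (-1) ^ Suc m * Q ^ tri (Suc m) / (Q * s) ^ Suc m * (1 - s * Q ^ (2 * Suc m))
     * (po s (Suc m) / (1 - s) / po Q (Suc m)) * (hpo X (s * Q) (Suc m) * hpo Y (s * Q) (Suc m) / ((po X (Suc m) / (1 - X)) * po Y (Suc m)))"
      by (simp add: vwp_term_def mult_ac)
    also have "po X (Suc m) / (1 - X) = po (X * Q) m"
      using n4 by (simp add: bm)
    also have "(-1) ^ Suc m * Q ^ tri (Suc m) / (Q * s) ^ Suc m * (1 - s * Q ^ (2 * Suc m))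
     * (po s (Suc m) / (1 - s) / po Q (Suc m)) * (hpo X (s * Q) (Suc m) * hpo Y (s * Q) (Suc m) / (po (X * Q) m * po Y (Suc m)))
     = - D * (1 - s * (Q * x) ^ 2) * (X - s * Q * x) / ((1 - Q * x) * (1 - Y * x))"
      unfolding s1 unfolding D_def po_Suc[of _ m] hpo_Suc[of X _ m] by (simp add: x_def power_mult power_mult_distrib mult_ac power_even_eq power2_eq_square)
    finally show ?thesis .
  qed
  have g: "- X * (-1) ^ Suc m * Q ^ tri (Suc (Suc m)) / (Q * s) ^ Suc (Suc m) * (po (s * Q) (Suc m) / po Q (Suc m))
      * (hpo Y (s * Q) (Suc (Suc m)) * hpo X (s * Q) (Suc m) / (po Y (Suc m) * po (X * Q) (Suc m)))
    = D * X * (Q * x) / (Q * s) * (1 - s * Q * x) * (Y - s * Q * (Q * x)) * (X - s * Q * x)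
       / ((1 - Q * x) * (1 - X * Q * x) * (1 - Y * x))"
    unfolding D_def tri_Suc[of "Suc m"] power_add po_Suc[of _ m] hpo_Suc[of _ _ "Suc m"] hpo_Suc[of X _ m]
    by (simp add: x_def mult_ac)
  \<comment> \<open>Once the common factor D is extracted, the induction step is this rational
    identity in x = q^m.\<close>
  have "(1 - X * Y / (Q * s)) * (- D * (1 - s * (Q * x) ^ 2) * (Q * x * (X - s)) / ((1 - Q * x) * (1 - X * Q * x) * (1 - Y * x)))
     - (- D * (1 - s * (Q * x) ^ 2) * (X - s * Q * x) / ((1 - Q * x) * (1 - Y * x))) - X * D
    = D * X * (Q * x) / (Q * s) * (1 - s * Q * x) * (Y - s * Q * (Q * x)) * (X - s * Q * x)
       / ((1 - Q * x) * (1 - X * Q * x) * (1 - Y * x))"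
    using assms(1) n1 n2 n3 by (simp add: divide_simps) (simp add: algebra_simps power2_eq_square)
  moreover have "(1 - X * Y / (Q * s)) * (\<Sum>n<Suc m. vwp_term s (X * Q) Y n) - (1 - X) * (\<Sum>n<Suc m. vwp_term s X Y n)
     = - X * D"
    unfolding Suc.IH D_def by simp
  moreover have "a * (S + t) - b * (S' + t') = a * t - b * t' - e"
    if "a * S - b * S' = - e" for a b e t t' S S' :: complex
    using that by (simp add: algebra_simps)
  ultimately show ?case
    unfolding sum.lessThan_Suc[of _ "Suc m"] g using t1 t2 by (metis mult_minus_left)
qed

lemma Q_Q_pow_neq_1: "Q * Q ^ k \<noteq> 1"
  using Q_pow_neq_1[of "Suc k"] by simp

text \<open>The boundary term carries a Gaussian factor and tends to 0, which leaves an exact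
  relation between the full sums.\<close>

lemma vwp_term_step:
  assumes "s \<noteq> 0" "s \<noteq> 1" and b: "\<And>k. X * Q ^ k \<noteq> 1" and c: "\<And>k. Y * Q ^ k \<noteq> 1"
  shows "(1 - X * Y / (Q * s)) * (\<Sum>n. vwp_term s (X * Q) Y n) = (1 - X) * (\<Sum>n. vwp_term s X Y n)"
proof -
  define G where "G m = Q ^ tri m * (- X * (-1) ^ m * Q ^ m / (Q * s) ^ m * (1 / (Q * s)) * (po (s * Q) m / po Q m)
      * (hpo Y (s * Q) m * (Y - s * Q * Q ^ m) * hpo X (s * Q) m / po Y m / po (X * Q) m))" for m
  have b': "X * Q * Q ^ k \<noteq> 1" for k
    using b[of "Suc k"] by (simp add: mult_ac)
  have "exp_bd (\<lambda>m. - X * (-1) ^ m * Q ^ m / (Q * s) ^ m * (1 / (Q * s)) * (po (s * Q) m / po Q m)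
      * (hpo Y (s * Q) m * (Y - s * Q * Q ^ m) * hpo X (s * Q) m / po Y m / po (X * Q) m))"
    using c b' Q_Q_pow_neq_1
    by (intro exp_bd_intros) assumption+
  then have "G \<longlonglongrightarrow> 0"
    unfolding G_def[abs_def] by (intro summable_LIMSEQ_zero summable_exp_bd)
  moreover have "G = (\<lambda>m. (1 - X * Y / (Q * s)) * (\<Sum>n<Suc m. vwp_term s (X * Q) Y n) - (1 - X) * (\<Sum>n<Suc m. vwp_term s X Y n))"
    unfolding vwp_term_telescope[OF assms] G_def[abs_def] by (rule ext) (simp add: tri_Suc power_add hpo_Suc mult_ac)
  moreover have "\<dots> \<longlonglongrightarrow> (1 - X * Y / (Q * s)) * (\<Sum>n. vwp_term s (X * Q) Y n) - (1 - X) * (\<Sum>n. vwp_term s X Y n)"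
    by (intro tendsto_intros LIMSEQ_Suc[OF summable_LIMSEQ] vwp_term_summable b b' c)
  ultimately show ?thesis
    using LIMSEQ_unique by fastforce
qed

lemma vwp_term_iter:
  assumes "s \<noteq> 0" "s \<noteq> 1" and b: "\<And>k. X * Q ^ k \<noteq> 1" and c: "\<And>k. Y * Q ^ k \<noteq> 1"
  shows "po (X * Y / (Q * s)) N * (\<Sum>n. vwp_term s (X * Q ^ N) Y n) = po X N * (\<Sum>n. vwp_term s X Y n)"
proof (induction N)
  case (Suc N)
  have b': "X * Q ^ N * Q ^ k \<noteq> 1" for k
    using b[of "N + k"] by (simp add: power_add mult_ac)
  have "(1 - X * Q ^ N * Y / (Q * s)) * (\<Sum>n. vwp_term s (X * Q ^ N * Q) Y n) = (1 - X * Q ^ N) * (\<Sum>n. vwp_term s (X * Q ^ N) Y n)"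
    by (rule vwp_term_step[OF assms(1,2) b' c])
  then have "po (X * Y / (Q * s)) (Suc N) * (\<Sum>n. vwp_term s (X * Q ^ Suc N) Y n)
     = (1 - X * Q ^ N) * (po (X * Y / (Q * s)) N * (\<Sum>n. vwp_term s (X * Q ^ N) Y n))"
    by (simp add: po_Suc mult_ac)
  then show ?case by (simp add: Suc po_Suc)
qed simp

text \<open>Tannery's theorem. The majorant has to serve all shifts X q^N at once.\<close>

lemma vwp_term_tendsto:
  assumes b: "\<And>k. X * Q ^ k \<noteq> 1" and c: "\<And>k. Y * Q ^ k \<noteq> 1"
  shows "(\<lambda>N. \<Sum>n. vwp_term s (X * Q ^ N) Y n) \<longlonglongrightarrow> (\<Sum>n. vwp_term s 0 Y n)"
proof -
  define r where "r n = (-1) ^ n / (Q * s) ^ n * ((1 - s * (Q ^ 2) ^ n) * (1 / (1 - s)))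
     * (po s n / po Q n) * (hpo Y (s * Q) n / po Y n)" for n
  have r: "vwp_term s x Y n = Q ^ tri n * r n * (hpo x (s * Q) n / po x n)" for x n
    unfolding r_def vwp_term_def power_mult by (simp add: mult_ac)
  have "exp_bd r"
    unfolding r_def[abs_def] using c Q_Q_pow_neq_1
    by (intro exp_bd_intros) assumption+
  then obtain C B where CB: "C \<ge> 0" "B \<ge> 1" "\<And>n. norm (r n) \<le> C * B ^ n"
    by (rule exp_bdE) blast
  obtain \<delta> where d: "\<delta> > 0" "\<And>n. norm (po X n) \<ge> \<delta>"
    using po_lower[OF b] by blast
  define K where "K = exp (norm X / (1 - q)) / \<delta>"
  have Q1: "norm (X * Q ^ N) \<le> norm X" for N
    using q0 q1 by (simp add: norm_mult norm_power mult_left_le power_le_one)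
  \<comment> \<open>From (X; q)_(N+n) = (X; q)_N (X q^N; q)_n: the left side is bounded below and
    the first factor on the right above, uniformly in N and n.\<close>
  have lower: "1 / norm (po (X * Q ^ N) n) \<le> K" for N n
  proof -
    have "po X (N + n) = po X N * po (X * Q ^ N) n" by (rule po_add)
    then have "\<delta> \<le> norm (po X N) * norm (po (X * Q ^ N) n)"
      using d(2)[of "N + n"] by (simp add: norm_mult)
    also have "\<dots> \<le> exp (norm X / (1 - q)) * norm (po (X * Q ^ N) n)"
      by (intro mult_right_mono norm_po_le) auto
    finally have le: "\<delta> \<le> exp (norm X / (1 - q)) * norm (po (X * Q ^ N) n)" .
    then have "norm (po (X * Q ^ N) n) > 0"
      using d(1) by (metis less_le_trans mult_zero_right norm_ge_zero order_le_less order_less_irrefl)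
    then show ?thesis using le d(1) by (simp add: K_def divide_simps mult_ac)
  qed
  have "((\<lambda>N. \<Sum>n. vwp_term s (X * Q ^ N) Y n) \<longlonglongrightarrow> (\<Sum>n. vwp_term s 0 Y n))"
  proof (rule tannerys_theorem[THEN conjunct2, THEN conjunct2])
    fix n
    have "(\<lambda>N. X * Q ^ N) \<longlonglongrightarrow> X * 0"
      using q0 q1 by (intro tendsto_intros LIMSEQ_power_zero) simp
    then have l: "(\<lambda>N. X * Q ^ N) \<longlonglongrightarrow> 0" by simp
    have "(\<lambda>N. hpo (X * Q ^ N) (s * Q) n / po (X * Q ^ N) n) \<longlonglongrightarrow> hpo 0 (s * Q) n / po 0 n"
      unfolding hpo_def qpoch_def by (intro tendsto_intros l) auto
    then show "(\<lambda>N. vwp_term s (X * Q ^ N) Y n) \<longlonglongrightarrow> vwp_term s 0 Y n"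
      unfolding r by (rule tendsto_mult[OF tendsto_const])
  next
    show "\<forall>\<^sub>F (n, N) in sequentially \<times>\<^sub>F sequentially. norm (vwp_term s (X * Q ^ N) Y n)
        \<le> C * K * (B * (norm X + norm (s * Q))) ^ n * q ^ tri n"
    proof (intro always_eventually allI, clarify)
      fix n N
      have "norm (vwp_term s (X * Q ^ N) Y n) =
          q ^ tri n * norm (r n) * (norm (hpo (X * Q ^ N) (s * Q) n) * (1 / norm (po (X * Q ^ N) n)))"
        using q0 unfolding r by (simp add: norm_mult norm_power norm_divide)
      also have "\<dots> \<le> q ^ tri n * (C * B ^ n) * ((norm X + norm (s * Q)) ^ n * K)"
      proof (intro mult_mono CB lower)
        have "norm (hpo (X * Q ^ N) (s * Q) n) \<le> (norm (X * Q ^ N) + norm (s * Q)) ^ n"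
          by (rule norm_hpo_le)
        also have "\<dots> \<le> (norm X + norm (s * Q)) ^ n"
          using Q1 by (intro power_mono add_right_mono) auto
        finally show "norm (hpo (X * Q ^ N) (s * Q) n) \<le> (norm X + norm (s * Q)) ^ n" .
      qed (use q0 CB in auto)
      finally show "norm (vwp_term s (X * Q ^ N) Y n) \<le> C * K * (B * (norm X + norm (s * Q))) ^ n * q ^ tri n"
        by (simp add: power_mult_distrib mult_ac)
    qed
  qed (auto intro: summable_gauss)
  then show ?thesis .
qed

(* A limit case of Rogers' 6phi5 sum. Iterating X -> X q moves X to 0; the value there is
   read off at X = s q, where the series reduces to its first term. *)
lemma vwp_sum:
  assumes s: "s \<noteq> 0" "\<And>k. s * Q ^ k \<noteq> 1" and b: "\<And>k. X * Q ^ k \<noteq> 1" and c: "\<And>k. Y * Q ^ k \<noteq> 1"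
  shows "(\<Sum>n. vwp_term s X Y n) = poi (s * Q) * poi (X * Y / (Q * s)) / (poi X * poi Y)"
proof -
  have s1: "s \<noteq> 1" using s(2)[of 0] by simp
  have star: "poi (x * Y / (Q * s)) * (\<Sum>n. vwp_term s 0 Y n) = poi x * (\<Sum>n. vwp_term s x Y n)"
    if x: "\<And>k. x * Q ^ k \<noteq> 1" for x
  proof (rule LIMSEQ_unique)
    show "(\<lambda>N. po (x * Y / (Q * s)) N * (\<Sum>n. vwp_term s (x * Q ^ N) Y n)) \<longlonglongrightarrow> poi (x * Y / (Q * s)) * (\<Sum>n. vwp_term s 0 Y n)"
      by (intro tendsto_intros po_tendsto vwp_term_tendsto x c)
    show "(\<lambda>N. po (x * Y / (Q * s)) N * (\<Sum>n. vwp_term s (x * Q ^ N) Y n)) \<longlonglongrightarrow> poi x * (\<Sum>n. vwp_term s x Y n)"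
      unfolding vwp_term_iter[OF s(1) s1 x c] by (intro tendsto_intros po_tendsto)
  qed
  have "s * Q * Q ^ k \<noteq> 1" for k using s(2)[of "Suc k"] by (simp add: mult_ac)
  note star' = star[OF this]
  have "(\<Sum>n. vwp_term s (s * Q) Y n) = (\<Sum>n\<in>{0}. vwp_term s (s * Q) Y n)"
  proof (rule suminf_finite)
    fix n :: nat assume "n \<notin> {0}"
    then obtain m where "n = Suc m" by (cases n) auto
    then show "vwp_term s (s * Q) Y n = 0" by (simp add: vwp_term_def hpo_rec)
  qed simp
  also have "\<dots> = 1" using s1 by (simp add: vwp_term_def)
  finally have "poi Y * (\<Sum>n. vwp_term s 0 Y n) = poi (s * Q)"
    using star' s(1) by (simp add: mult_ac)
  moreover have "poi Y \<noteq> 0" "poi X \<noteq> 0" using poi_nz[OF b] poi_nz[OF c] by blast+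
  moreover have "(\<Sum>n. vwp_term s X Y n) * (poi X * poi Y) =
      poi (X * Y / (Q * s)) * (poi Y * (\<Sum>n. vwp_term s 0 Y n))"
    using star[OF b] by (metis mult.commute mult.left_commute)
  ultimately show ?thesis by (simp add: nonzero_eq_divide_eq mult_ac)
qed

section \<open>The weights of the expansion\<close>

lemma power_2_tri: "Q ^ (i * i) = Q ^ (tri i) * Q ^ (tri i) * Q ^ i"
proof -
  have "i * i = tri i + tri i + i"
    by (induction i) (simp_all add: tri_Suc)
  then show ?thesis by (simp flip: power_add)
qed

lemma po_minus_power:
  assumes "i \<le> N"
  shows "po (1 / Q ^ N) i = (-1) ^ i * Q ^ tri i / Q ^ (N * i) * (po Q N / po Q (N - i))"
  using assms
proof (induction i)
  case (Suc i)
  obtain M where N: "N = Suc (i + M)"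
    using Suc.prems less_imp_Suc_add Suc_le_lessD by blast
  have n: "1 - Q * Q ^ M \<noteq> 0" using Q_Q_pow_neq_1[of M] by simp
  have "1 - 1 / Q ^ N * Q ^ i = - (Q ^ i / Q ^ N) * (1 - Q * Q ^ M)"
    by (simp add: N power_add field_simps)
  then have "po (1 / Q ^ N) (Suc i) = (-1) ^ i * Q ^ tri i / Q ^ (N * i) * (po Q N / po Q (Suc M))
      * (- (Q ^ i / Q ^ N) * (1 - Q * Q ^ M))"
    using Suc by (simp add: po_Suc[of _ i] N)
  also have "\<dots> = (-1) ^ Suc i * Q ^ tri (Suc i) / Q ^ (N * Suc i) * (po Q N / po Q (N - Suc i))"
    using n by (simp add: po_Suc[of _ M] N tri_Suc power_add mult_ac)
  finally show ?case .
qed simp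

lemma po_minus_power_r:
  assumes "r \<noteq> 0"
  shows "po (1 / (r * Q ^ j)) j = (-1) ^ j / r ^ j * Q ^ tri j / Q ^ (j * j) * po (Q * r) j"
proof -
  have "po (1 / (r * Q ^ j)) j = (\<Prod>i<j. - 1 / (r * Q * Q ^ i)) * hpo 1 (r * Q) j"
    using po_reverse[of "r * Q" 1 j] assms by (simp add: mult_ac)
  also have "(\<Prod>i<j. - 1 / (r * Q * Q ^ i)) = (-1) ^ j / r ^ j * Q ^ tri j / Q ^ (j * j)"
  proof (induction j)
    case (Suc j)
    have "Q ^ (Suc j * Suc j) = Q ^ (j * j) * Q ^ j * Q ^ j * Q"
      by (simp add: power_add)
    with Suc show ?case by (simp add: tri_Suc power_add)
  qed simp
  finally show ?thesis by (simp add: hpo_1 mult_ac)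
qed

lemma vandermonde_rev: "(\<Sum>i\<le>n. qbin n i * (po T i * T ^ (n - i) * po A (n - i))) = po (T * A) n"
proof -
  have "(\<Sum>i\<le>n. qbin n i * (po T i * T ^ (n - i) * po A (n - i))) =
        (\<Sum>k\<le>n. qbin n (n - k) * (po T (n - k) * T ^ k * po A k))"
    by (rule sum.reindex_bij_witness[of _ "\<lambda>k. n - k" "\<lambda>k. n - k"]) auto
  also have "\<dots> = (\<Sum>k\<le>n. qbin n k * (po A k * T ^ k * po T (n - k)))"
    by (intro sum.cong) (simp_all add: qbin_sym mult_ac)
  finally show ?thesis using vandermonde by simp
qed

text \<open>The factor (q^-j; q)_h removes the terms with j < h. In terms of j - h the rest is a
  q-Vandermonde sum with A q^h and U q^h.\<close>

lemma vandermonde_shift: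
  assumes "A \<noteq> 0"
  shows "(\<Sum>j\<le>n. qbin n j * (po A j * hpo A U (n - j)) * po (1 / Q ^ j) h)
    = po (1 / Q ^ n) h * po A h * po (U * Q ^ h) (n - h)"
proof (cases "h \<le> n")
  case True
  have "(\<Sum>j\<le>n. qbin n j * (po A j * hpo A U (n - j)) * po (1 / Q ^ j) h)
      = (\<Sum>j\<in>{h..n}. qbin n j * (po A j * hpo A U (n - j)) * po (1 / Q ^ j) h)"
    by (rule sum.mono_neutral_right) (auto simp: po_minus_pow_eq_0)
  also have "\<dots> = (\<Sum>i\<le>n - h. po (1 / Q ^ n) h * po A h *
      (qbin (n - h) i * (po (A * Q ^ h) i * hpo (A * Q ^ h) (U * Q ^ h) (n - h - i))))"
  proof (rule sum.reindex_bij_witness[of _ "\<lambda>i. i + h" "\<lambda>j. j - h"])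
    fix j assume "j \<in> {h..n}"
    then obtain i where j: "j = h + i" "h + i \<le> n"
      using le_Suc_ex by (metis atLeastAtMost_iff)
    obtain M where n: "n = h + i + M" using j(2) le_Suc_ex by blast
    have p1: "po (1 / Q ^ j) h = (-1) ^ h * Q ^ tri h / Q ^ (j * h) * (po Q j / po Q i)"
      using po_minus_power[of h j] by (simp add: j)
    have p2: "po (1 / Q ^ n) h = (-1) ^ h * Q ^ tri h / Q ^ (n * h) * (po Q n / po Q (i + M))"
      using po_minus_power[of h n] by (simp add: n)
    have b1: "qbin n j = po Q n / (po Q j * po Q M)"
      by (simp add: qbin_def n j)
    have b2: "qbin (n - h) i = po Q (i + M) / (po Q i * po Q M)"
      by (simp add: qbin_def n)
    have e: "Q ^ (n * h) = Q ^ (j * h) * (Q ^ h) ^ M"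
      by (simp add: n j power_mult[symmetric] power_add[symmetric] algebra_simps)
    have hs: "hpo (A * Q ^ h) (U * Q ^ h) M = (Q ^ h) ^ M * hpo A U M"
      using hpo_scale[of "Q ^ h" A U M] by (simp add: mult_ac)
    have "qbin n j * po (1 / Q ^ j) h = po (1 / Q ^ n) h * qbin (n - h) i * (Q ^ h) ^ M"
      unfolding p1 p2 b1 b2 e by (simp add: mult_ac)
    then show "po (1 / Q ^ n) h * po A h * (qbin (n - h) (j - h) * (po (A * Q ^ h) (j - h) * hpo (A * Q ^ h) (U * Q ^ h) (n - h - (j - h)))) =
      qbin n j * (po A j * hpo A U (n - j)) * po (1 / Q ^ j) h"
      using hs by (simp add: j n po_add mult_ac)
  qed (use True in auto)
  also have "\<dots> = po (1 / Q ^ n) h * po A h * po (U * Q ^ h) (n - h)"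
    unfolding sum_distrib_left[symmetric] using assms by (subst vandermonde_hpo) simp_all
  finally show ?thesis .
next
  case False
  then show ?thesis by (simp add: po_minus_pow_eq_0)
qed

text \<open>Separates i from j in (X; q)_(i+j) q^(-ij), at the price of a new index h. The terms
  with h > min(i, j) vanish, so any bound N >= j gives a range independent of i and j.\<close>

lemma po_add_expand:
  assumes "\<And>k. X * Q ^ k \<noteq> 1" "j \<le> N" "X \<noteq> 0"
  shows "po X (i + j) / Q ^ (i * j) = po X i * po X j * (\<Sum>h\<le>N. hq i h * po (1 / Q ^ j) h / po X h)"
proof -
  have nz: "po X h \<noteq> 0" for h using assms(1) by (rule po_nz)
  have *: "po X i = po X h * po (X * Q ^ h) (i - h)" if "h \<le> i" for h
    using that by (rule po_split)
  have "hpo (1 / Q ^ j) X i = (\<Sum>h\<le>i. hq i h * (po (1 / Q ^ j) h * po (X * Q ^ h) (i - h)))"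
    using saalschuetz_hq[of X 0 0 i "1 / Q ^ j"] assms(3) by simp
  also have "\<dots> = (\<Sum>h\<le>i. po X i * (hq i h * po (1 / Q ^ j) h / po X h))"
    by (intro sum.cong refl) (use nz * in \<open>simp add: field_simps\<close>)
  also have "\<dots> = (\<Sum>h\<le>max i N. po X i * (hq i h * po (1 / Q ^ j) h / po X h))"
    by (rule sum.mono_neutral_left) (auto simp: hq_def po_minus_pow_eq_0)
  also have "\<dots> = (\<Sum>h\<le>N. po X i * (hq i h * po (1 / Q ^ j) h / po X h))"
    by (rule sum.mono_neutral_right) (use assms(2) in \<open>auto simp: po_minus_pow_eq_0\<close>)
  finally have *: "hpo (1 / Q ^ j) X i = po X i * (\<Sum>h\<le>N. hq i h * po (1 / Q ^ j) h / po X h)"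
    by (simp add: sum_distrib_left)
  have "hpo (1 / Q ^ j) X i = po (X * Q ^ j) i / Q ^ (i * j)"
    by (simp add: hpo_po power_divide power_mult[symmetric] mult.commute)
  moreover have "po X (i + j) = po X j * po (X * Q ^ j) i"
    using po_add[of X j i] by (simp add: add.commute)
  ultimately have "po X (i + j) / Q ^ (i * j) = po X j * hpo (1 / Q ^ j) X i" by simp
  then show ?thesis by (simp add: * )
qed

text \<open>The last j factors of (1/(r q^n); q)_n, reversed, give (qr; q)_j, and the remaining
  powers of q cancel against those in (q^-n; q)_j.\<close>

lemma hq_po_r:
  assumes "r \<noteq> 0" "j \<le> n"
  shows "hq n j * Q ^ (j * (n - j)) / (Q * r) ^ j * po (1 / (r * Q ^ n)) (n - j) * po (Q * r) j
    = po (1 / (r * Q ^ n)) n * qbin n j"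
proof -
  obtain M where n: "n = j + M" using assms(2) le_Suc_ex by blast
  have "1 / (r * Q ^ n) * Q ^ M = 1 / (r * Q ^ j)"
    by (simp add: n power_add)
  then have "po (1 / (r * Q ^ n)) n = po (1 / (r * Q ^ n)) M * ((-1) ^ j / r ^ j * Q ^ tri j / Q ^ (j * j) * po (Q * r) j)"
    using po_split[of M n "1 / (r * Q ^ n)"] po_minus_power_r[OF assms(1), of j] by (simp add: n)
  moreover have "hq n j = (-1) ^ j * Q ^ tri j / Q ^ (n * j) * qbin n j * Q ^ j"
    using po_minus_power[of j n] by (simp add: hq_def qbin_def n)
  moreover have "Q ^ (n * j) = Q ^ (j * j) * Q ^ (j * M)"
    by (simp add: n algebra_simps power_add)
  ultimately show ?thesis
    using assms(1) by (simp add: n power_mult_distrib mult_ac)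
qed

text \<open>For u = ab, v = ac, r = ad/q this is abc/d, the parameter in which the expansion is
  very-well-poised.\<close>

definition sp where
  "sp u v r = u * v / (Q * r)"

text \<open>The list is stable under exchanging u and v and under (u, v, r) -> (u/r, v/r, 1/r), so
  both symmetries of the kernel stay within the hypothesis.\<close>

definition admissible where
  "admissible u v r \<longleftrightarrow> u \<noteq> 0 \<and> v \<noteq> 0 \<and> r \<noteq> 0 \<and>
     (\<forall>x\<in>{u, v, u / r, v / r, r, 1 / r, sp u v r}. \<forall>k. x * Q ^ k \<noteq> 1)"

lemma admissibleD:
  assumes "admissible u v r"
  shows "u \<noteq> 0" "v \<noteq> 0" "r \<noteq> 0" "sp u v r \<noteq> 0" "u * Q ^ k \<noteq> 1" "v * Q ^ k \<noteq> 1" "u / r * Q ^ k \<noteq> 1"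
    "v / r * Q ^ k \<noteq> 1" "r * Q ^ k \<noteq> 1" "1 / r * Q ^ k \<noteq> 1" "sp u v r * Q ^ k \<noteq> 1"
    "Q * r * Q ^ k \<noteq> 1"
proof -
  show "u \<noteq> 0" "v \<noteq> 0" "r \<noteq> 0" "sp u v r \<noteq> 0" "u * Q ^ k \<noteq> 1" "v * Q ^ k \<noteq> 1" "u / r * Q ^ k \<noteq> 1"
    "v / r * Q ^ k \<noteq> 1" "r * Q ^ k \<noteq> 1" "1 / r * Q ^ k \<noteq> 1" "sp u v r * Q ^ k \<noteq> 1"
    using assms by (auto simp: admissible_def sp_def)
  have "r * Q ^ Suc k \<noteq> 1" using assms unfolding admissible_def by blast
  then show "Q * r * Q ^ k \<noteq> 1" by (simp add: mult_ac)
qed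

lemma sp_flip: "r \<noteq> 0 \<Longrightarrow> sp (u / r) (v / r) (1 / r) = sp u v r"
  by (simp add: sp_def field_simps)

lemma sp_swap: "sp u v r = sp v u r"
  by (simp add: sp_def mult_ac)

lemma admissible_flip: "admissible u v r \<Longrightarrow> admissible (u / r) (v / r) (1 / r)"
  by (auto simp: admissible_def sp_flip)

lemma admissible_swap: "admissible u v r \<Longrightarrow> admissible v u r"
  by (auto simp: admissible_def sp_swap)

text \<open>The coefficient of E_m^+ E_m^+ in Stokman's expansion: since ad = qr, the factor (ad)^-m
  q^(m(m+1)/2) becomes r^-m \<open>Q ^ tri m\<close>.\<close>

definition wt where
  "wt u v r m = (-1) ^ m * Q ^ tri m / r ^ m * ((1 - sp u v r * Q ^ (2 * m)) / (1 - sp u v r))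
     * (po u m * po v m * po (sp u v r) m / (po (u / r) m * po (v / r) m * po Q m))"

text \<open>The part of the i-th term of E_m^+ that depends on m, up to normalization. It is zero
  for m < i.\<close>

definition bas where
  "bas s i m = po (1 / Q ^ m) i * po (s * Q ^ m) i"

lemma wt_swap: "wt u v r m = wt v u r m"
  by (simp add: wt_def sp_swap mult_ac)

lemma exp_bd_po_div: "exp_bd (\<lambda>m. po (x / Q ^ m) k)"
  unfolding qpoch_def
  by (intro exp_bd_prod exp_bd_diff exp_bd_mult exp_bd_divide_power exp_bd_const)

lemma exp_bd_po_mult: "exp_bd (\<lambda>m. po (x * Q ^ m) k)"
  unfolding qpoch_def
  by (intro exp_bd_prod exp_bd_diff exp_bd_mult exp_bd_power exp_bd_const)

lemma exp_bd_bas: "exp_bd (bas s i)"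
  unfolding bas_def[abs_def] by (intro exp_bd_mult exp_bd_po_div exp_bd_po_mult)

lemma wt_exp_bd:
  assumes "admissible u v r"
  obtains f where "exp_bd f" "\<And>m. wt u v r m = Q ^ tri m * f m"
proof
  show "exp_bd (\<lambda>m. (-1) ^ m / r ^ m * ((1 - sp u v r * (Q ^ 2) ^ m) * (1 / (1 - sp u v r)))
     * (po u m * po v m * po (sp u v r) m / po (u / r) m / po (v / r) m / po Q m))"
    using admissibleD[OF assms] Q_Q_pow_neq_1
    by (intro exp_bd_intros) assumption+
  show "wt u v r m = Q ^ tri m * ((-1) ^ m / r ^ m * ((1 - sp u v r * (Q ^ 2) ^ m) * (1 / (1 - sp u v r)))
     * (po u m * po v m * po (sp u v r) m / po (u / r) m / po (v / r) m / po Q m))" for m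
    unfolding wt_def power_mult by (simp add: mult_ac)
qed

lemma wt_summable:
  assumes "admissible u v r" "exp_bd g"
  shows "summable (\<lambda>m. wt u v r m * g m)"
proof -
  obtain f where f: "exp_bd f" "\<And>m. wt u v r m = Q ^ tri m * f m"
    using wt_exp_bd[OF assms(1)] by blast
  show ?thesis
    using summable_exp_bd[OF exp_bd_mult[OF f(1) assms(2)]] by (simp add: f(2) mult_ac)
qed

lemma wt_suminf_sum:
  assumes "admissible u v r" "\<And>i. i \<in> I \<Longrightarrow> exp_bd (g i)" "\<And>i. i \<in> I \<Longrightarrow> (\<Sum>m. wt u v r m * g i m) = S i"
  shows "(\<Sum>m. wt u v r m * (\<Sum>i\<in>I. c i * g i m)) = (\<Sum>i\<in>I. c i * S i)"
proof -
  have "(\<Sum>m. wt u v r m * (\<Sum>i\<in>I. c i * g i m)) = (\<Sum>m. \<Sum>i\<in>I. c i * (wt u v r m * g i m))"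
    by (simp add: sum_distrib_left mult_ac)
  also have "\<dots> = (\<Sum>i\<in>I. \<Sum>m. c i * (wt u v r m * g i m))"
    by (rule suminf_sum) (intro summable_mult wt_summable assms)
  also have "\<dots> = (\<Sum>i\<in>I. c i * S i)"
    by (intro sum.cong refl) (subst suminf_mult, auto intro!: wt_summable assms simp: assms(3))
  finally show ?thesis .
qed

text \<open>The total mass of the weights, as the case i = 0 of \<open>wt_bas\<close> shows.\<close>

definition wtC where
  "wtC u v r = poi (sp u v r * Q) * poi (1 / r) / (poi (u / r) * poi (v / r))"

lemma bas_shift:
  "bas s i (i + n) * po s (i + n) / po Q (i + n) * Q ^ tri (i + n)
    = (-1) ^ i / Q ^ i * po s (2 * i) * Q ^ tri n * po (s * Q ^ (2 * i)) n / po Q n"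
proof -
  have "po s (i + n) * po (s * Q ^ (i + n)) i = po s (2 * i) * po (s * Q ^ (2 * i)) n"
    unfolding po_add[symmetric] by (simp add: mult_2 add_ac)
  moreover have "po (1 / Q ^ (i + n)) i = (-1) ^ i * Q ^ tri i / Q ^ ((i + n) * i) * (po Q (i + n) / po Q n)"
    using po_minus_power[of i "i + n"] by simp
  ultimately have "bas s i (i + n) * po s (i + n) / po Q (i + n) * Q ^ tri (i + n)
     = (-1) ^ i * Q ^ tri i / Q ^ ((i + n) * i) * (po s (2 * i) * po (s * Q ^ (2 * i)) n) / po Q n * Q ^ tri (i + n)"
    by (simp add: bas_def mult_ac)
  moreover have "Q ^ ((i + n) * i) = Q ^ tri i * Q ^ tri i * Q ^ i * Q ^ (i * n)"
    unfolding power_2_tri[symmetric] by (simp add: algebra_simps power_add)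
  ultimately show ?thesis
    by (simp add: tri_add power_add)
qed

lemma suminf_bas_shift:
  assumes "summable (\<lambda>m. w m * bas s i m)"
  shows "(\<Sum>m. w m * bas s i m) = (\<Sum>n. w (i + n) * bas s i (i + n))"
proof -
  have "(\<Sum>m<i. w m * bas s i m) = 0"
    by (intro sum.neutral) (auto simp: bas_def po_minus_pow_eq_0)
  then show ?thesis
    using suminf_split_initial_segment[OF assms, of i] by (simp add: add.commute)
qed

text \<open>The sum effectively starts at m = i. Re-indexed from there it is again very-well-poised,
  with s replaced by s q^(2i), and \<open>vwp_sum\<close> evaluates it.\<close>

lemma wt_bas:
  assumes adm: "admissible u v r"
  shows "(\<Sum>m. wt u v r m * bas (sp u v r) i m) = wtC u v r * (po u i * po v i / (Q * r) ^ i)"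
proof -
  define s where "s = sp u v r"
  note D = admissibleD[OF adm, folded s_def]
  define s' where "s' = s * Q ^ (2 * i)"
  define X where "X = v / r * Q ^ i"
  define Y where "Y = u / r * Q ^ i"
  have uv: "u * v = s * Q * r" using D by (simp add: s_def sp_def)
  have s1: "1 - s \<noteq> 0" using D(11)[of 0] by simp
  have s'1: "1 - s' \<noteq> 0" using D(11)[of "2 * i"] by (simp add: s'_def)
  have be: "X \<noteq> 0" "Y \<noteq> 0" "s' \<noteq> 0" using D by (auto simp: X_def Y_def s'_def)
  have s'2: "s' = s * (Q ^ i * Q ^ i)" by (simp add: s'_def mult_2 power_add)
  have p1: "hpo X (s' * Q) n = X ^ n * po (u * Q ^ i) n" for n
  proof -
    have "s' * Q / X = (s * Q * r) / v * Q ^ i"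
      using D by (simp add: s'2 X_def)
    then have "s' * Q / X = u * Q ^ i"
      using D by (simp flip: uv)
    then show ?thesis using hpo_po[OF be(1)] by simp
  qed
  have p2: "hpo Y (s' * Q) n = Y ^ n * po (v * Q ^ i) n" for n
  proof -
    have "s' * Q / Y = (s * Q * r) / u * Q ^ i"
      using D by (simp add: s'2 Y_def)
    then have "s' * Q / Y = v * Q ^ i"
      using D by (simp flip: uv)
    then show ?thesis using hpo_po[OF be(2)] by simp
  qed
  have bes: "X * Y / (Q * s') = 1 / r"
  proof -
    have "X * Y / (Q * s') = (u * v) / (s * Q * r) / r"
      using D by (simp add: s'2 X_def Y_def mult_ac)
    then show ?thesis using D by (simp add: uv)
  qed
  define c where "c = 1 / (Q * r) ^ i * (po s (2 * i) * (1 - s') / (1 - s)) * (po u i * po v i / (po (u / r) i * po (v / r) i))"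
  have tm: "wt u v r (i + n) * bas s i (i + n) = c * vwp_term s' X Y n" for n
  proof -
    have e: "s * Q ^ (2 * (i + n)) = s' * Q ^ (2 * n)"
      by (simp add: s'_def power_add distrib_left)
    have v: "vwp_term s' X Y n = (-1) ^ n * Q ^ tri n / r ^ n * ((1 - s' * Q ^ (2 * n)) / (1 - s'))
     * (po s' n / po Q n) * (po (u * Q ^ i) n * po (v * Q ^ i) n / (po X n * po Y n))"
    proof -
      have x: "X ^ n * Y ^ n / (Q * s') ^ n = 1 / r ^ n"
        using bes by (metis power_divide power_mult_distrib power_one)
      have "vwp_term s' X Y n = (X ^ n * Y ^ n / (Q * s') ^ n) * ((-1) ^ n * Q ^ tri n * ((1 - s' * Q ^ (2 * n)) / (1 - s'))
        * (po s' n / po Q n) * (po (u * Q ^ i) n * po (v * Q ^ i) n / (po X n * po Y n)))"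
        unfolding vwp_term_def p1 p2 by (simp add: mult_ac)
      then show ?thesis unfolding x by (simp add: mult_ac)
    qed
    have "wt u v r (i + n) * bas s i (i + n) = (-1) ^ (i + n) / r ^ (i + n) * ((1 - s' * Q ^ (2 * n)) / (1 - s))
     * (po u (i + n) * po v (i + n) / (po (u / r) (i + n) * po (v / r) (i + n)))
     * (bas s i (i + n) * po s (i + n) / po Q (i + n) * Q ^ tri (i + n))"
      unfolding wt_def s_def[symmetric] e by (simp add: mult_ac)
    also have "\<dots> = (-1) ^ (i + n) / r ^ (i + n) * ((1 - s' * Q ^ (2 * n)) / (1 - s))
     * (po u (i + n) * po v (i + n) / (po (u / r) (i + n) * po (v / r) (i + n)))
     * ((-1) ^ i / Q ^ i * po s (2 * i) * Q ^ tri n * po s' n / po Q n)"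
      unfolding bas_shift s'_def ..
    also have "\<dots> = c * vwp_term s' X Y n"
      unfolding v c_def po_add X_def[symmetric] Y_def[symmetric] using s'1
      by (simp add: power_add power_mult_distrib mult_ac)
    finally show ?thesis .
  qed
  have "(\<Sum>m. wt u v r m * bas s i m) = (\<Sum>n. c * vwp_term s' X Y n)"
    by (subst suminf_bas_shift) (auto simp: tm intro!: wt_summable adm exp_bd_bas)
  also have "\<dots> = c * (\<Sum>n. vwp_term s' X Y n)"
    using D(8)[of "i + _"] D(7)[of "i + _"]
    by (intro suminf_mult vwp_term_summable) (auto simp: X_def Y_def power_add mult_ac)
  also have "(\<Sum>n. vwp_term s' X Y n) = poi (s' * Q) * poi (1 / r) / (poi X * poi Y)"
    unfolding bes[symmetric] using D(8)[of "i + _"] D(7)[of "i + _"] D(11)[of "2 * i + _"] be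
    by (intro vwp_sum) (auto simp: X_def Y_def s'_def power_add mult_ac)
  also have "c * (poi (s' * Q) * poi (1 / r) / (poi X * poi Y)) = wtC u v r * (po u i * po v i / (Q * r) ^ i)"
  proof -
    have "po s (2 * i) * (1 - s') = (1 - s) * po (s * Q) (2 * i)"
      using po_Suc[of s "2 * i"] po_rec[of s "2 * i"] by (simp add: s'_def)
    then have c: "c = 1 / (Q * r) ^ i * po (s * Q) (2 * i) * (po u i * po v i / (po (u / r) i * po (v / r) i))"
      unfolding c_def using s1 by simp
    have "poi (s * Q) = po (s * Q) (2 * i) * poi (s' * Q)"
      using poi_split[of "s * Q" "2 * i"] by (simp add: s'_def mult_ac)
    moreover have "poi (u / r) = po (u / r) i * poi Y" "poi (v / r) = po (v / r) i * poi X"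
      unfolding X_def Y_def by (rule poi_split)+
    ultimately show ?thesis unfolding c wtC_def s_def[symmetric] by (simp add: mult_ac)
  qed
  finally show ?thesis by (simp add: s_def)
qed

abbreviation shp where "shp s x k m \<equiv> po (x * Q ^ m) k * po (x / (s * Q ^ m)) k"

text \<open>The factor is a polynomial in q^-m + s q^m. It is expanded in \<open>bas\<close> by
  q-Saalschuetz, summed term by term, and put together again by q-Vandermonde.\<close>

lemma wt_single:
  assumes adm: "admissible u v r"
  shows "(\<Sum>m. wt u v r m * (shp (sp u v r) v k m))
    = wtC u v r * (po v k * po (Q * r) k / u ^ k)"
proof -
  define s where "s = sp u v r"
  note D = admissibleD[OF adm, folded s_def]
  define T where "T = v / s"
  have T0: "T \<noteq> 0" using D by (simp add: T_def)
  have uT: "u * T = Q * r" using D by (simp add: T_def s_def sp_def)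
  define c where "c i = qbin k i * (T ^ i * po T (k - i) * po (v * Q ^ i) (k - i))" for i
  have "shp s v k m = (\<Sum>i\<le>k. c i * bas s i m)" for m
  proof -
    have e: "T * (1 / Q ^ m) = v / (s * Q ^ m)" "v / (s * Q ^ m) * (s * Q ^ m) = v" "T * (s * Q ^ m) = v * Q ^ m"
      using D by (simp_all add: T_def)
    show ?thesis
      using saalschuetz_poly[of k "1 / Q ^ m" "s * Q ^ m" T] unfolding e by (simp add: c_def bas_def mult_ac)
  qed
  then have "(\<Sum>m. wt u v r m * (shp s v k m)) =
      (\<Sum>i\<le>k. c i * (wtC u v r * (po u i * po v i / (Q * r) ^ i)))"
    by (simp only:, intro wt_suminf_sum adm exp_bd_bas) (simp add: wt_bas[OF adm] s_def)
  also have "\<dots> = (\<Sum>i\<le>k. wtC u v r * po v k / u ^ k * (qbin k i * (po u i * u ^ (k - i) * po T (k - i))))"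
  proof (intro sum.cong refl, goal_cases)
    case (1 i)
    then have "po v k = po v i * po (v * Q ^ i) (k - i)" "u ^ k = u ^ i * u ^ (k - i)"
      by (auto simp: po_split[of i k] simp flip: power_add)
    moreover have "T ^ i / (Q * r) ^ i = 1 / u ^ i"
      unfolding uT[symmetric] using D(1) T0 by (simp add: power_mult_distrib)
    ultimately show ?case
      using D unfolding c_def by (simp add: divide_simps mult_ac)
  qed
  also have "\<dots> = wtC u v r * po v k / u ^ k * po (u * T) k"
    unfolding sum_distrib_left[symmetric] vandermonde_rev ..
  finally show ?thesis by (simp add: uT s_def)
qed

lemma wt_single':
  assumes adm: "admissible u v r"
  shows "(\<Sum>m. wt u v r m * (shp (sp u v r) u k m))
    = wtC u v r * (po u k * po (Q * r) k / v ^ k)"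
  using wt_single[OF admissible_swap[OF adm], of k]
  by (simp add: wt_swap[of v u] sp_swap[of v u] wtC_def mult_ac)

lemma wt_pair:
  assumes adm: "admissible u v r"
  shows "(\<Sum>m. wt u v r m * (shp (sp u v r) u j m
      * (shp (sp u v r) v k m)))
    = wtC u v r * (po u j * po v k * po (Q * r) (j + k) / (v ^ j * u ^ k * Q ^ (j * k)))"
proof -
  define s where "s = sp u v r"
  note D = admissibleD[OF adm, folded s_def]
  have uv: "u * v = s * (Q * r)" using D by (simp add: s_def sp_def)
  \<comment> \<open>The second factor is expanded in continuations of the first one, so that each
    product is a single factor of order j + i in u and \<open>wt_single'\<close> applies.\<close>
  define U where "U = u * Q ^ j"
  have U: "U \<noteq> 0" using D by (simp add: U_def)
  define T where "T = v / U"
  define c where "c i = qbin k i * (T ^ i * po T (k - i) * po (Q * r * Q ^ (j + i)) (k - i))" for i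
  define g where "g i m = po (u * Q ^ m) (j + i) * po (u / (s * Q ^ m)) (j + i)" for i m
  have "shp s u j m * (shp s v k m)
     = (\<Sum>i\<le>k. c i * g i m)" for m
  proof -
    define A B where "A = u * Q ^ m * Q ^ j" and "B = u / (s * Q ^ m) * Q ^ j"
    have "T * A = v * Q ^ m" using D by (simp add: T_def A_def U_def)
    moreover have "T * B = v / (s * Q ^ m)" using D by (simp add: T_def B_def U_def)
    moreover have "T * A * B = Q * r * Q ^ j"
    proof -
      have "T * A * B = (u * v) / s * Q ^ j"
        using D by (simp add: calculation(1) B_def)
      then show ?thesis using D by (simp add: uv)
    qed
    ultimately have "shp s v k m =
       (\<Sum>i\<le>k. qbin k i * (po A i * po B i * T ^ i * po T (k - i) * po (Q * r * Q ^ j * Q ^ i) (k - i)))"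
      using saalschuetz_poly[of k A B T] by simp
    then show ?thesis
      unfolding g_def po_add A_def[symmetric] B_def[symmetric] c_def
      by (simp add: sum_distrib_left power_add mult_ac)
  qed
  then have "(\<Sum>m. wt u v r m * (shp s u j m
      * (shp s v k m))) =
      (\<Sum>i\<le>k. c i * (wtC u v r * (po u (j + i) * po (Q * r) (j + i) / v ^ (j + i))))"
  proof (simp only:, intro wt_suminf_sum adm)
    show "exp_bd (g i)" for i
      unfolding g_def[abs_def] using exp_bd_po_div[of "u / s" "j + i"]
      by (intro exp_bd_mult exp_bd_po_mult) simp
  qed (simp add: wt_single'[OF adm] s_def g_def)
  also have "\<dots> = (\<Sum>i\<le>k. wtC u v r * po u j * po (Q * r) (j + k) / (v ^ j * U ^ k) * (qbin k i * (po U i * U ^ (k - i) * po T (k - i))))"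
  proof (intro sum.cong refl)
    fix i assume i: "i \<in> {..k}"
    then have "po (Q * r) (j + k) = po (Q * r) (j + i) * po (Q * r * Q ^ (j + i)) (k - i)"
      using po_split[of "j + i" "j + k" "Q * r"] by simp
    moreover have "U ^ k = U ^ i * U ^ (k - i)"
      using i by (simp flip: power_add)
    moreover have "po u (j + i) = po u j * po U i" by (simp add: po_add U_def)
    moreover have "T ^ i / v ^ i = 1 / U ^ i"
      using D by (simp add: T_def power_divide)
    ultimately show "c i * (wtC u v r * (po u (j + i) * po (Q * r) (j + i) / v ^ (j + i))) =
       wtC u v r * po u j * po (Q * r) (j + k) / (v ^ j * U ^ k) * (qbin k i * (po U i * U ^ (k - i) * po T (k - i)))"
      using D U unfolding c_def by (simp add: power_add divide_simps mult_ac)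
  qed
  also have "\<dots> = wtC u v r * po u j * po (Q * r) (j + k) / (v ^ j * U ^ k) * po (U * T) k"
    unfolding sum_distrib_left[symmetric] vandermonde_rev ..
  also have "U * T = v" using U by (simp add: T_def)
  also have "U ^ k = u ^ k * Q ^ (j * k)" by (simp add: U_def power_mult_distrib power_mult)
  finally show ?thesis by (simp add: s_def mult_ac)
qed

section \<open>The kernel\<close>

(* The polynomial E_m^+(z; a, b, c, q/d) with az, a/z replaced by independent variables A1, A2,
   multiplied by (A1 A2 / r; q)_m; here u = ab, v = ac, r = ad/q, so that A1 A2 / r = qa/d. *)
definition awp where
  "awp u v r A1 A2 m = (\<Sum>k\<le>m. hq m k * (po (sp u v r * Q ^ m) k * po A1 k * po A2 k
      * po (A1 * A2 / r * Q ^ k) (m - k)) / (po u k * po v k))"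

abbreviation ker_term where
  "ker_term u v r A1 A2 G1 G2 m \<equiv> wt u v r m * (awp u v r A1 A2 m * poi (A1 * A2 / r * Q ^ m)
     * (awp u v r G1 G2 m * poi (G1 * G2 / r * Q ^ m)))"

text \<open>The expansion multiplied by (A1 A2/r, G1 G2/r; q)_\<infinity>. As \<open>awp\<close>
  already contains (A1 A2/r; q)_m, only the tail of the infinite product remains in each term, and
  every term is entire in A1 and in G1.\<close>

definition ker where
  "ker u v r A1 A2 G1 G2 = (\<Sum>m. ker_term u v r A1 A2 G1 G2 m)"

lemma awp_poi:
  "awp u v r A1 A2 m * poi (A1 * A2 / r * Q ^ m) =
    (\<Sum>k\<le>m. po A1 k * po A2 k * poi (A1 * A2 / r * Q ^ k) / (po u k * po v k * po Q k) * Q ^ k * bas (sp u v r) k m)"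
  unfolding awp_def sum_distrib_right
proof (intro sum.cong refl, goal_cases)
  case (1 k)
  then have "poi (A1 * A2 / r * Q ^ k) = po (A1 * A2 / r * Q ^ k) (m - k) * poi (A1 * A2 / r * Q ^ m)"
    using poi_split[of "A1 * A2 / r * Q ^ k" "m - k"] by (simp add: mult.assoc flip: power_add)
  then show ?case
    by (simp add: hq_def bas_def mult_ac)
qed

text \<open>For A1 = q^-n the range of summation no longer depends on m, so the sum over m can be
  taken inside.\<close>

lemma awp_poi_terminating:
  "awp u v r (1 / Q ^ n) A2 m * poi (1 / Q ^ n * A2 / r * Q ^ m) =
    (\<Sum>k\<le>n. po (1 / Q ^ n) k * po A2 k * poi (1 / Q ^ n * A2 / r * Q ^ k) / (po u k * po v k * po Q k) * Q ^ k * bas (sp u v r) k m)"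
proof -
  define f where "f k = po (1 / Q ^ n) k * po A2 k * poi (1 / Q ^ n * A2 / r * Q ^ k) / (po u k * po v k * po Q k) * Q ^ k * bas (sp u v r) k m" for k
  have "(\<Sum>k\<le>m. f k) = (\<Sum>k\<le>max m n. f k)"
    by (rule sum.mono_neutral_left) (auto simp: f_def bas_def po_minus_pow_eq_0)
  also have "\<dots> = (\<Sum>k\<le>n. f k)"
    by (rule sum.mono_neutral_right) (auto simp: f_def po_minus_pow_eq_0)
  finally show ?thesis unfolding awp_poi f_def .
qed

definition cf where
  "cf u v r A2 n j = hq n j * (po A2 j * (1 / (Q * r) * u) ^ j * po (v * Q ^ j) (n - j)
     * hpo A2 u (n - j) * po (1 / (r * Q ^ n)) (n - j) * Q ^ (j * (n - j)))"

text \<open>Products of two \<open>bas\<close> factors are not what \<open>wt_pair\<close> sums.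
  Sears' transformation with TX = s q^m, TY = q^-m and TXY = v changes to the factors it does
  sum.\<close>

lemma awp_poi_expand:
  assumes adm: "admissible u v r"
  shows "awp u v r (1 / Q ^ n) A2 m * poi (1 / Q ^ n * A2 / r * Q ^ m) =
    poi (A2 / r) / (po u n * po v n) *
    (\<Sum>j\<le>n. cf u v r A2 n j * (shp (sp u v r) v j m))"
proof -
  define s where "s = sp u v r"
  note D = admissibleD[OF adm, folded s_def]
  have s: "s = u * v / (Q * r)" by (simp add: s_def sp_def)
  define T where "T = s / v"
  have T: "T = 1 / (Q * r) * u" using D by (simp add: T_def s)
  define F where "F = T * Q / (Q ^ n * u)"
  have F: "F = 1 / (r * Q ^ n)" using D by (simp add: F_def T)
  have nz: "po u k \<noteq> 0" "po v k \<noteq> 0" for k using D by (auto intro!: po_nz)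
  define w where "w = A2 * F"
  have w: "1 / Q ^ n * A2 / r = w" by (simp add: w_def F)
  have wn: "A2 / r = w * Q ^ n" by (simp add: w_def F)
  have "awp u v r (1 / Q ^ n) A2 m * poi (w * Q ^ m) =
     (\<Sum>k\<le>n. po (1 / Q ^ n) k * po A2 k * poi (w * Q ^ k) / (po u k * po v k * po Q k) * Q ^ k * bas s k m)"
    using awp_poi_terminating[of u v r n A2 m] unfolding w s_def .
  also have "\<dots> = (\<Sum>k\<le>n. poi (A2 / r) / (po u n * po v n) * (hq n k * (po A2 k * po (s * Q ^ m) k * po (1 / Q ^ m) k
      * po (v * Q ^ k) (n - k) * po (u * Q ^ k) (n - k) * po (w * Q ^ k) (n - k))))"
  proof (intro sum.cong refl, goal_cases)
    case (1 k)
    then have k: "k \<le> n" by simp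
    have "poi (w * Q ^ k) = po (w * Q ^ k) (n - k) * poi (A2 / r)"
      using poi_split[of "w * Q ^ k" "n - k"] k by (simp add: wn mult.assoc flip: power_add)
    then show ?case
      using nz[of k] nz[of n] po_split[OF k, of u] po_split[OF k, of v]
      by (simp add: hq_def bas_def mult_ac)
  qed
  also have "\<dots> = poi (A2 / r) / (po u n * po v n) * (\<Sum>k\<le>n. hq n k * (po A2 k * po (s * Q ^ m) k * po (1 / Q ^ m) k
      * po (v * Q ^ k) (n - k) * po (u * Q ^ k) (n - k) * po (w * Q ^ k) (n - k)))"
    by (simp only: sum_distrib_left)
  also have "(\<Sum>k\<le>n. hq n k * (po A2 k * po (s * Q ^ m) k * po (1 / Q ^ m) k
      * po (v * Q ^ k) (n - k) * po (u * Q ^ k) (n - k) * po (w * Q ^ k) (n - k))) =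
      (\<Sum>j\<le>n. cf u v r A2 n j * (shp s v j m))"
  proof -
    have e: "T * (v * Q ^ m) = s * Q ^ m" "s * Q ^ m * (v / (s * Q ^ m)) = v" "T * (v / (s * Q ^ m)) = 1 / Q ^ m"
      using D by (simp_all add: T_def)
    show ?thesis
      using sears[of u F T n A2 "v * Q ^ m" "v / (s * Q ^ m)"] D(1) F_def
      unfolding e w_def[symmetric] cf_def F[symmetric] T[symmetric] by (simp add: mult_ac)
  qed
  finally show ?thesis unfolding w s_def .
qed

lemma cf_sum:
  assumes adm: "admissible u v r" and "A2 \<noteq> 0"
  shows "(\<Sum>j\<le>n. cf u v r A2 n j * (po v j * po (Q * r) j / u ^ j) * po (1 / Q ^ j) h)
    = po v n * po (1 / (r * Q ^ n)) n * (po (1 / Q ^ n) h * po A2 h * po (u * Q ^ h) (n - h))"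
proof -
  note D = admissibleD[OF adm]
  have "cf u v r A2 n j * (po v j * po (Q * r) j / u ^ j) * po (1 / Q ^ j) h =
    po v n * po (1 / (r * Q ^ n)) n * (qbin n j * (po A2 j * hpo A2 u (n - j)) * po (1 / Q ^ j) h)"
    if j: "j \<le> n" for j
  proof -
    have "cf u v r A2 n j * (po v j * po (Q * r) j / u ^ j) * po (1 / Q ^ j) h =
      (po v j * po (v * Q ^ j) (n - j)) *
      (hq n j * Q ^ (j * (n - j)) / (Q * r) ^ j * po (1 / (r * Q ^ n)) (n - j) * po (Q * r) j)
      * (po A2 j * hpo A2 u (n - j) * po (1 / Q ^ j) h)"
      using D(1) by (simp add: cf_def power_mult_distrib power_divide mult_ac)
    then show ?thesis
      unfolding hq_po_r[OF D(3) j] po_split[OF j, of v, symmetric] by (simp add: mult_ac)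
  qed
  then have "(\<Sum>j\<le>n. cf u v r A2 n j * (po v j * po (Q * r) j / u ^ j) * po (1 / Q ^ j) h) =
    (\<Sum>j\<le>n. po v n * po (1 / (r * Q ^ n)) n * (qbin n j * (po A2 j * hpo A2 u (n - j)) * po (1 / Q ^ j) h))"
    by (intro sum.cong) auto
  also have "\<dots> = po v n * po (1 / (r * Q ^ n)) n * (po (1 / Q ^ n) h * po A2 h * po (u * Q ^ h) (n - h))"
    unfolding sum_distrib_left[symmetric] vandermonde_shift[OF assms(2)] ..
  finally show ?thesis .
qed

lemma awp_swap: "awp u v r A1 A2 m = awp v u r A1 A2 m"
  by (simp add: awp_def sp_swap[of u v] mult_ac)

text \<open>One polynomial is expanded with v, the other, by symmetry, with u, so that
  \<open>wt_pair\<close> applies. The result couples the two indices only through (qr; q)_(i+j)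
  q^(-ij); separating them introduces h, which becomes the summation index of the 4phi3.\<close>

lemma ker_terminating:
  assumes adm: "admissible u v r" and "A2 \<noteq> 0" "G2 \<noteq> 0"
  shows "ker u v r (1 / Q ^ n) A2 (1 / Q ^ l) G2 =
    wtC u v r * (po (1 / (r * Q ^ n)) n * poi (A2 / r)) * (po (1 / (r * Q ^ l)) l * poi (G2 / r))
      * (\<Sum>h\<le>n. po (1 / Q ^ n) h * po A2 h * po (1 / Q ^ l) h * po G2 h / (po u h * po v h * po (Q * r) h * po Q h) * Q ^ h)"
proof -
  define s where "s = sp u v r"
  note D = admissibleD[OF adm, folded s_def]
  have nz: "po u k \<noteq> 0" "po v k \<noteq> 0" "po (Q * r) k \<noteq> 0" for k using D by (auto intro!: po_nz)
  define a b where "a j m = shp s v j m"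
    and "b j m = shp s u j m" for j m
  define P where "P = poi (A2 / r) / (po u n * po v n) * (poi (G2 / r) / (po u l * po v l))"
  have "awp u v r (1 / Q ^ n) A2 m * poi (1 / Q ^ n * A2 / r * Q ^ m)
     * (awp u v r (1 / Q ^ l) G2 m * poi (1 / Q ^ l * G2 / r * Q ^ m))
    = (\<Sum>(j, i)\<in>{..n} \<times> {..l}. (P * (cf u v r A2 n j * cf v u r G2 l i)) * (b i m * a j m))" for m
    unfolding awp_poi_expand[OF adm] awp_swap[of u v r "1 / Q ^ l" G2] awp_poi_expand[OF admissible_swap[OF adm]]
    unfolding sp_swap[of v u] s_def[symmetric] a_def[symmetric] b_def[symmetric] P_def
    unfolding sum.cartesian_product[symmetric] sum_product sum_distrib_left
    by (simp add: sum_distrib_left sum_distrib_right mult_ac) (rule sum.swap)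
  then have "ker u v r (1 / Q ^ n) A2 (1 / Q ^ l) G2 =
     (\<Sum>m. wt u v r m * (\<Sum>p\<in>{..n} \<times> {..l}. (P * (cf u v r A2 n (fst p) * cf v u r G2 l (snd p))) * (b (snd p) m * a (fst p) m)))"
    unfolding ker_def by (simp add: case_prod_beta)
  also have "\<dots> = (\<Sum>p\<in>{..n} \<times> {..l}. (P * (cf u v r A2 n (fst p) * cf v u r G2 l (snd p))) *
     (wtC u v r * (po u (snd p) * po v (fst p) * po (Q * r) (snd p + fst p) / (v ^ snd p * u ^ fst p * Q ^ (snd p * fst p)))))"
  proof (rule wt_suminf_sum[OF adm])
    fix p
    show "(\<Sum>m. wt u v r m * (b (snd p) m * a (fst p) m)) =
      wtC u v r * (po u (snd p) * po v (fst p) * po (Q * r) (snd p + fst p) / (v ^ snd p * u ^ fst p * Q ^ (snd p * fst p)))"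
      unfolding a_def b_def s_def by (rule wt_pair[OF adm])
    show "exp_bd (\<lambda>m. b (snd p) m * a (fst p) m)"
      unfolding a_def b_def using exp_bd_po_div[of "u / s"] exp_bd_po_div[of "v / s"]
      by (intro exp_bd_mult exp_bd_po_mult) simp_all
  qed
  also have "\<dots> = (\<Sum>j\<le>n. \<Sum>i\<le>l. P * (cf u v r A2 n j * cf v u r G2 l i) *
     (wtC u v r * (po u i * po v j * po (Q * r) (i + j) / (v ^ i * u ^ j * Q ^ (i * j)))))"
    unfolding sum.cartesian_product by (simp add: case_prod_beta)
  also have "\<dots> = (\<Sum>j\<le>n. \<Sum>i\<le>l. \<Sum>h\<le>n. P * wtC u v r *
       ((cf u v r A2 n j * (po v j * po (Q * r) j / u ^ j) * po (1 / Q ^ j) h) *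
        (cf v u r G2 l i * (po u i * po (Q * r) i / v ^ i) * po (1 / Q ^ i) h) * (Q ^ h / (po (Q * r) h * po Q h))))"
  proof (intro sum.cong refl, goal_cases)
    case (1 j i)
    then have j: "j \<le> n" by simp
    have X: "po (Q * r) (i + j) / Q ^ (i * j) = po (Q * r) i * po (Q * r) j * (\<Sum>h\<le>n. hq i h * po (1 / Q ^ j) h / po (Q * r) h)"
      using D by (intro po_add_expand j) auto
    let "?l = _" = ?case
    have "?l
     = P * wtC u v r * (cf u v r A2 n j * (po v j / u ^ j)) * (cf v u r G2 l i * (po u i / v ^ i)) * (po (Q * r) (i + j) / Q ^ (i * j))"
      by (simp add: mult_ac)
    then show ?case
      unfolding X by (simp add: sum_distrib_left hq_def mult_ac)
  qed
  also have "\<dots> = (\<Sum>h\<le>n. P * wtC u v r *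
       ((\<Sum>j\<le>n. cf u v r A2 n j * (po v j * po (Q * r) j / u ^ j) * po (1 / Q ^ j) h) *
        (\<Sum>i\<le>l. cf v u r G2 l i * (po u i * po (Q * r) i / v ^ i) * po (1 / Q ^ i) h) * (Q ^ h / (po (Q * r) h * po Q h))))"
  proof -
    have *: "(\<Sum>j\<le>n. \<Sum>i\<le>l. \<Sum>h\<le>n. c * (f j h * g i h * x h)) = (\<Sum>h\<le>n. c * ((\<Sum>j\<le>n. f j h) * (\<Sum>i\<le>l. g i h) * x h))"
      for f g :: "nat \<Rightarrow> nat \<Rightarrow> complex" and x c
    proof -
      have "(\<Sum>j\<le>n. \<Sum>i\<le>l. \<Sum>h\<le>n. c * (f j h * g i h * x h)) = (\<Sum>j\<le>n. \<Sum>h\<le>n. \<Sum>i\<le>l. c * (f j h * g i h * x h))"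
        by (intro sum.cong refl sum.swap)
      also have "\<dots> = (\<Sum>h\<le>n. \<Sum>j\<le>n. \<Sum>i\<le>l. c * (f j h * g i h * x h))"
        by (rule sum.swap)
      finally show ?thesis
        by (simp add: sum_product sum_distrib_left sum_distrib_right) (intro sum.cong refl sum.swap)
    qed
    show ?thesis by (rule *)
  qed
  also have "\<dots> = (\<Sum>h\<le>n. wtC u v r * (po (1 / (r * Q ^ n)) n * poi (A2 / r)) * (po (1 / (r * Q ^ l)) l * poi (G2 / r)) *
       (po (1 / Q ^ n) h * po A2 h * po (1 / Q ^ l) h * po G2 h / (po u h * po v h * po (Q * r) h * po Q h) * Q ^ h))"
    unfolding cf_sum[OF adm assms(2)] cf_sum[OF admissible_swap[OF adm] assms(3)]
  proof (intro sum.cong refl, goal_cases)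
    case (1 h)
    then have u: "po u n = po u h * po (u * Q ^ h) (n - h)"
      by (simp add: po_split)
    \<comment> \<open>Here h may exceed l. Then l - h is truncated and (v; q)_l does not split at h,
      but (q^-l; q)_h is zero.\<close>
    have v: "po (1 / Q ^ l) h * (po (v * Q ^ h) (l - h) / po v l) = po (1 / Q ^ l) h / po v h"
    proof (cases "h \<le> l")
      case True
      then show ?thesis using nz(2)[of l] nz(2)[of h] po_split[OF True, of v] by simp
    next
      case False
      then show ?thesis by (simp add: po_minus_pow_eq_0)
    qed
    have u': "po (u * Q ^ h) (n - h) / po u n = 1 / po u h"
      using nz(1)[of n] unfolding u by simp
    let "?l = _" = ?case
    have "?l =
       wtC u v r * (po (1 / (r * Q ^ n)) n * poi (A2 / r)) * (po (1 / (r * Q ^ l)) l * poi (G2 / r)) *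
       (po (1 / Q ^ n) h * po A2 h * po G2 h * (po (u * Q ^ h) (n - h) / po u n) *
        (po (1 / Q ^ l) h * (po (v * Q ^ h) (l - h) / po v l)) * (Q ^ h / (po (Q * r) h * po Q h)))"
      using nz(2)[of n] nz(1)[of l] unfolding P_def by simp
    then show ?case
      unfolding u' v by (simp add: mult_ac)
  qed
  finally show ?thesis by (simp add: sum_distrib_left)
qed

text \<open>The Askey--Wilson polynomials are symmetric in a and q/d up to normalization; this is
  Sears' transformation with T = r. The factor (A1 A2/r; q)_m is itself invariant.\<close>

lemma awp_flip:
  assumes adm: "admissible u v r"
  shows "awp u v r A1 A2 m =
    po (u / r) m * po (v / r) m / (po u m * po v m) * r ^ m * awp (u / r) (v / r) (1 / r) (A1 / r) (A2 / r) m"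
proof -
  define s where "s = sp u v r"
  note D = admissibleD[OF adm, folded s_def]
  have s: "s * (Q * r) = u * v" using D by (simp add: s_def sp_def)
  have nz: "po u k \<noteq> 0" "po v k \<noteq> 0" "po (u / r) k \<noteq> 0" "po (v / r) k \<noteq> 0" for k
    using D by (auto intro!: po_nz)
  define F where "F = r * Q / (Q ^ m * u)"
  have vF: "v = s * Q ^ m * F"
  proof -
    have "s * Q ^ m * F = (s * (Q * r)) / u" by (simp add: F_def)
    then show ?thesis using D by (simp add: s)
  qed
  have w: "A1 * A2 / r = r * (A1 / r) * (A2 / r)" "A1 / r * (A2 / r) / (1 / r) = r * (A1 / r) * (A2 / r)"
    and A: "r * (A1 / r) = A1" "r * (A2 / r) = A2"
    using D by simp_all
  have "po u m * po v m * awp u v r A1 A2 m = (\<Sum>k\<le>m. hq m k * (po (s * Q ^ m) k * po (r * (A1 / r)) k * po (r * (A2 / r)) k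
      * po (r * (A1 / r) * (A2 / r) * Q ^ k) (m - k) * po (u * Q ^ k) (m - k) * po (v * Q ^ k) (m - k)))"
    unfolding awp_def sum_distrib_left s_def[symmetric] w A
  proof (intro sum.cong refl, goal_cases)
    case (1 k)
    then have k: "k \<le> m" by simp
    show ?case
      using nz[of k] po_split[OF k, of u] po_split[OF k, of v] by simp
  qed
  also have "\<dots> = (\<Sum>j\<le>m. hq m j * (po (s * Q ^ m) j * po (A1 / r) j * po (A2 / r) j * r ^ j
      * po (r * (A1 / r) * (A2 / r) * Q ^ j) (m - j) * hpo (s * Q ^ m) u (m - j) * po F (m - j) * Q ^ (j * (m - j))))"
    unfolding vF by (rule sears[OF D(1) F_def])
  also have "\<dots> = (\<Sum>j\<le>m. po (u / r) m * po (v / r) m * r ^ m * (hq m j * (po (s * Q ^ m) j * po (A1 / r) j * po (A2 / r) j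
      * po (r * (A1 / r) * (A2 / r) * Q ^ j) (m - j)) / (po (u / r) j * po (v / r) j)))"
  proof (intro sum.cong refl, goal_cases)
    case (1 j)
    then obtain N where m: "m = j + N" using le_Suc_ex by (metis atMost_iff)
    have vr: "v / r * Q ^ j = s * Q ^ m * Q / (Q ^ N * u)"
    proof -
      have "s * Q ^ m * Q / (Q ^ N * u) = (s * (Q * r)) / u / r * Q ^ j"
        using D by (simp add: m power_add)
      then show ?thesis using D by (simp add: s)
    qed
    have uQ: "u * Q ^ j \<noteq> 0" using D by simp
    have F: "F = r * Q / (Q ^ N * (u * Q ^ j))" by (simp add: F_def m power_add mult_ac)
    have 1: "po (v / r * Q ^ j) N = (\<Prod>l<N. - 1 / (u * Q ^ l)) * hpo (s * Q ^ m) u N"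
      unfolding vr by (rule po_reverse[OF D(1)])
    have 2: "po F N = (\<Prod>l<N. - 1 / (u * Q ^ j * Q ^ l)) * (r ^ N * po (u / r * Q ^ j) N)"
      unfolding F po_reverse[OF uQ] using D by (simp add: hpo_po)
    have 3: "(\<Prod>l<N. - 1 / (u * Q ^ l)) = Q ^ (j * N) * (\<Prod>l<N. - 1 / (u * Q ^ j * Q ^ l))"
    proof (induction N)
      case (Suc N)
      then show ?case using D by (simp add: power_add)
    qed simp
    have "hpo (s * Q ^ m) u N * po F N * Q ^ (j * N) = r ^ N * po (u / r * Q ^ j) N * po (v / r * Q ^ j) N"
      unfolding 1 2 3 by (simp add: mult_ac)
    moreover have "po (u / r) m = po (u / r) j * po (u / r * Q ^ j) N" "po (v / r) m = po (v / r) j * po (v / r * Q ^ j) N"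
      by (simp_all add: m po_add)
    ultimately show ?case
      using nz(3,4)[of j] by (simp add: m power_add mult_ac)
  qed
  also have "\<dots> = po (u / r) m * po (v / r) m * r ^ m * awp (u / r) (v / r) (1 / r) (A1 / r) (A2 / r) m"
    unfolding awp_def sum_distrib_left sp_flip[OF D(3)] s_def[symmetric] w ..
  finally show ?thesis
    using nz[of m] by (simp add: field_simps)
qed

lemma ker_swap: "ker u v r A1 A2 G1 G2 = ker u v r G1 G2 A1 A2"
  by (simp add: ker_def mult_ac)

text \<open>One normalization constant of \<open>awp_flip\<close> removes u, v and r from the weight
  except through s; two of them produce the flipped weight.\<close>

lemma wt_flip:
  assumes adm: "admissible u v r"
  shows "wt u v r m * (po (u / r) m * po (v / r) m / (po u m * po v m) * r ^ m) =
    (-1) ^ m * Q ^ tri m * ((1 - sp u v r * Q ^ (2 * m)) / (1 - sp u v r)) * (po (sp u v r) m / po Q m)"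
proof -
  note D = admissibleD[OF adm]
  have "po u m \<noteq> 0" "po v m \<noteq> 0" "po (u / r) m \<noteq> 0" "po (v / r) m \<noteq> 0"
    using D by (auto intro!: po_nz)
  then show ?thesis using D(3) by (simp add: wt_def)
qed

lemma ker_flip:
  assumes adm: "admissible u v r"
  shows "ker u v r A1 A2 G1 G2 = ker (u / r) (v / r) (1 / r) (A1 / r) (A2 / r) (G1 / r) (G2 / r)"
proof -
  note D = admissibleD[OF adm]
  define c where "c m = po (u / r) m * po (v / r) m / (po u m * po v m) * r ^ m" for m
  have nz: "po u m \<noteq> 0" "po v m \<noteq> 0" "po (u / r) m \<noteq> 0" "po (v / r) m \<noteq> 0" for m
    using D by (auto intro!: po_nz)
  have w: "wt u v r m * (c m * c m) = wt (u / r) (v / r) (1 / r) m" for m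
  proof -
    have "wt u v r m * (c m * c m) = (wt u v r m * c m) * c m" by simp
    also have "\<dots> = wt (u / r) (v / r) (1 / r) m"
      unfolding c_def wt_flip[OF adm] using D(3) by (simp add: wt_def sp_flip power_divide mult_ac)
    finally show ?thesis .
  qed
  show ?thesis
    unfolding ker_def w[symmetric] awp_flip[OF adm] c_def[symmetric]
    using D(3) by (simp add: mult_ac)
qed

section \<open>The mixed nodes: sums that vanish\<close>

definition wt0 where
  "wt0 s m = (-1) ^ m * Q ^ tri m * ((1 - s * Q ^ (2 * m)) / (1 - s)) * (po s m / po Q m)"

lemma wt0_summable:
  assumes "exp_bd g"
  shows "summable (\<lambda>m. wt0 s m * g m)"
proof -
  have "exp_bd (\<lambda>m. (-1) ^ m * ((1 - s * (Q ^ 2) ^ m) * (1 / (1 - s))) * (po s m / po Q m) * g m)"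
    using Q_Q_pow_neq_1 assms
    by (intro exp_bd_intros) assumption+
  from summable_exp_bd[OF this] show ?thesis
    unfolding wt0_def power_mult by (simp add: mult_ac)
qed

lemma wt0_partial_sum:
  assumes "s \<noteq> 1"
  shows "(\<Sum>n<Suc m. wt0 s n) = Q ^ tri m * ((-1) ^ m * Q ^ m * (po (s * Q) m / po Q m))"
proof (induction m)
  case 0
  show ?case using assms by (simp add: wt0_def)
next
  case (Suc m)
  define x where "x = Q ^ m"
  define T where "T = Q ^ tri m * ((-1) ^ m * x * (po (s * Q) m / po Q m))"
  have 1: "1 - Q * x \<noteq> 0" using Q_Q_pow_neq_1[of m] by (simp add: x_def)
  have "wt0 s (Suc m) = - ((-1) ^ m * (Q ^ tri m * x) * (1 - s * (Q * x) ^ 2) * (po s (Suc m) / (1 - s)) / po Q (Suc m))"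
    by (simp add: wt0_def tri_Suc power_add x_def power_mult power_mult_distrib power_even_eq mult_ac power2_eq_square)
  also have "po s (Suc m) / (1 - s) = po (s * Q) m" using assms by (simp add: po_rec)
  finally have w: "wt0 s (Suc m) = - T * ((1 - s * (Q * x) ^ 2) / (1 - Q * x))"
    by (simp add: po_Suc[of _ m] x_def T_def mult_ac)
  have aux: "T + - T * y = T * (1 - y)" for y by (simp add: algebra_simps)
  have "(\<Sum>n<Suc (Suc m). wt0 s n) = T * (1 - (1 - s * (Q * x) ^ 2) / (1 - Q * x))"
    unfolding sum.lessThan_Suc[of _ "Suc m"] Suc.IH w x_def[symmetric] T_def[symmetric] by (rule aux)
  also have "1 - (1 - s * (Q * x) ^ 2) / (1 - Q * x) = - Q * x * (1 - s * Q * x) / (1 - Q * x)"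
    using 1 by (simp add: field_simps power2_eq_square)
  also have "T * (- Q * x * (1 - s * Q * x) / (1 - Q * x))
     = Q ^ tri (Suc m) * ((-1) ^ Suc m * Q ^ Suc m * (po (s * Q) (Suc m) / po Q (Suc m)))"
    by (simp add: po_Suc[of _ m] tri_Suc power_add x_def T_def mult_ac)
  finally show ?case .
qed

text \<open>The partial sums have a closed form with a Gaussian factor and therefore tend to
  0.\<close>

lemma wt0_suminf:
  assumes "s \<noteq> 1"
  shows "(\<Sum>n. wt0 s n) = 0"
proof -
  have "exp_bd (\<lambda>m. (-1) ^ m * Q ^ m * (po (s * Q) m / po Q m))"
    using Q_Q_pow_neq_1
    by (intro exp_bd_intros) assumption+
  then have "(\<lambda>m. \<Sum>n<Suc m. wt0 s n) \<longlonglongrightarrow> 0"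
    unfolding wt0_partial_sum[OF assms] by (intro summable_LIMSEQ_zero summable_exp_bd)
  moreover have "summable (\<lambda>m. wt0 s m * 1)" by (intro wt0_summable exp_bd_const)
  then have "(\<lambda>m. \<Sum>n<Suc m. wt0 s n) \<longlonglongrightarrow> (\<Sum>n. wt0 s n)"
    by (intro LIMSEQ_Suc[OF summable_LIMSEQ]) simp
  ultimately show ?thesis using LIMSEQ_unique by blast
qed

lemma wt0_bas:
  assumes s: "\<And>k. s * Q ^ k \<noteq> 1"
  shows "(\<Sum>m. wt0 s m * bas s i m) = 0"
proof -
  define s' where "s' = s * Q ^ (2 * i)"
  have s': "1 - s' \<noteq> 0" using s[of "2 * i"] by (simp add: s'_def)
  define c where "c = 1 / Q ^ i * (po s (2 * i) * (1 - s') / (1 - s))"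
  have "wt0 s (i + n) * bas s i (i + n) = c * wt0 s' n" for n
  proof -
    have e: "s * Q ^ (2 * (i + n)) = s' * Q ^ (2 * n)"
      by (simp add: s'_def power_add distrib_left)
    have "wt0 s (i + n) * bas s i (i + n) = (-1) ^ (i + n) * ((1 - s' * Q ^ (2 * n)) / (1 - s))
       * (bas s i (i + n) * po s (i + n) / po Q (i + n) * Q ^ tri (i + n))"
      unfolding wt0_def e by (simp add: mult_ac)
    then show ?thesis
      unfolding bas_shift s'_def[symmetric] c_def wt0_def using s'
      by (simp add: power_add mult_ac)
  qed
  then have "(\<Sum>m. wt0 s m * bas s i m) = (\<Sum>n. c * wt0 s' n)"
    by (subst suminf_bas_shift) (auto intro!: wt0_summable exp_bd_bas)
  also have "\<dots> = c * (\<Sum>n. wt0 s' n)"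
    using wt0_summable[of "\<lambda>_. 1" s'] by (intro suminf_mult) (simp add: exp_bd_const)
  also have "\<dots> = 0" using s' by (simp add: wt0_suminf)
  finally show ?thesis .
qed

(* bas s i m is (y, s/y; q)_i at y = q^(-m), hence a polynomial in y + s/y, and multiplication
   by y + s/y maps (y, s/y; q)_i to a combination of itself and (y, s/y; q)_(i+1). *)
lemma wt0_bas_bas:
  assumes s: "\<And>k. s * Q ^ k \<noteq> 1"
  shows "(\<Sum>m. wt0 s m * (bas s i m * bas s j m)) = 0"
proof (induction j arbitrary: i)
  case 0
  then show ?case using wt0_bas[OF s] by (simp add: bas_def)
next
  case (Suc j)
  define t where "t m = 1 / Q ^ m + s * Q ^ m" for m
  have B: "bas s (Suc k) m = bas s k m * (1 + s * (Q ^ k * Q ^ k) - Q ^ k * t m)" for k m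
    by (simp add: bas_def po_Suc t_def algebra_simps)
  define a b where "a = (1 + s * (Q ^ j * Q ^ j)) - Q ^ j / Q ^ i * (1 + s * (Q ^ i * Q ^ i))" and "b = Q ^ j / Q ^ i"
  have "bas s i m * bas s (Suc j) m = a * (bas s i m * bas s j m) + b * (bas s (Suc i) m * bas s j m)" for m
    unfolding B a_def b_def by (simp add: field_simps)
  then have "(\<Sum>m. wt0 s m * (bas s i m * bas s (Suc j) m)) =
      (\<Sum>m. a * (wt0 s m * (bas s i m * bas s j m)) + b * (wt0 s m * (bas s (Suc i) m * bas s j m)))"
    by (simp add: algebra_simps)
  also have "\<dots> = a * (\<Sum>m. wt0 s m * (bas s i m * bas s j m)) + b * (\<Sum>m. wt0 s m * (bas s (Suc i) m * bas s j m))"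
    using wt0_summable[OF exp_bd_mult[OF exp_bd_bas exp_bd_bas]]
    by (subst suminf_add[symmetric]) (auto simp: suminf_mult intro: summable_mult)
  finally show ?case by (simp add: Suc)
qed

text \<open>Flipping the polynomial in G1 makes both expansions finite in \<open>bas\<close> and
  leaves the weight \<open>wt0\<close>, which annihilates all products of two basis
  elements.\<close>

lemma ker_mixed:
  assumes adm: "admissible u v r"
  shows "ker u v r (1 / Q ^ n) A2 (r / Q ^ l) G2 = 0"
proof -
  define s where "s = sp u v r"
  note D = admissibleD[OF adm, folded s_def]
  define c where "c m = po (u / r) m * po (v / r) m / (po u m * po v m) * r ^ m" for m
  define a where "a k = po (1 / Q ^ n) k * po A2 k * poi (1 / Q ^ n * A2 / r * Q ^ k) / (po u k * po v k * po Q k) * Q ^ k" for k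
  define b where "b k = po (1 / Q ^ l) k * po (G2 / r) k * poi (1 / Q ^ l * (G2 / r) / (1 / r) * Q ^ k) / (po (u / r) k * po (v / r) k * po Q k) * Q ^ k" for k
  have 1: "awp u v r (1 / Q ^ n) A2 m * poi (1 / Q ^ n * A2 / r * Q ^ m) = (\<Sum>k\<le>n. a k * bas s k m)" for m
    unfolding awp_poi_terminating a_def s_def ..
  have e: "r / Q ^ l / r = 1 / Q ^ l" "r / Q ^ l * G2 / r = 1 / Q ^ l * (G2 / r) / (1 / r)"
    using D(3) by simp_all
  have 2: "awp u v r (r / Q ^ l) G2 m * poi (r / Q ^ l * G2 / r * Q ^ m) = c m * (\<Sum>k\<le>l. b k * bas s k m)" for m
    unfolding awp_flip[OF adm, of "r / Q ^ l"] c_def[symmetric] e mult.assoc[of "c m"] awp_poi_terminating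
    unfolding b_def sp_flip[OF D(3)] s_def ..
  have w: "wt u v r m * c m = wt0 s m" for m
    unfolding c_def wt_flip[OF adm] wt0_def s_def ..
  have "ker u v r (1 / Q ^ n) A2 (r / Q ^ l) G2 =
     (\<Sum>m. (wt u v r m * c m) * ((\<Sum>k\<le>n. a k * bas s k m) * (\<Sum>k\<le>l. b k * bas s k m)))"
    unfolding ker_def 1 2 by (simp add: mult_ac)
  also have "\<dots> = (\<Sum>m. \<Sum>p\<in>{..n} \<times> {..l}. a (fst p) * b (snd p) * (wt0 s m * (bas s (fst p) m * bas s (snd p) m)))"
    unfolding w sum_product sum.cartesian_product
    by (simp add: sum_distrib_left case_prod_beta mult_ac)
  also have "\<dots> = (\<Sum>p\<in>{..n} \<times> {..l}. \<Sum>m. a (fst p) * b (snd p) * (wt0 s m * (bas s (fst p) m * bas s (snd p) m)))"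
    by (rule suminf_sum) (intro summable_mult wt0_summable exp_bd_mult exp_bd_bas)
  also have "\<dots> = 0"
    using wt0_summable[OF exp_bd_mult[OF exp_bd_bas exp_bd_bas]] wt0_bas_bas[OF D(11)]
    by (intro sum.neutral ballI) (subst suminf_mult, auto)
  finally show ?thesis .
qed

section \<open>Growth and interpolation\<close>

lemma holomorphic_divide_root:
  assumes "f holomorphic_on UNIV" "f a = 0"
  obtains g where "g holomorphic_on UNIV" "\<And>x. f x = (x - a) * g x"
proof
  show "(\<lambda>z. if z = a then deriv f a else (f z - f a) / (z - a)) holomorphic_on UNIV"
    by (rule pole_lemma_open[OF assms(1) open_UNIV])
  show "f x = (x - a) * (if x = a then deriv f a else (f x - f a) / (x - a))" for x
    using assms(2) by simp
qed

lemma po_minus_power_nz: "po (1 / Q ^ M) M \<noteq> 0"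
  using po_minus_power[of M M] by simp

lemma po_ratio_nz:
  assumes "\<And>k. c * Q ^ k \<noteq> 1"
  shows "po (1 / (c * Q ^ M)) (Suc M) \<noteq> 0"
proof -
  have "1 / (c * Q ^ M) * Q ^ j \<noteq> 1" if "j < Suc M" for j
  proof
    assume e: "1 / (c * Q ^ M) * Q ^ j = 1"
    have "Q ^ M = Q ^ j * Q ^ (M - j)" using that by (simp flip: power_add)
    then have "1 / (c * Q ^ (M - j)) = 1" using e by simp
    then have "c * Q ^ (M - j) = 1" by (metis div_by_0 divide_eq_1_iff zero_neq_one)
    with assms show False by blast
  qed
  then show ?thesis by (auto simp: po_eq_0_iff)
qed

text \<open>Zeros are divided out one at a time. As r is no integral power of q, the two
  progressions are disjoint, so the next zero is not one already removed.\<close>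

lemma holomorphic_divide_po:
  assumes f: "f holomorphic_on UNIV" and r: "r \<noteq> 0" "\<And>k. r * Q ^ k \<noteq> 1" "\<And>k. 1 / r * Q ^ k \<noteq> 1"
    and z: "\<And>n. f (1 / Q ^ n) = 0" "\<And>n. f (r / Q ^ n) = 0"
  obtains g where "g holomorphic_on UNIV" "\<And>x. f x = po x M * po (x / r) M * g x"
proof -
  have "\<exists>g. g holomorphic_on UNIV \<and> (\<forall>x. f x = po x M * po (x / r) M * g x)"
  proof (induction M)
    case 0
    show ?case using f by (intro exI[of _ f]) simp
  next
    case (Suc M)
    then obtain g where g: "g holomorphic_on UNIV" "\<And>x. f x = po x M * po (x / r) M * g x" by blast
    have "po (1 / Q ^ M / r) M \<noteq> 0"
      using po_ratio_nz[OF r(2), of M] by (simp add: po_Suc mult_ac)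
    then have "g (1 / Q ^ M) = 0"
      using z(1)[of M] g(2) po_minus_power_nz by simp
    from holomorphic_divide_root[OF g(1) this] obtain g1 where
      g1: "g1 holomorphic_on UNIV" "\<And>x. g x = (x - 1 / Q ^ M) * g1 x" by blast
    have f1: "f x = po x (Suc M) * po (x / r) M * (- 1 / Q ^ M * g1 x)" for x
      unfolding g(2) g1(2) po_Suc by (simp add: field_simps)
    have "po (r / Q ^ M) (Suc M) \<noteq> 0"
      using po_ratio_nz[OF r(3), of M] by simp
    then have "g1 (r / Q ^ M) = 0"
      using z(2)[of M] po_minus_power_nz r(1) by (simp add: f1)
    from holomorphic_divide_root[OF g1(1) this] obtain g2 where
      g2: "g2 holomorphic_on UNIV" "\<And>x. g1 x = (x - r / Q ^ M) * g2 x" by blast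
    have "f x = po x (Suc M) * po (x / r) (Suc M) * (r / (Q ^ M * Q ^ M) * g2 x)" for x
      unfolding f1 g2(2) po_Suc[of "x / r"] using r(1) by (simp add: field_simps)
    moreover have "(\<lambda>x. r / (Q ^ M * Q ^ M) * g2 x) holomorphic_on UNIV"
      using g2(1) by (intro holomorphic_intros)
    ultimately show ?case
      by (intro exI[of _ "\<lambda>x. r / (Q ^ M * Q ^ M) * g2 x"]) simp
  qed
  then show ?thesis using that by blast
qed

text \<open>The factor with index i has modulus at least q^-(N-i), and these exponents add up to
  N(N+1)/2.\<close>

lemma po_large:
  assumes "norm y * q ^ N \<ge> 2"
  shows "norm (po y N) \<ge> 1 / q ^ tri (Suc N)"
  using assms
proof (induction N arbitrary: y)
  case 0
  then show ?case by (simp add: tri_Suc)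
next
  case (Suc N)
  have "norm (y * Q) * q ^ N \<ge> 2" using Suc.prems q0 by (simp add: norm_mult mult_ac)
  then have IH: "1 / q ^ tri (Suc N) \<le> norm (po (y * Q) N)" by (rule Suc.IH)
  have qN: "0 < q ^ Suc N" "q ^ Suc N \<le> 1" using q0 q1 by (auto intro: power_le_one simp del: power_Suc)
  have "norm y \<ge> 2 / q ^ Suc N"
    using Suc.prems qN by (simp only: pos_divide_le_eq)
  then have "norm y \<ge> 2 * (1 / q ^ Suc N)" by simp
  moreover have "1 / q ^ Suc N \<ge> 1" using qN by (simp only: le_divide_eq_1_pos)
  moreover have "norm (1 - y) \<ge> norm y - 1"
    using norm_triangle_ineq2[of y 1] by (simp add: norm_minus_commute)
  ultimately have "norm (1 - y) \<ge> 1 / q ^ Suc N" by linarith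
  then have "1 / q ^ Suc N * (1 / q ^ tri (Suc N)) \<le> norm (1 - y) * norm (po (y * Q) N)"
    using IH q0 by (intro mult_mono) auto
  then show ?case
    by (simp add: po_rec norm_mult tri_Suc[of "Suc N"] power_add mult_ac)
qed

lemma po_large_nz:
  assumes "norm y * q ^ N \<ge> 2"
  shows "po y N \<noteq> 0"
proof -
  have "0 < 1 / q ^ tri (Suc N)" using q0 by simp
  also have "\<dots> \<le> norm (po y N)" by (rule po_large[OF assms])
  finally show ?thesis by simp
qed

text \<open>The quotient of f by (x, x/r; q)_M is at most \<epsilon>_M on the circle of radius
  \<rho> q^-M, hence inside by the maximum principle. At a fixed point the divisor is bounded
  uniformly in M, so f vanishes there as M grows.\<close>

lemma entire_zero_criterion:
  fixes r :: complex
  assumes f: "f holomorphic_on UNIV" and r: "r \<noteq> 0" "\<And>k. r * Q ^ k \<noteq> 1" "\<And>k. 1 / r * Q ^ k \<noteq> 1"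
    and z: "\<And>n. f (1 / Q ^ n) = 0" "\<And>n. f (r / Q ^ n) = 0"
    and rho: "\<rho> \<ge> 2" "\<rho> \<ge> 2 * norm r" and e: "\<epsilon> \<longlonglongrightarrow> 0"
    and b: "\<And>M x. norm x * q ^ M = \<rho> \<Longrightarrow> norm (f x) \<le> \<epsilon> M * (norm (po x M) * norm (po (x / r) M))"
  shows "f x = 0"
proof -
  define H where "H = exp (norm x / (1 - q)) * exp (norm (x / r) / (1 - q))"
  have H0: "0 \<le> H" by (simp add: H_def)
  have "(\<lambda>M. norm x * q ^ M) \<longlonglongrightarrow> norm x * 0"
    using q0 q1 by (intro tendsto_intros LIMSEQ_power_zero) simp
  then have "eventually (\<lambda>M. norm x * q ^ M < 1) sequentially"
    by (rule order_tendstoD) simp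
  then have "eventually (\<lambda>M. norm (f x) \<le> H * \<epsilon> M) sequentially"
  proof eventually_elim
    case (elim M)
    define R where "R = \<rho> / q ^ M"
    have qM: "q ^ M > 0" using q0 by simp
    have "norm x \<le> 1 / q ^ M" using elim qM by (simp add: field_simps)
    also have "\<dots> \<le> R" unfolding R_def using rho qM by (intro divide_right_mono) auto
    finally have R: "norm x \<le> R" .
    have R0: "R > 0" "R * q ^ M = \<rho>" using qM rho by (auto simp: R_def)
    obtain g where g: "g holomorphic_on UNIV" "\<And>x. f x = po x M * po (x / r) M * g x"
      using holomorphic_divide_po[OF f r z] by blast
    have "norm (g x) \<le> \<epsilon> M"
    proof (rule maximum_modulus_frontier[of g "cball 0 R"])
      show "g holomorphic_on interior (cball 0 R)"
        using g(1) by (rule holomorphic_on_subset) simp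
      show "continuous_on (closure (cball 0 R)) g"
        using g(1) by (intro holomorphic_on_imp_continuous_on holomorphic_on_subset[OF g(1)]) simp
      show "x \<in> cball 0 R" using R by simp
      fix y assume "y \<in> frontier (cball (0::complex) R)"
      then have y: "norm y * q ^ M = \<rho>" using R0 by simp
      have "po y M \<noteq> 0" using y rho by (intro po_large_nz) simp
      moreover have "norm (y / r) * q ^ M \<ge> 2"
        using y rho r(1) by (simp add: norm_divide field_simps)
      then have "po (y / r) M \<noteq> 0" by (rule po_large_nz)
      ultimately have "0 < norm (po y M) * norm (po (y / r) M)" by simp
      moreover have "norm (g y) * (norm (po y M) * norm (po (y / r) M)) \<le> \<epsilon> M * (norm (po y M) * norm (po (y / r) M))"
        using b[OF y] by (simp add: g(2) norm_mult mult_ac)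
      ultimately show "norm (g y) \<le> \<epsilon> M" by (rule mult_right_le_imp_le[rotated])
    qed simp
    moreover have "norm (po x M * po (x / r) M) \<le> H"
      unfolding norm_mult H_def by (intro mult_mono norm_po_le) auto
    ultimately show ?case
      unfolding g(2) norm_mult[of "_ * _" "g x"] using H0 by (intro mult_mono) auto
  qed
  moreover have "(\<lambda>M. H * \<epsilon> M) \<longlonglongrightarrow> H * 0" by (intro tendsto_intros e)
  ultimately have "norm (f x) \<le> H * 0"
    by (intro tendsto_lowerbound[of "\<lambda>M. H * \<epsilon> M"]) auto
  then show ?thesis by simp
qed

section \<open>Growth of the 4phi3 side\<close>

lemma norm_po_le':
  assumes "norm x \<le> R"
  shows "norm (po x n) \<le> exp (R / (1 - q))"
  by (rule order_trans[OF norm_po_le]) (use assms q1 in \<open>simp add: divide_right_mono\<close>)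

lemma norm_poi_le':
  assumes "norm x \<le> R"
  shows "norm (poi x) \<le> exp (R / (1 - q))"
  by (rule order_trans[OF norm_poi_le]) (use assms q1 in \<open>simp add: divide_right_mono\<close>)

text \<open>For k < M the missing factors of (y; q)_M are large; for k >= M the additional ones have
  bounded product. Either way the left side is of order q^max(k, M) |(y; q)_M|. Half of this decay
  is kept in M, the other half makes the series in k summable.\<close>

lemma po_growth:
  assumes "norm y * q ^ M \<ge> 2" "norm y * q ^ M \<le> \<tau>"
  shows "q ^ k * norm (po y k) \<le> exp (\<tau> / (1 - q)) * (sqrt q ^ M * sqrt q ^ k) * norm (po y M)"
proof -
  define p where "p = sqrt q"
  have p: "p > 0" "p \<le> 1" "q = p * p" using q0 q1 by (auto simp: p_def)
  have E: "exp (\<tau> / (1 - q)) \<ge> 1"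
  proof -
    have "\<tau> / (1 - q) \<ge> 0" using assms q1 by (intro divide_nonneg_nonneg) auto
    then show ?thesis by simp
  qed
  have qk: "q ^ k = p ^ k * p ^ k" for k using p by (simp add: power_mult_distrib)
  show ?thesis
  proof (cases "k < M")
    case True
    define N where "N = M - k"
    have M: "M = k + N" using True by (simp add: N_def)
    have "norm (y * Q ^ k) * q ^ N \<ge> 2"
      using assms(1) q0 by (simp add: norm_mult norm_power M power_add mult_ac)
    then have "norm (po (y * Q ^ k) N) \<ge> 1 / q ^ tri (Suc N)"
      by (rule po_large)
    also have "q ^ tri (Suc N) \<le> q ^ N"
      using q0 q1 by (intro power_decreasing) (auto simp: tri_Suc)
    then have "1 / q ^ tri (Suc N) \<ge> 1 / q ^ N"
      using q0 by (intro divide_left_mono) auto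
    finally have "norm (po (y * Q ^ k) N) \<ge> 1 / q ^ N" by simp
    then have "norm (po y k) * (1 / q ^ N) \<le> norm (po y k) * norm (po (y * Q ^ k) N)"
      by (intro mult_left_mono) auto
    also have "\<dots> = norm (po y M)" by (simp add: M po_add norm_mult)
    finally have "norm (po y k) \<le> q ^ N * norm (po y M)"
      using q0 by (simp add: field_simps)
    then have "q ^ k * norm (po y k) \<le> q ^ k * (q ^ N * norm (po y M))"
      using q0 by (intro mult_left_mono) auto
    also have "\<dots> = (p ^ M * p ^ M) * norm (po y M)"
      by (simp add: qk M power_add)
    also have "\<dots> \<le> (p ^ M * p ^ k) * norm (po y M)"
      using p True by (intro mult_right_mono mult_left_mono power_decreasing) auto
    also have "\<dots> \<le> exp (\<tau> / (1 - q)) * ((p ^ M * p ^ k) * norm (po y M))"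
      using E p mult_right_mono[of 1 "exp (\<tau> / (1 - q))" "p ^ M * p ^ k * norm (po y M)"] by simp
    finally show ?thesis by (simp add: p_def mult_ac)
  next
    case False
    define N where "N = k - M"
    have k: "k = M + N" using False by (simp add: N_def)
    have "norm (po (y * Q ^ M) N) \<le> exp (\<tau> / (1 - q))"
      using assms(2) q0 by (intro norm_po_le') (simp add: norm_mult norm_power)
    then have "q ^ k * norm (po y k) \<le> q ^ k * (norm (po y M) * exp (\<tau> / (1 - q)))"
      unfolding k po_add norm_mult using q0 by (intro mult_left_mono) auto
    also have "\<dots> \<le> (p ^ M * p ^ k) * (norm (po y M) * exp (\<tau> / (1 - q)))"
      unfolding qk using p False by (intro mult_right_mono power_decreasing) auto
    finally show ?thesis by (simp add: p_def mult_ac)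
  qed
qed

definition phi where
  "phi u v r A1 A2 G1 G2 = (\<Sum>k. po A1 k * po A2 k * po G1 k * po G2 k / (po u k * po v k * po (Q * r) k * po Q k) * Q ^ k)"

text \<open>The first 4phi3 term with the denominators in z and \<gamma> cleared, normalized so that
  the second term is the same expression at (u/r, v/r, 1/r).\<close>

definition half where
  "half u v r A1 A2 G1 G2 = poi (A1 / r) * poi (A2 / r) * poi (G1 / r) * poi (G2 / r)
     / (poi (u / r) * poi (v / r) * poi (1 / r)) * phi u v r A1 A2 G1 G2"

lemma phi_coeff_bound:
  assumes adm: "admissible u v r"
  obtains C where "C \<ge> 0" "\<And>k. norm (po A2 k * po G1 k * po G2 k / (po u k * po v k * po (Q * r) k * po Q k)) \<le> C"
proof -
  note D = admissibleD[OF adm]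
  obtain d1 where d1: "d1 > 0" "\<And>n. norm (po u n) \<ge> d1" using po_lower[OF D(5)] by blast
  obtain d2 where d2: "d2 > 0" "\<And>n. norm (po v n) \<ge> d2" using po_lower[OF D(6)] by blast
  obtain d3 where d3: "d3 > 0" "\<And>n. norm (po (Q * r) n) \<ge> d3" using po_lower[OF D(12)] by blast
  obtain d4 where d4: "d4 > 0" "\<And>n. norm (po Q n) \<ge> d4" using po_lower[OF Q_Q_pow_neq_1] by blast
  show ?thesis
  proof (rule that[of "exp (norm A2 / (1 - q)) * exp (norm G1 / (1 - q)) * exp (norm G2 / (1 - q)) / (d1 * d2 * d3 * d4)"])
    fix k
    show "norm (po A2 k * po G1 k * po G2 k / (po u k * po v k * po (Q * r) k * po Q k))
        \<le> exp (norm A2 / (1 - q)) * exp (norm G1 / (1 - q)) * exp (norm G2 / (1 - q)) / (d1 * d2 * d3 * d4)"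
      unfolding norm_divide norm_mult
      using d1 d2 d3 d4 by (intro frac_le mult_mono norm_po_le mult_pos_pos mult_nonneg_nonneg) (auto intro: less_imp_le)
  qed (use d1 d2 d3 d4 in auto)
qed

lemma half_facts:
  assumes adm: "admissible u v r"
  shows half_holomorphic: "(\<lambda>x. half u v r x A2 G1 G2) holomorphic_on UNIV" (is ?hol)
    and half_growth: "\<exists>K. \<forall>M y. norm y * q ^ M \<ge> 2 \<longrightarrow> norm y * q ^ M \<le> \<tau> \<longrightarrow> norm (y / r) * q ^ M \<le> \<tau> \<longrightarrow>
      norm (half u v r y A2 G1 G2) \<le> K * sqrt q ^ M * (norm (po y M) * norm (po (y / r) M))" (is ?growth)
proof -
  note D = admissibleD[OF adm]
  define c where "c k = po A2 k * po G1 k * po G2 k / (po u k * po v k * po (Q * r) k * po Q k)" for k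
  obtain C where C: "C \<ge> 0" "\<And>k. norm (c k) \<le> C"
    using phi_coeff_bound[OF adm, of A2 G1 G2] unfolding c_def by blast
  have phi: "phi u v r x A2 G1 G2 = (\<Sum>k. c k * Q ^ k * po x k)" for x
    by (simp add: phi_def c_def mult_ac)
  have "(\<lambda>x. \<Sum>k. c k * Q ^ k * po x k) holomorphic_on UNIV"
  proof (rule holomorphic_suminf)
    fix R :: real
    have "norm (c n * Q ^ n * po x n) \<le> C * q ^ n * exp (R / (1 - q))" if "norm x \<le> R" for n x
      using C norm_po_le'[OF that] q0 by (auto simp: norm_mult norm_power intro!: mult_mono)
    moreover have "summable (\<lambda>n. C * q ^ n * exp (R / (1 - q)))"
      using q0 q1 by (intro summable_mult summable_mult2 summable_geometric) auto
    ultimately show "\<exists>M. summable M \<and> (\<forall>n x. norm x \<le> R \<longrightarrow> norm (c n * Q ^ n * po x n) \<le> M n)"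
      by blast
  qed (intro holomorphic_intros)
  then show ?hol
    unfolding half_def phi divide_inverse by (intro holomorphic_intros)
  define P where "P = poi (A2 / r) * poi (G1 / r) * poi (G2 / r) / (poi (u / r) * poi (v / r) * poi (1 / r))"
  define E where "E = exp (\<tau> / (1 - q))"
  define p where "p = sqrt q"
  have p: "0 < p" "p < 1" using q0 q1 by (auto simp: p_def)
  show ?growth
  proof (intro exI allI impI)
    fix M y assume y: "norm y * q ^ M \<ge> 2" "norm y * q ^ M \<le> \<tau>" "norm (y / r) * q ^ M \<le> \<tau>"
    have b: "norm (c k * Q ^ k * po y k) \<le> (C * E * p ^ M * norm (po y M)) * p ^ k" for k
    proof -
      have "norm (c k * Q ^ k * po y k) = norm (c k) * (q ^ k * norm (po y k))"
        using q0 by (simp add: norm_mult norm_power)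
      also have "\<dots> \<le> C * (E * (p ^ M * p ^ k) * norm (po y M))"
        using po_growth[OF y(1,2), of k] C q0 unfolding E_def p_def by (intro mult_mono[OF C(2)]) auto
      finally show ?thesis by (simp add: mult_ac)
    qed
    have sg: "summable (\<lambda>k. (C * E * p ^ M * norm (po y M)) * p ^ k)"
      using p by (intro summable_mult summable_geometric) auto
    have "norm (phi u v r y A2 G1 G2) \<le> (\<Sum>k. (C * E * p ^ M * norm (po y M)) * p ^ k)"
      unfolding phi by (rule norm_suminf_le[OF b sg])
    also have "\<dots> = (C * E * p ^ M * norm (po y M)) * (1 / (1 - p))"
      using p by (subst suminf_mult) (auto simp: suminf_geometric intro!: summable_geometric)
    finally have 1: "norm (phi u v r y A2 G1 G2) \<le> (C * E * p ^ M * norm (po y M)) * (1 / (1 - p))" .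
    have "norm (poi (y / r * Q ^ M)) \<le> E"
      unfolding E_def using y(3) q0 by (intro norm_poi_le') (simp add: norm_mult norm_power norm_divide)
    then have 2: "norm (poi (y / r)) \<le> norm (po (y / r) M) * E"
      unfolding poi_split[of "y / r" M] norm_mult by (intro mult_left_mono) auto
    have "norm (half u v r y A2 G1 G2) = norm P * norm (poi (y / r)) * norm (phi u v r y A2 G1 G2)"
      by (simp add: half_def P_def norm_mult norm_divide)
    also have "\<dots> \<le> norm P * (norm (po (y / r) M) * E) * ((C * E * p ^ M * norm (po y M)) * (1 / (1 - p)))"
      using 1 2 p by (intro mult_mono mult_nonneg_nonneg) (auto simp: E_def)
    finally show "norm (half u v r y A2 G1 G2) \<le> (norm P * E * C * E / (1 - p)) * sqrt q ^ M * (norm (po y M) * norm (po (y / r) M))"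
      by (simp add: p_def mult_ac)
  qed
qed

section \<open>Growth of the polynomials and of the kernel\<close>

lemma qbin_bounded: obtains C where "C \<ge> 0" "\<And>m j. norm (qbin m j) \<le> C"
proof -
  obtain d where d: "d > 0" "\<And>n. norm (po Q n) \<ge> d"
    using po_lower[OF Q_Q_pow_neq_1] by blast
  show ?thesis
  proof (rule that[of "exp (norm Q / (1 - q)) / (d * d)"])
    fix m j
    have "norm (po Q m) / (norm (po Q j) * norm (po Q (m - j))) \<le> exp (norm Q / (1 - q)) / (d * d)"
      using d by (intro frac_le mult_mono norm_po_le) (auto intro: less_imp_le)
    moreover have "0 \<le> exp (norm Q / (1 - q)) / (d * d)" using d by simp
    ultimately show "norm (qbin m j) \<le> exp (norm Q / (1 - q)) / (d * d)"
      by (simp add: qbin_def norm_divide norm_mult)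
  qed (use d in auto)
qed

text \<open>For i < m both parts of the factor x - q^i are of order q^i. The resulting power of q
  compensates the division by \<open>Q ^ tri j\<close> in \<open>awp_summand\<close>.\<close>

lemma norm_hpo_small:
  assumes "norm x \<le> c * q ^ m" "j \<le> m"
  shows "norm (hpo x 1 j) \<le> (c + 1) ^ j * q ^ tri j"
  using assms(2)
proof (induction j)
  case (Suc j)
  have c: "c \<ge> 0"
  proof -
    have "0 < q ^ m" using q0 by simp
    moreover have "0 \<le> c * q ^ m" using order_trans[OF norm_ge_zero assms(1)] .
    ultimately show ?thesis by (auto simp: zero_le_mult_iff)
  qed
  have "q ^ m \<le> q ^ j" using Suc.prems q0 q1 by (intro power_decreasing) auto
  then have "c * q ^ m \<le> c * q ^ j" using c by (rule mult_left_mono)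
  moreover have "norm (x - 1 * Q ^ j) \<le> norm x + q ^ j"
    using norm_triangle_ineq4[of x "Q ^ j"] q0 by (simp add: norm_power)
  ultimately have "norm (x - 1 * Q ^ j) \<le> (c + 1) * q ^ j"
    using assms(1) by (simp add: algebra_simps)
  then have "norm (hpo x 1 j) * norm (x - 1 * Q ^ j) \<le> ((c + 1) ^ j * q ^ tri j) * ((c + 1) * q ^ j)"
    using Suc c q0 by (intro mult_mono) auto
  then show ?case
    unfolding hpo_Suc norm_mult by (simp add: tri_Suc power_add mult_ac)
qed simp

abbreviation awp_summand where
  "awp_summand s u v r A1 A2 m j \<equiv> (-1) ^ j * qbin m j * (hpo (s * Q ^ m / u) 1 j / Q ^ tri j * A2 ^ j)
     * (po A1 j * hpo A1 v (m - j)) * (po (u / A2) j * po (u * Q ^ j) (m - j) * po (A2 / r) (m - j))"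

(* The growth of awp in m is only exponential, although the terms of its defining sum grow like
   q^(-m^2/2): the Sears transformation rewrites it without cancellation. *)
lemma awp_transformed:
  assumes adm: "admissible u v r" and A2: "A2 \<noteq> 0"
  shows "po u m * po v m * awp u v r A1 A2 m =
    (\<Sum>j\<le>m. awp_summand (sp u v r) u v r A1 A2 m j)"
proof -
  define s where "s = sp u v r"
  note D = admissibleD[OF adm, folded s_def]
  have s: "s * (Q * r) = u * v" using D by (simp add: s_def sp_def)
  have nz: "po u k \<noteq> 0" "po v k \<noteq> 0" for k using D by (auto intro!: po_nz)
  define T where "T = A2 * (s * Q ^ m / u)"
  define X where "X = u / A2"
  define Y where "Y = u / (s * Q ^ m)"
  have e: "T * X = s * Q ^ m" "s * Q ^ m * Y = u" "T * Y = A2"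
    using D A2 by (simp_all add: T_def X_def Y_def)
  have F: "A2 / r = T * Q / (Q ^ m * v)"
  proof -
    have "T * Q / (Q ^ m * v) = A2 * (s * (Q * r)) / (u * v) / r"
      using D by (simp add: T_def field_simps)
    then show ?thesis using D by (simp add: s)
  qed
  have "po u m * po v m * awp u v r A1 A2 m = (\<Sum>k\<le>m. hq m k * (po A1 k * po (s * Q ^ m) k * po A2 k
      * po (u * Q ^ k) (m - k) * po (v * Q ^ k) (m - k) * po (A1 * (A2 / r) * Q ^ k) (m - k)))"
    unfolding awp_def sum_distrib_left s_def[symmetric]
  proof (intro sum.cong refl, goal_cases)
    case (1 k)
    then have k: "k \<le> m" by simp
    show ?case
      using nz[of k] po_split[OF k, of u] po_split[OF k, of v] by simp
  qed
  also have "\<dots> = (\<Sum>j\<le>m. hq m j * (po A1 j * po X j * po Y j * T ^ j * po (u * Q ^ j) (m - j)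
            * hpo A1 v (m - j) * po (A2 / r) (m - j) * Q ^ (j * (m - j))))"
    using sears[OF D(2) F, of A1 X Y] unfolding e by simp
  also have "\<dots> = (\<Sum>j\<le>m. awp_summand s u v r A1 A2 m j)"
  proof (intro sum.cong refl, goal_cases)
    case (1 j)
    then obtain N where m: "m = j + N" using le_Suc_ex by (metis atMost_iff)
    have h: "hpo (s * Q ^ m / u) 1 j = (s * Q ^ m / u) ^ j * po Y j"
      using hpo_po[of "s * Q ^ m / u" 1 j] D by (simp add: Y_def)
    have 1: "hq m j = (-1) ^ j * Q ^ tri j / Q ^ (m * j) * qbin m j * Q ^ j"
      using po_minus_power[of j m] by (simp add: hq_def qbin_def m)
    have 2: "Q ^ (m * j) = Q ^ tri j * Q ^ tri j * Q ^ j * Q ^ (j * N)"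
      by (simp add: m algebra_simps power_add power_2_tri)
    have 3: "hq m j * (po Y j * T ^ j * Q ^ (j * N)) = (-1) ^ j * qbin m j * (hpo (s * Q ^ m / u) 1 j / Q ^ tri j * A2 ^ j)"
      unfolding h 1 2 T_def power_mult_distrib by simp
    let "?l = _" = ?case
    have "?l
      = (hq m j * (po Y j * T ^ j * Q ^ (j * N))) * (po A1 j * hpo A1 v (m - j))
       * (po (u / A2) j * po (u * Q ^ j) (m - j) * po (A2 / r) (m - j))"
      by (simp add: m X_def mult_ac)
    then show ?case
      unfolding 3 .
  qed
  finally show ?thesis by (simp add: s_def)
qed

text \<open>The dependence on A1 is kept explicit because the kernel will be estimated on circles
  whose radius grows with M.\<close>

lemma awp_bound:
  assumes adm: "admissible u v r" and A2: "A2 \<noteq> 0"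
  obtains C B where "C \<ge> 0" "B \<ge> 1" "\<And>A1 m. norm (awp u v r A1 A2 m) \<le> C * (B * (1 + norm A1)) ^ m"
proof -
  define s where "s = sp u v r"
  note D = admissibleD[OF adm, folded s_def]
  obtain C0 where C0: "C0 \<ge> 0" "\<And>m j. norm (qbin m j) \<le> C0" using qbin_bounded by blast
  obtain d1 where d1: "d1 > 0" "\<And>n. norm (po u n) \<ge> d1" using po_lower[OF D(5)] by blast
  obtain d2 where d2: "d2 > 0" "\<And>n. norm (po v n) \<ge> d2" using po_lower[OF D(6)] by blast
  define E where "E = exp (norm (u / A2) / (1 - q)) * exp (norm u / (1 - q)) * exp (norm (A2 / r) / (1 - q))"
  define B1 where "B1 = (norm (s / u) + 1) * norm A2"
  define B where "B = max 1 (max B1 (1 + norm v))"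
  have B: "B \<ge> 1" "B \<ge> B1" "B \<ge> 1 + norm v" by (auto simp: B_def)
  have B1: "B1 \<ge> 0" by (simp add: B1_def)
  show ?thesis
  proof (rule that[of "C0 * E / (d1 * d2)" "2 * B"])
    fix A1 :: complex and m
    define R where "R = 1 + norm A1"
    have R: "R \<ge> 1" "norm A1 \<le> R" by (auto simp: R_def)
    have "norm (po u m * po v m * awp u v r A1 A2 m) \<le> (\<Sum>j\<le>m. C0 * E * (B * R) ^ m)"
      unfolding awp_transformed[OF assms] s_def[symmetric]
    proof (rule sum_norm_le)
      fix j assume "j \<in> {..m}"
      then have j: "j \<le> m" by simp
      have 1: "norm (hpo (s * Q ^ m / u) 1 j / Q ^ tri j * A2 ^ j) \<le> B1 ^ j"
      proof -
        have "norm (hpo (s * Q ^ m / u) 1 j) \<le> (norm (s / u) + 1) ^ j * q ^ tri j"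
          using q0 j by (intro norm_hpo_small[where m = m]) (auto simp: norm_mult norm_divide norm_power)
        then have "norm (hpo (s * Q ^ m / u) 1 j) / q ^ tri j \<le> (norm (s / u) + 1) ^ j"
          using q0 by (simp add: pos_divide_le_eq)
        then have "norm (hpo (s * Q ^ m / u) 1 j) / q ^ tri j * norm A2 ^ j \<le> (norm (s / u) + 1) ^ j * norm A2 ^ j"
          by (rule mult_right_mono) simp
        then show ?thesis
          using q0 unfolding B1_def power_mult_distrib by (simp add: norm_mult norm_divide norm_power)
      qed
      have 2: "norm (po A1 j) \<le> R ^ j"
        using norm_hpo_le[of 1 A1 j] by (simp add: hpo_1 R_def)
      have 3: "norm (hpo A1 v (m - j)) \<le> (B * R) ^ (m - j)"
      proof -
        have "norm A1 + norm v \<le> B * R"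
        proof -
          have "norm A1 + norm v \<le> (1 + norm v) * R"
            by (simp add: R_def algebra_simps)
          also have "\<dots> \<le> B * R" using B R by (intro mult_right_mono) auto
          finally show ?thesis .
        qed
        then have "(norm A1 + norm v) ^ (m - j) \<le> (B * R) ^ (m - j)"
          by (intro power_mono) auto
        with norm_hpo_le show ?thesis by (rule order_trans)
      qed
      have uQ: "norm (u * Q ^ j) \<le> norm u"
        using q0 q1 by (simp add: norm_mult norm_power mult_left_le power_le_one)
      have 4: "norm (po (u / A2) j * po (u * Q ^ j) (m - j) * po (A2 / r) (m - j)) \<le> E"
        unfolding E_def norm_mult
        by (intro mult_mono norm_po_le norm_po_le' uQ) auto
      have "norm (awp_summand s u v r A1 A2 m j)
        = norm (qbin m j) * norm (hpo (s * Q ^ m / u) 1 j / Q ^ tri j * A2 ^ j) * (norm (po A1 j) * norm (hpo A1 v (m - j)))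
         * norm (po (u / A2) j * po (u * Q ^ j) (m - j) * po (A2 / r) (m - j))"
        by (simp add: norm_mult norm_power norm_divide)
      also have "\<dots> \<le> C0 * B1 ^ j * (R ^ j * (B * R) ^ (m - j)) * E"
        using C0 1 2 3 4 B B1 R by (intro mult_mono mult_nonneg_nonneg) (auto intro: zero_le_power)
      also have "\<dots> \<le> C0 * B ^ j * (R ^ j * (B * R) ^ (m - j)) * E"
        using C0 B B1 R by (intro mult_mono mult_right_mono mult_left_mono power_mono mult_nonneg_nonneg) (auto simp: E_def)
      also have "\<dots> = C0 * E * ((B * R) ^ j * (B * R) ^ (m - j))"
        by (simp add: power_mult_distrib)
      also have "(B * R) ^ j * (B * R) ^ (m - j) = (B * R) ^ m"
        using j by (simp flip: power_add)
      finally show "norm (awp_summand s u v r A1 A2 m j) \<le> C0 * E * (B * R) ^ m" .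
    qed
    also have "\<dots> = real (Suc m) * (C0 * E * (B * R) ^ m)" by simp
    \<comment> \<open>The number of terms is absorbed into the base of the exponential
      bound.\<close>
    also have "\<dots> \<le> 2 ^ m * (C0 * E * (B * R) ^ m)"
    proof (intro mult_right_mono)
      have "Suc m \<le> 2 ^ m" by (induction m) auto
      then show "real (Suc m) \<le> 2 ^ m" by (metis of_nat_le_iff of_nat_numeral of_nat_power)
      show "0 \<le> C0 * E * (B * R) ^ m"
        using C0 B R by (auto simp: E_def)
    qed
    finally have le: "norm (po u m) * norm (po v m) * norm (awp u v r A1 A2 m) \<le> C0 * E * (2 * B * R) ^ m"
      by (simp add: norm_mult power_mult_distrib mult_ac)
    have "d1 * d2 * norm (awp u v r A1 A2 m) \<le> norm (po u m) * norm (po v m) * norm (awp u v r A1 A2 m)"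
      using d1 d2 by (intro mult_right_mono mult_mono) auto
    with le have "d1 * d2 * norm (awp u v r A1 A2 m) \<le> C0 * E * (2 * B * R) ^ m" by simp
    then show "norm (awp u v r A1 A2 m) \<le> C0 * E / (d1 * d2) * (2 * B * (1 + norm A1)) ^ m"
      using d1 d2 by (simp add: R_def field_simps)
  qed (use C0 d1 d2 B in \<open>auto simp: E_def\<close>)
qed

lemma exp_bd_awp:
  assumes "admissible u v r" "A2 \<noteq> 0"
  shows "exp_bd (awp u v r A1 A2)"
proof -
  obtain C B where "C \<ge> 0" "B \<ge> 1" "\<And>A1 m. norm (awp u v r A1 A2 m) \<le> C * (B * (1 + norm A1)) ^ m"
    using awp_bound[OF assms] by blast
  then show ?thesis by (intro exp_bdI[of _ C "B * (1 + norm A1)"]) auto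
qed

lemma exp_bd_poi: "exp_bd (\<lambda>m. poi (w * Q ^ m))"
proof (rule exp_bdI[of _ _ 1])
  fix m
  show "norm (poi (w * Q ^ m)) \<le> exp (norm w / (1 - q)) * 1 ^ m"
    using q0 q1 by (simp add: norm_mult norm_power mult_left_le power_le_one norm_poi_le')
qed simp

lemma po_upper:
  assumes "norm z * q ^ N \<le> \<tau>" "\<tau> \<ge> 1"
  shows "norm (po z N) \<le> (2 * \<tau>) ^ N / q ^ tri (Suc N)"
  using assms(1)
proof (induction N arbitrary: z)
  case 0
  then show ?case by (simp add: tri_Suc)
next
  case (Suc N)
  have "norm (z * Q) * q ^ N \<le> \<tau>" using Suc.prems q0 by (simp add: norm_mult mult_ac)
  then have IH: "norm (po (z * Q) N) \<le> (2 * \<tau>) ^ N / q ^ tri (Suc N)" by (rule Suc.IH)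
  have qN: "0 < q ^ Suc N" "q ^ Suc N \<le> 1" using q0 q1 by (auto intro: power_le_one simp del: power_Suc)
  have "norm z \<le> \<tau> / q ^ Suc N"
    using Suc.prems qN by (simp only: pos_le_divide_eq)
  moreover have "1 \<le> \<tau> / q ^ Suc N" using qN assms(2) by (simp only: le_divide_eq_1_pos)
  moreover have "norm (1 - z) \<le> 1 + norm z"
    using norm_triangle_ineq4[of 1 z] by simp
  ultimately have "norm (1 - z) \<le> 2 * (\<tau> / q ^ Suc N)" by linarith
  then have "norm (1 - z) * norm (po (z * Q) N) \<le> 2 * (\<tau> / q ^ Suc N) * ((2 * \<tau>) ^ N / q ^ tri (Suc N))"
    using IH q0 assms(2) by (intro mult_mono) auto
  then show ?case
    by (simp add: po_rec norm_mult tri_Suc[of "Suc N"] power_add mult_ac)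
qed

lemma square_tri: "m * m = 2 * tri m + m"
  by (induction m) (simp_all add: tri_Suc)

text \<open>The infinite product in x is left in place: on a fixed disc it is bounded, whereas on
  large circles its size depends on m.\<close>

lemma ker_term_bound:
  assumes adm: "admissible u v r" and nz: "A2 \<noteq> 0" "G2 \<noteq> 0"
  obtains C B where "C \<ge> 0" "B \<ge> 1"
    "\<And>x m. norm (ker_term u v r x A2 G1 G2 m)
       \<le> C * (B * (1 + norm x)) ^ m * q ^ tri m * norm (poi (x * A2 / r * Q ^ m))"
proof -
  obtain f where f: "exp_bd f" "\<And>m. wt u v r m = Q ^ tri m * f m"
    using wt_exp_bd[OF adm] by blast
  define g where "g m = f m * (awp u v r G1 G2 m * poi (G1 * G2 / r * Q ^ m))" for m
  have "exp_bd g"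
    unfolding g_def[abs_def] by (intro exp_bd_mult f exp_bd_awp[OF adm nz(2)] exp_bd_poi)
  then obtain C1 B1 where 1: "C1 \<ge> 0" "B1 \<ge> 1" "\<And>m. norm (g m) \<le> C1 * B1 ^ m"
    by (rule exp_bdE) blast
  obtain C2 B2 where 2: "C2 \<ge> 0" "B2 \<ge> 1" "\<And>x m. norm (awp u v r x A2 m) \<le> C2 * (B2 * (1 + norm x)) ^ m"
    using awp_bound[OF adm nz(1)] by blast
  show ?thesis
  proof (rule that[of "C1 * C2" "B1 * B2"])
    show "C1 * C2 \<ge> 0" using 1 2 by simp
    show "B1 * B2 \<ge> 1" using 1 2 mult_mono[of 1 B1 1 B2] by simp
    fix x :: complex and m
    have "norm (ker_term u v r x A2 G1 G2 m)
       = norm (g m) * norm (awp u v r x A2 m) * q ^ tri m * norm (poi (x * A2 / r * Q ^ m))"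
      using q0 by (simp add: f(2) g_def norm_mult norm_power)
    also have "\<dots> \<le> (C1 * B1 ^ m) * (C2 * (B2 * (1 + norm x)) ^ m) * q ^ tri m * norm (poi (x * A2 / r * Q ^ m))"
      using 1 q0 by (intro mult_right_mono mult_mono 1(3) 2(3)) auto
    finally show "norm (ker_term u v r x A2 G1 G2 m)
       \<le> C1 * C2 * (B1 * B2 * (1 + norm x)) ^ m * q ^ tri m * norm (poi (x * A2 / r * Q ^ m))"
      by (simp add: power_mult_distrib mult_ac)
  qed
qed

lemma ker_holomorphic:
  assumes adm: "admissible u v r" and nz: "A2 \<noteq> 0" "G2 \<noteq> 0"
  shows "(\<lambda>x. ker u v r x A2 G1 G2) holomorphic_on UNIV"
  unfolding ker_def
proof (rule holomorphic_suminf)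
  fix m
  show "(\<lambda>x. ker_term u v r x A2 G1 G2 m) holomorphic_on UNIV"
    unfolding awp_def divide_inverse by (intro holomorphic_intros)
next
  fix R :: real
  obtain C B where CB: "C \<ge> 0" "B \<ge> 1"
    "\<And>x m. norm (ker_term u v r x A2 G1 G2 m)
       \<le> C * (B * (1 + norm x)) ^ m * q ^ tri m * norm (poi (x * A2 / r * Q ^ m))"
    using ker_term_bound[OF assms, of G1] by blast
  define E where "E = exp (R * norm (A2 / r) / (1 - q))"
  show "\<exists>M. summable M \<and> (\<forall>m x. norm x \<le> R \<longrightarrow>
     norm (ker_term u v r x A2 G1 G2 m) \<le> M m)"
  proof (intro exI conjI allI impI)
    show "summable (\<lambda>m. C * (B * (1 + R)) ^ m * q ^ tri m * E)"
      by (intro summable_mult2 summable_gauss)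
    fix m and x :: complex assume x: "norm x \<le> R"
    have "norm (x * A2 / r * Q ^ m) = norm x * norm (A2 / r) * q ^ m"
      using q0 by (simp add: norm_mult norm_divide norm_power)
    also have "\<dots> \<le> R * norm (A2 / r) * 1"
      using q0 q1 x order_trans[OF norm_ge_zero x] by (intro mult_mono power_le_one) auto
    finally have "norm (poi (x * A2 / r * Q ^ m)) \<le> E"
      unfolding E_def by (intro norm_poi_le') simp
    then have "C * (B * (1 + norm x)) ^ m * q ^ tri m * norm (poi (x * A2 / r * Q ^ m)) \<le> C * (B * (1 + R)) ^ m * q ^ tri m * E"
      using CB(1,2) x q0 order_trans[OF norm_ge_zero x]
      by (intro mult_mono mult_left_mono mult_right_mono power_mono mult_nonneg_nonneg zero_le_power) auto
    with CB(3) show "norm (ker_term u v r x A2 G1 G2 m)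
       \<le> C * (B * (1 + R)) ^ m * q ^ tri m * E"
      by (rule order_trans)
  qed
qed

text \<open>On |x| = \<rho> q^-M the m-th term has the factor q^(tri m - M m). For m < M the
  infinite product adds q^(-tri(M-m+1)), and the exponents sum to -tri(M+1) whatever m is. For m = M
  + j there remains a Gaussian decay in j.\<close>

lemma ker_growth:
  assumes adm: "admissible u v r" and nz: "A2 \<noteq> 0" "G2 \<noteq> 0" and "\<rho> \<ge> 1"
  shows "\<exists>K D. \<forall>M x. norm x * q ^ M = \<rho> \<longrightarrow> norm (ker u v r x A2 G1 G2) \<le> K * D ^ M / q ^ tri (Suc M)"
proof -
  obtain C B where CB: "C \<ge> 0" "B \<ge> 1"
    "\<And>x m. norm (ker_term u v r x A2 G1 G2 m)
       \<le> C * (B * (1 + norm x)) ^ m * q ^ tri m * norm (poi (x * A2 / r * Q ^ m))"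
    using ker_term_bound[OF adm nz, of G1] by blast
  define \<tau> where "\<tau> = max 1 (\<rho> * norm (A2 / r))"
  define e where "e = exp (\<tau> / (1 - q))"
  define L where "L = 2 * B * \<rho>"
  define D where "D = max L (2 * \<tau>)"
  have tau: "\<tau> \<ge> 1" "\<rho> * norm (A2 / r) \<le> \<tau>" by (auto simp: \<tau>_def)
  have D: "D \<ge> 1" "D \<ge> L" "D \<ge> 2 * \<tau>" "L \<ge> 0" "e \<ge> 0"
    using tau CB \<open>\<rho> \<ge> 1\<close> by (auto simp: D_def L_def e_def)
  define S where "S = (\<Sum>j. 1 * D ^ j * q ^ tri j)"
  have S0: "S \<ge> 0" unfolding S_def using D q0 by (intro suminf_nonneg summable_gauss) auto
  show ?thesis
  proof (intro exI allI impI)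
    fix M and x :: complex assume x: "norm x * q ^ M = \<rho>"
    have qM: "0 < q ^ M" "q ^ M \<le> 1" using q0 q1 by (auto intro: power_le_one)
    have xM: "norm x = \<rho> / q ^ M" using x qM by (simp add: field_simps)
    have x1: "norm x \<ge> 1"
    proof -
      have "norm x * q ^ M \<le> norm x * 1" using qM by (intro mult_left_mono) auto
      then show ?thesis using x \<open>\<rho> \<ge> 1\<close> by simp
    qed
    define y where "y = x * A2 / r"
    have y: "norm y * q ^ M \<le> \<tau>"
    proof -
      have "norm y * q ^ M = (norm x * q ^ M) * norm (A2 / r)"
        by (simp add: y_def norm_mult norm_divide)
      then show ?thesis using x tau by simp
    qed
    define t where "t m = wt u v r m * (awp u v r x A2 m * poi (y * Q ^ m) * (awp u v r G1 G2 m * poi (G1 * G2 / r * Q ^ m)))" for m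
    define K where "K = C * e * D ^ M / q ^ tri (Suc M)"
    have K0: "K \<ge> 0" using CB D q0 by (simp add: K_def)
    have t: "norm (t m) \<le> C * (L ^ m / (q ^ M) ^ m) * q ^ tri m * norm (poi (y * Q ^ m))" for m
    proof -
      have "B * (1 + norm x) \<le> B * (2 * norm x)" using x1 CB by (intro mult_left_mono) auto
      also have "\<dots> = L / q ^ M" by (simp add: xM L_def)
      finally have "(B * (1 + norm x)) ^ m \<le> (L / q ^ M) ^ m" using CB by (intro power_mono) auto
      then have "C * (B * (1 + norm x)) ^ m * q ^ tri m * norm (poi (y * Q ^ m)) \<le> C * (L / q ^ M) ^ m * q ^ tri m * norm (poi (y * Q ^ m))"
        using CB q0 by (intro mult_right_mono mult_left_mono) auto
      with CB(3)[of m x] show ?thesis by (simp add: t_def y_def power_divide)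
    qed
    have big: "norm (poi (y * Q ^ (M + j))) \<le> e" for j
    proof -
      have "norm (y * Q ^ (M + j)) = norm y * q ^ M * q ^ j"
        using q0 by (simp add: norm_mult norm_power power_add)
      also have "\<dots> \<le> \<tau> * 1"
        using y tau q0 q1 by (intro mult_mono power_le_one) auto
      finally show ?thesis unfolding e_def by (intro norm_poi_le') simp
    qed
    have low: "norm (t m) \<le> K" if "m < M" for m
    proof -
      define N where "N = M - m"
      have M: "M = m + N" using that by (simp add: N_def)
      have "norm (y * Q ^ m) * q ^ N \<le> \<tau>"
        using y q0 by (simp add: M norm_mult norm_power power_add mult_ac)
      then have p: "norm (po (y * Q ^ m) N) \<le> (2 * \<tau>) ^ N / q ^ tri (Suc N)"
        by (rule po_upper) (rule tau)
      have "poi (y * Q ^ m) = po (y * Q ^ m) N * poi (y * Q ^ (M + 0))"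
        using poi_split[of "y * Q ^ m" N] by (simp add: M power_add mult_ac)
      then have "norm (poi (y * Q ^ m)) \<le> (2 * \<tau>) ^ N / q ^ tri (Suc N) * e"
        using p big[of 0] tau q0 by (simp only: norm_mult) (intro mult_mono, auto)
      then have "norm (t m) \<le> C * (L ^ m / (q ^ M) ^ m) * q ^ tri m * ((2 * \<tau>) ^ N / q ^ tri (Suc N) * e)"
        using CB D q0 by (intro order_trans[OF t] mult_left_mono) auto
      also have "\<dots> \<le> C * (D ^ m / (q ^ M) ^ m) * q ^ tri m * (D ^ N / q ^ tri (Suc N) * e)"
        using CB D q0 tau
        by (intro mult_mono mult_left_mono mult_right_mono divide_right_mono power_mono) auto
      also have "\<dots> = C * e * D ^ M * (q ^ tri m / ((q ^ M) ^ m * q ^ tri (Suc N)))"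
        by (simp add: M power_add)
      also have "q ^ tri m / ((q ^ M) ^ m * q ^ tri (Suc N)) = 1 / q ^ tri (Suc M)"
      proof -
        \<comment> \<open>The exponents match exactly, with no loss in m: all terms below M share
          one bound.\<close>
        have "tri m + tri (Suc M) = M * m + tri (Suc N)"
          using square_tri[of m] tri_add[of m "Suc N"] by (simp add: M algebra_simps)
        then have "q ^ tri m * q ^ tri (Suc M) = (q ^ M) ^ m * q ^ tri (Suc N)"
          by (simp flip: power_add power_mult)
        then show ?thesis using q0 by (simp add: field_simps)
      qed
      finally show ?thesis by (simp add: K_def)
    qed
    have high: "norm (t (M + j)) \<le> K * (1 * D ^ j * q ^ tri j)" for j
    proof -
      have "norm (t (M + j)) \<le> C * (L ^ (M + j) / (q ^ M) ^ (M + j)) * q ^ tri (M + j) * e"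
        using CB D q0 by (intro order_trans[OF t] mult_left_mono big) auto
      also have "\<dots> \<le> C * (D ^ (M + j) / (q ^ M) ^ (M + j)) * q ^ tri (M + j) * e"
        using CB D q0
        by (intro mult_left_mono mult_right_mono divide_right_mono power_mono) auto
      also have "\<dots> = C * e * D ^ M * D ^ j * (q ^ tri (M + j) / (q ^ M) ^ (M + j))"
        by (simp add: power_add)
      also have "q ^ tri (M + j) / (q ^ M) ^ (M + j) = q ^ tri j / q ^ tri (Suc M)"
      proof -
        have "tri (M + j) + tri (Suc M) = M * (M + j) + tri j"
          using square_tri[of M] tri_add[of M j] by (simp add: tri_Suc algebra_simps)
        then have "q ^ tri (M + j) * q ^ tri (Suc M) = (q ^ M) ^ (M + j) * q ^ tri j"
          by (simp flip: power_add power_mult)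
        then show ?thesis using q0 by (simp add: field_simps)
      qed
      finally show ?thesis by (simp add: K_def)
    qed
    have sg: "summable (\<lambda>j. K * (1 * D ^ j * q ^ tri j))"
      by (intro summable_mult summable_gauss)
    have "summable (\<lambda>j. t (j + M))"
      by (rule summable_comparison_test'[OF sg]) (use high in \<open>simp add: add.commute\<close>)
    then have sum_t: "summable t" by (simp only: summable_iff_shift)
    have "norm (\<Sum>j. t (j + M)) \<le> (\<Sum>j. K * (1 * D ^ j * q ^ tri j))"
      by (rule norm_suminf_le[OF _ sg]) (use high in \<open>simp add: add.commute\<close>)
    also have "\<dots> = K * S" unfolding S_def by (intro suminf_mult summable_gauss)
    finally have tail: "norm (\<Sum>j. t (j + M)) \<le> K * S" .
    have "norm (\<Sum>m<M. t m) \<le> (\<Sum>m<M. K)"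
      by (rule sum_norm_le) (use low in auto)
    then have head: "norm (\<Sum>m<M. t m) \<le> M * K" by simp
    have "ker u v r x A2 G1 G2 = (\<Sum>j. t (j + M)) + (\<Sum>m<M. t m)"
      unfolding suminf_split_initial_segment[OF sum_t, of M, symmetric] unfolding ker_def t_def y_def ..
    then have "norm (ker u v r x A2 G1 G2) \<le> K * S + M * K"
      using norm_triangle_ineq[of "\<Sum>j. t (j + M)" "\<Sum>m<M. t m"] head tail by simp
    also have "\<dots> = K * (S + M)" by (simp add: algebra_simps)
    \<comment> \<open>The M initial terms and the tail together cost a factor that is absorbed by
      doubling D.\<close>
    also have "\<dots> \<le> K * (2 ^ M * (S + 1))"
    proof (intro mult_left_mono K0)
      have "real M \<le> 2 ^ M"
        using of_nat_less_two_power[of M] less_imp_le by blast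
      moreover have "1 * S \<le> 2 ^ M * S" using S0 by (intro mult_right_mono) auto
      ultimately show "S + M \<le> 2 ^ M * (S + 1)" unfolding distrib_left by linarith
    qed
    finally show "norm (ker u v r x A2 G1 G2) \<le> (C * e * (S + 1)) * (2 * D) ^ M / q ^ tri (Suc M)"
      by (simp add: K_def power_mult_distrib mult_ac)
  qed
qed

section \<open>Equality of both sides by interpolation\<close>

definition ker_sum where
  "ker_sum u v r A1 A2 G1 G2 = poi (sp u v r * Q) *
     (half u v r A1 A2 G1 G2 + half (u / r) (v / r) (1 / r) (A1 / r) (A2 / r) (G1 / r) (G2 / r))"

lemma half_swap: "half u v r A1 A2 G1 G2 = half u v r G1 G2 A1 A2"
  by (simp add: half_def phi_def mult_ac)

lemma ker_sum_swap: "ker_sum u v r A1 A2 G1 G2 = ker_sum u v r G1 G2 A1 A2"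
  unfolding ker_sum_def half_swap[of u v r A1] half_swap[of "u / r" "v / r" "1 / r" "A1 / r"] ..

lemma ker_sum_flip:
  "r \<noteq> 0 \<Longrightarrow> ker_sum (u / r) (v / r) (1 / r) (A1 / r) (A2 / r) (G1 / r) (G2 / r) = ker_sum u v r A1 A2 G1 G2"
  by (simp add: ker_sum_def sp_flip add.commute)

lemma ker_eq_interpolate:
  assumes adm: "admissible u v r" and nz: "A2 \<noteq> 0" "G2 \<noteq> 0"
    and 1: "\<And>n. ker u v r (1 / Q ^ n) A2 G1 G2 = ker_sum u v r (1 / Q ^ n) A2 G1 G2"
    and 2: "\<And>n. ker u v r (r / Q ^ n) A2 G1 G2 = ker_sum u v r (r / Q ^ n) A2 G1 G2"
  shows "ker u v r x A2 G1 G2 = ker_sum u v r x A2 G1 G2"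
proof -
  note D = admissibleD[OF adm]
  note adm' = admissible_flip[OF adm]
  define \<Delta> where "\<Delta> x = ker u v r x A2 G1 G2 - ker_sum u v r x A2 G1 G2" for x
  \<comment> \<open>Large enough that \<open>po_large\<close> applies to x and to x/r on every
    circle.\<close>
  define \<rho> where "\<rho> = 2 * max 1 (norm r)"
  have rho: "\<rho> \<ge> 2" "\<rho> \<ge> 2 * norm r" "\<rho> \<ge> 1" by (auto simp: \<rho>_def)
  define \<tau> where "\<tau> = max \<rho> (\<rho> / norm r)"
  obtain K0 D0 where K0: "\<And>M x. norm x * q ^ M = \<rho> \<Longrightarrow> norm (ker u v r x A2 G1 G2) \<le> K0 * D0 ^ M / q ^ tri (Suc M)"
    using ker_growth[OF adm nz rho(3), of G1] by blast
  obtain K1 where K1: "\<And>M y. norm y * q ^ M \<ge> 2 \<Longrightarrow> norm y * q ^ M \<le> \<tau> \<Longrightarrow> norm (y / r) * q ^ M \<le> \<tau> \<Longrightarrow>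
      norm (half u v r y A2 G1 G2) \<le> K1 * sqrt q ^ M * (norm (po y M) * norm (po (y / r) M))"
    using half_growth[OF adm] by blast
  obtain K2 where K2: "\<And>M y. norm y * q ^ M \<ge> 2 \<Longrightarrow> norm y * q ^ M \<le> \<tau> \<Longrightarrow> norm (y / (1 / r)) * q ^ M \<le> \<tau> \<Longrightarrow>
      norm (half (u / r) (v / r) (1 / r) y (A2 / r) (G1 / r) (G2 / r)) \<le> K2 * sqrt q ^ M * (norm (po y M) * norm (po (y / (1 / r)) M))"
    using half_growth[OF adm'] by blast
  define c where "c = norm (poi (sp u v r * Q))"
  \<comment> \<open>The first summand is the margin of the two 4phi3 terms. The second compares
    q^(-tri(M+1)) for the kernel with the divisor, which is at least its square; tri(M+1) = tri M +
    M gives the factor (D0 q)^M.\<close>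
  define \<epsilon> where "\<epsilon> M = c * (K1 + K2) * sqrt q ^ M + K0 * (D0 * q) ^ M * q ^ tri M" for M
  have "\<Delta> x = 0"
  proof (rule entire_zero_criterion[of \<Delta> r \<rho> \<epsilon>])
    have "(\<lambda>x. half (u / r) (v / r) (1 / r) (x / r) (A2 / r) (G1 / r) (G2 / r)) holomorphic_on UNIV"
      using holomorphic_on_compose_gen[OF _ half_holomorphic[OF adm'], of "\<lambda>x. x / r" UNIV] D(3)
      by (simp add: o_def holomorphic_intros)
    then show "\<Delta> holomorphic_on UNIV"
      unfolding \<Delta>_def[abs_def] ker_sum_def
      by (intro holomorphic_intros ker_holomorphic adm nz half_holomorphic)
    have "(\<lambda>M. K0 * (D0 * q) ^ M * q ^ tri M) \<longlonglongrightarrow> 0"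
      by (intro summable_LIMSEQ_zero summable_gauss)
    moreover have "(\<lambda>M. c * (K1 + K2) * sqrt q ^ M) \<longlonglongrightarrow> c * (K1 + K2) * 0"
      using q0 q1 by (intro tendsto_intros LIMSEQ_power_zero) auto
    ultimately have "\<epsilon> \<longlonglongrightarrow> c * (K1 + K2) * 0 + 0"
      unfolding \<epsilon>_def[abs_def] by (intro tendsto_add)
    then show "\<epsilon> \<longlonglongrightarrow> 0" by simp
  next
    fix M and x :: complex assume x: "norm x * q ^ M = \<rho>"
    define P where "P = norm (po x M) * norm (po (x / r) M)"
    have xr: "norm (x / r) * q ^ M = \<rho> / norm r" using x by (simp add: norm_divide)
    have xr2: "\<rho> / norm r \<ge> 2" using rho D(3) by (simp add: field_simps)
    have "1 / q ^ tri (Suc M) * (1 / q ^ tri (Suc M)) \<le> P"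
      unfolding P_def using x xr xr2 rho q0 by (intro mult_mono po_large) auto
    then have P: "1 / q ^ tri (Suc M) \<le> q ^ tri (Suc M) * P"
      using q0 by (simp add: field_simps)
    \<comment> \<open>No sign of K0 or D0 is known; the product is nonnegative because it bounds a
      norm.\<close>
    have k0: "0 \<le> K0 * D0 ^ M"
    proof -
      have "0 \<le> K0 * D0 ^ M / q ^ tri (Suc M)"
        using K0[OF x] norm_ge_zero order_trans by blast
      moreover have "0 < q ^ tri (Suc M)" using q0 by simp
      ultimately show ?thesis by (simp add: zero_le_divide_iff)
    qed
    have "norm (ker u v r x A2 G1 G2) \<le> K0 * D0 ^ M * (1 / q ^ tri (Suc M))"
      using K0[OF x] by simp
    also have "\<dots> \<le> K0 * D0 ^ M * (q ^ tri (Suc M) * P)"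
      by (intro mult_left_mono P k0)
    also have "\<dots> = K0 * (D0 * q) ^ M * q ^ tri M * P"
      by (simp add: tri_Suc power_add power_mult_distrib mult_ac)
    finally have a: "norm (ker u v r x A2 G1 G2) \<le> K0 * (D0 * q) ^ M * q ^ tri M * P" .
    have b: "norm (half u v r x A2 G1 G2) \<le> K1 * sqrt q ^ M * P"
      unfolding P_def using x xr rho by (intro K1) (auto simp: \<tau>_def)
    have "x / r / (1 / r) = x" using D(3) by simp
    then have c: "norm (half (u / r) (v / r) (1 / r) (x / r) (A2 / r) (G1 / r) (G2 / r)) \<le> K2 * sqrt q ^ M * P"
      using K2[of "x / r" M] x xr xr2 by (simp add: P_def \<tau>_def mult_ac)
    have "norm (ker_sum u v r x A2 G1 G2) \<le> c * (K1 * sqrt q ^ M * P + K2 * sqrt q ^ M * P)"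
      unfolding ker_sum_def norm_mult c_def
      by (intro mult_left_mono order_trans[OF norm_triangle_ineq] add_mono b c) auto
    then have "norm (\<Delta> x) \<le> K0 * (D0 * q) ^ M * q ^ tri M * P + c * (K1 * sqrt q ^ M * P + K2 * sqrt q ^ M * P)"
      unfolding \<Delta>_def using a by (intro order_trans[OF norm_triangle_ineq4] add_mono) auto
    also have "\<dots> = \<epsilon> M * P" by (simp add: \<epsilon>_def algebra_simps)
    finally show "norm (\<Delta> x) \<le> \<epsilon> M * (norm (po x M) * norm (po (x / r) M))" by (simp add: P_def)
  qed (use D rho 1 2 in \<open>auto simp: \<Delta>_def\<close>)
  then show ?thesis by (simp add: \<Delta>_def)
qed

lemma half_eq_0: "A1 / r * Q ^ k = 1 \<Longrightarrow> half u v r A1 A2 G1 G2 = 0"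
  using poi_eq_0[of "A1 / r" k] by (simp add: half_def)

lemma ker_eq_terminating:
  assumes adm: "admissible u v r" and nz: "A2 \<noteq> 0" "G2 \<noteq> 0"
  shows "ker u v r (1 / Q ^ n) A2 (1 / Q ^ l) G2 = ker_sum u v r (1 / Q ^ n) A2 (1 / Q ^ l) G2"
proof -
  note D = admissibleD[OF adm]
  have p: "poi (1 / Q ^ n / r) = po (1 / (r * Q ^ n)) n * poi (1 / r)" for n
    using poi_split[of "1 / (r * Q ^ n)" n] by (simp add: mult.commute)
  have "phi u v r (1 / Q ^ n) A2 (1 / Q ^ l) G2 =
     (\<Sum>h\<le>n. po (1 / Q ^ n) h * po A2 h * po (1 / Q ^ l) h * po G2 h / (po u h * po v h * po (Q * r) h * po Q h) * Q ^ h)"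
    unfolding phi_def by (rule suminf_finite) (auto simp: po_minus_pow_eq_0)
  moreover have "half (u / r) (v / r) (1 / r) (1 / Q ^ n / r) (A2 / r) (1 / Q ^ l / r) (G2 / r) = 0"
    using D(3) by (intro half_eq_0[where k = n]) simp
  moreover have "poi (1 / r) \<noteq> 0" using D(10) by (rule poi_nz)
  ultimately show ?thesis
    unfolding ker_terminating[OF assms] ker_sum_def half_def[of u v r] p wtC_def by simp
qed

theorem ker_eq:
  assumes adm: "admissible u v r" and nz: "A2 \<noteq> 0" "G2 \<noteq> 0"
  shows "ker u v r A1 A2 G1 G2 = ker_sum u v r A1 A2 G1 G2"
proof -
  have *: "ker u v r (1 / Q ^ n) A2 G1 G2 = ker_sum u v r (1 / Q ^ n) A2 G1 G2"
    if adm: "admissible u v r" and nz: "A2 \<noteq> 0" "G2 \<noteq> 0" for u v r A2 G1 G2 n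
  proof -
    note D = admissibleD[OF adm]
    \<comment> \<open>A1 stays at a node while G1 is interpolated. The interpolation lemma moves the
      first pair of variables, hence the exchanged order.\<close>
    have "ker u v r G1 G2 (1 / Q ^ n) A2 = ker_sum u v r G1 G2 (1 / Q ^ n) A2"
    proof (rule ker_eq_interpolate[OF adm nz(2,1)])
      fix l
      show "ker u v r (1 / Q ^ l) G2 (1 / Q ^ n) A2 = ker_sum u v r (1 / Q ^ l) G2 (1 / Q ^ n) A2"
        by (rule ker_eq_terminating[OF adm nz(2,1)])
      have "half u v r (r / Q ^ l) G2 (1 / Q ^ n) A2 = 0"
        using D(3) by (intro half_eq_0[where k = l]) simp
      moreover have "half (u / r) (v / r) (1 / r) (1 / Q ^ n / r) (A2 / r) (r / Q ^ l / r) (G2 / r) = 0"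
        using D(3) by (intro half_eq_0[where k = n]) simp
      ultimately have "ker_sum u v r (r / Q ^ l) G2 (1 / Q ^ n) A2 = 0"
        unfolding ker_sum_def half_swap[of "u / r" "v / r" "1 / r" "r / Q ^ l / r"]
        by (simp only: add_0_left mult_zero_right)
      then show "ker u v r (r / Q ^ l) G2 (1 / Q ^ n) A2 = ker_sum u v r (r / Q ^ l) G2 (1 / Q ^ n) A2"
        using ker_mixed[OF adm, of n A2 l G2] by (simp add: ker_swap[of _ _ _ "r / Q ^ l"])
    qed
    then show ?thesis by (simp only: ker_swap[of u v r G1] ker_sum_swap[of u v r G1])
  qed
  note D = admissibleD[OF adm]
  show ?thesis
  proof (rule ker_eq_interpolate[OF adm nz *[OF adm nz]])
    fix n
    \<comment> \<open>The flip carries the node r q^-n for r to the node q^-n for 1/r, where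
      equality is already known for all G1.\<close>
    have "ker (u / r) (v / r) (1 / r) (1 / Q ^ n) (A2 / r) (G1 / r) (G2 / r) =
       ker_sum (u / r) (v / r) (1 / r) (1 / Q ^ n) (A2 / r) (G1 / r) (G2 / r)"
      using nz D(3) by (intro * admissible_flip adm) auto
    moreover have "r / Q ^ n / r = 1 / Q ^ n" using D(3) by simp
    ultimately show "ker u v r (r / Q ^ n) A2 G1 G2 = ker_sum u v r (r / Q ^ n) A2 G1 G2"
      using ker_flip[OF adm, of "r / Q ^ n" A2 G1 G2] ker_sum_flip[OF D(3), of u v "r / Q ^ n" A2 G1 G2] by simp
  qed
qed

end

section \<open>Symmetric and non-symmetric Askey--Wilson functions\<close>

lemma csqrt_real_mult:
  assumes "t > 0"
  shows "csqrt (of_real t * y) = of_real (sqrt t) * csqrt y"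
proof (rule csqrt_unique)
  show "(of_real (sqrt t) * csqrt y)\<^sup>2 = of_real t * y"
    using assms by (simp add: power_mult_distrib flip: of_real_power)
  show "0 < Re (of_real (sqrt t) * csqrt y) \<or> Re (of_real (sqrt t) * csqrt y) = 0 \<and> 0 \<le> Im (of_real (sqrt t) * csqrt y)"
    using csqrt_principal[of y] assms by auto
qed

text \<open>Both roots lie in the cone |Im| < Re, so their product has positive real part and is the
  principal root.\<close>

lemma csqrt_mult_right_half:
  assumes "Re x > 0" "Re y > 0"
  shows "csqrt (x * y) = csqrt x * csqrt y"
proof (rule csqrt_unique)
  have cone: "\<bar>Im (csqrt z)\<bar> < Re (csqrt z)" if "Re z > 0" for z
  proof -
    define w where "w = csqrt z"
    have "Re z = Re (w ^ 2)" by (simp add: w_def)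
    also have "\<dots> = (Re w)\<^sup>2 - (Im w)\<^sup>2" by (rule Re_power2)
    finally have "\<bar>Im w\<bar>\<^sup>2 < (Re w)\<^sup>2" using that by simp
    moreover have "0 \<le> Re w" using csqrt_principal[of z] by (auto simp: w_def)
    ultimately have "\<bar>Im w\<bar> < Re w" by (rule power_less_imp_less_base)
    then show ?thesis by (simp only: w_def)
  qed
  define v w where "v = csqrt x" and "w = csqrt y"
  have v: "\<bar>Im v\<bar> < Re v" and w: "\<bar>Im w\<bar> < Re w"
    using cone[OF assms(1)] cone[OF assms(2)] by (simp_all only: v_def w_def)
  have "\<bar>Im v * Im w\<bar> \<le> \<bar>Im v\<bar> * Re w"
    unfolding abs_mult using w by (intro mult_left_mono) auto
  also have "\<dots> < Re v * Re w"
    using v w by (intro mult_strict_right_mono) auto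
  finally have "0 < Re (v * w)" by simp
  then show "0 < Re (csqrt x * csqrt y) \<or> Re (csqrt x * csqrt y) = 0 \<and> 0 \<le> Im (csqrt x * csqrt y)"
    by (simp only: v_def w_def simp_thms)
qed (simp add: power_mult_distrib)

context q_series
begin

lemma dual_a_square: "dual_a q a b c d ^ 2 = a * b * c * d / Q"
  by (simp add: dual_a_def)

lemma dual_a_nz: "a \<noteq> 0 \<Longrightarrow> b \<noteq> 0 \<Longrightarrow> c \<noteq> 0 \<Longrightarrow> d \<noteq> 0 \<Longrightarrow> dual_a q a b c d \<noteq> 0"
  by (simp add: dual_a_def)

text \<open>The radicand is multiplied by the positive number q^2, so no branch is crossed.\<close>

lemma dual_a_shift: "dual_a q (Q * a) (Q * b) c d = Q * dual_a q a b c d"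
proof -
  have "Q * a * (Q * b) * c * d / Q = of_real (q ^ 2) * (a * b * c * d / Q)"
    by (simp add: power2_eq_square)
  then show ?thesis
    using q0 csqrt_real_mult[of "q ^ 2" "a * b * c * d / Q"] unfolding dual_a_def by simp
qed

text \<open>Both sides equal the product of the roots of q, a/b and cd, once the root of ab is
  written as b times the root of a/b. The half-plane conditions justify each splitting.\<close>

lemma csqrt_dual_a:
  assumes "b \<noteq> 0" "Re a > 0" "Re b > 0" "Re (a * b) > 0" "Re (a / b) > 0" "Re (c * d) > 0"
  shows "csqrt (Q * a * inverse b * c * d) = Q * dual_a q a b c d / b"
proof -
  define t where "t = complex_of_real (sqrt q)"
  have t: "t * t = Q" "t \<noteq> 0" using q0 by (simp_all add: t_def flip: of_real_mult)
  have b: "b = csqrt b * csqrt b" by (simp flip: power2_eq_square)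
  have "csqrt a = csqrt (a / b) * csqrt b"
    using csqrt_mult_right_half[of "a / b" b] assms by simp
  then have ab: "csqrt (a * b) = csqrt (a / b) * b"
    using csqrt_mult_right_half[of a b] assms b by (metis mult.assoc)
  have "csqrt (Q * a * inverse b * c * d) = csqrt (of_real q * (a / b * (c * d)))"
    by (simp add: divide_inverse mult_ac)
  also have "\<dots> = t * (csqrt (a / b) * csqrt (c * d))"
    unfolding csqrt_real_mult[OF q0] t_def using csqrt_mult_right_half[of "a / b" "c * d"] assms by simp
  finally have 1: "csqrt (Q * a * inverse b * c * d) = t * (csqrt (a / b) * csqrt (c * d))" .
  have "a * b * (c * d) = of_real q * (a * b * c * d / Q)" by simp
  then have "csqrt (a * b * (c * d)) = t * dual_a q a b c d"
    unfolding dual_a_def t_def using csqrt_real_mult[OF q0] by metis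
  then have "t * dual_a q a b c d = csqrt (a / b) * b * csqrt (c * d)"
    using csqrt_mult_right_half[of "a * b" "c * d"] assms ab by simp
  then have "Q * dual_a q a b c d = t * (csqrt (a / b) * b * csqrt (c * d))"
    unfolding t(1)[symmetric] by simp
  then show ?thesis unfolding 1 using assms(1) by simp
qed

section \<open>Translation to Askey--Wilson polynomials and functions\<close>

lemma aw_poly_plus_awp:
  assumes "\<alpha> \<noteq> 0" "\<epsilon> \<noteq> 0" "z \<noteq> 0" "\<And>k. \<alpha> * \<epsilon> * Q ^ k \<noteq> 1"
  shows "aw_poly_plus q m z \<alpha> \<beta> \<gamma> \<epsilon> =
    awp (\<alpha> * \<beta>) (\<alpha> * \<gamma>) (\<alpha> / \<epsilon>) (\<alpha> * z) (\<alpha> / z) m / po (\<alpha> * \<epsilon>) m"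
proof -
  define s where "s = sp (\<alpha> * \<beta>) (\<alpha> * \<gamma>) (\<alpha> / \<epsilon>)"
  have s: "s * Q = \<alpha> * \<beta> * \<gamma> * \<epsilon>" using assms by (simp add: s_def sp_def)
  have w: "\<alpha> * z * (\<alpha> / z) / (\<alpha> / \<epsilon>) = \<alpha> * \<epsilon>" using assms by simp
  have e1: "Q powi (- int m) = 1 / Q ^ m"
    by (simp add: power_int_minus divide_inverse)
  have e2: "Q powi (int m - 1) * \<alpha> * \<beta> * \<gamma> * \<epsilon> = s * Q ^ m"
  proof -
    have "Q powi (int m - 1) * Q = Q ^ m"
      by (simp add: power_int_diff)
    then have "s * Q ^ m = Q powi (int m - 1) * (s * Q)" by simp
    then show ?thesis unfolding s by (simp add: mult_ac)
  qed
  have nz: "po (\<alpha> * \<epsilon>) k \<noteq> 0" for k using assms(4) by (rule po_nz)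
  have "aw_poly_plus q m z \<alpha> \<beta> \<gamma> \<epsilon> = (\<Sum>k. po (1 / Q ^ m) k * po (s * Q ^ m) k * po (\<alpha> * z) k * po (\<alpha> / z) k
     / (po (\<alpha> * \<beta>) k * po (\<alpha> * \<gamma>) k * po (\<alpha> * \<epsilon>) k * po Q k) * Q ^ k)"
    unfolding aw_poly_plus_def phi43_def e1 e2 by (simp add: qpochs_def mult_ac)
  also have "\<dots> = (\<Sum>k\<le>m. po (1 / Q ^ m) k * po (s * Q ^ m) k * po (\<alpha> * z) k * po (\<alpha> / z) k
     / (po (\<alpha> * \<beta>) k * po (\<alpha> * \<gamma>) k * po (\<alpha> * \<epsilon>) k * po Q k) * Q ^ k)"
    by (rule suminf_finite) (auto simp: po_minus_pow_eq_0)
  also have "\<dots> = awp (\<alpha> * \<beta>) (\<alpha> * \<gamma>) (\<alpha> / \<epsilon>) (\<alpha> * z) (\<alpha> / z) m / po (\<alpha> * \<epsilon>) m"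
    unfolding awp_def s_def[symmetric] w sum_divide_distrib
  proof (intro sum.cong refl, goal_cases)
    case (1 k)
    then have "po (\<alpha> * \<epsilon>) m = po (\<alpha> * \<epsilon>) k * po (\<alpha> * \<epsilon> * Q ^ k) (m - k)"
      by (simp add: po_split)
    then show ?case
      using nz[of m] by (simp add: hq_def mult_ac)
  qed
  finally show ?thesis .
qed

definition aw_prefactor where
  "aw_prefactor \<gamma> z a b c d =
     qpochs_inf q [b * c, Q * a / d, Q * b / d, Q * c / d, Q / (a * d)]
       / (qpoch_inf q (Q * a * b * c / d)
          * qpochs_inf q [Q / d * z, Q / d / z, Q / dual_d q a b c d * \<gamma>, Q / dual_d q a b c d / \<gamma>])"

definition aw_pair where
  "aw_pair \<gamma> z a b c d m = aw_poly_plus q m z a b c (Q / d) *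
     aw_poly_plus q m \<gamma> (dual_a q a b c d) (dual_b q a b c d) (dual_c q a b c d) (Q / dual_d q a b c d)"

text \<open>The polynomials in z and in \<gamma> share u, v and r, because the dual parameters have
  the same products ab, ac and quotient ad/q. Only A1 A2/r differs: it is qa/d for z and bc for
  \<gamma>. Hence \<open>ker_eq\<close> specializes to both families at once.\<close>

lemma aw_fun_sym_expansion:
  assumes nz: "a \<noteq> 0" "b \<noteq> 0" "c \<noteq> 0" "d \<noteq> 0"
    and adm: "admissible (a * b) (a * c) (a * d / Q)"
    and ae: "\<And>k. Q * a / d * Q ^ k \<noteq> 1" and bc: "\<And>k. b * c * Q ^ k \<noteq> 1"
    and reg: "aw_regular_point q a b c d \<gamma> z"
  shows "summable (\<lambda>m. wt (a * b) (a * c) (a * d / Q) m * aw_pair \<gamma> z a b c d m)"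
    and "aw_fun_sym q \<gamma> z a b c d = aw_prefactor \<gamma> z a b c d *
      (\<Sum>m. wt (a * b) (a * c) (a * d / Q) m * aw_pair \<gamma> z a b c d m)"
proof -
  define a' where "a' = dual_a q a b c d"
  define u v r where "u = a * b" and "v = a * c" and "r = a * d / Q"
  note adm = adm[folded u_def v_def r_def]
  note D = admissibleD[OF adm]
  have a': "a' \<noteq> 0" "a' * a' = a * b * c * d / Q"
    using dual_a_nz[OF nz] dual_a_square[of a b c d] by (auto simp: a'_def power2_eq_square)
  have z: "z \<noteq> 0" "\<gamma> \<noteq> 0" using reg by (auto simp: aw_regular_point_def)
  define A1 A2 G1 G2 where "A1 = a * z" and "A2 = a / z" and "G1 = a' * \<gamma>" and "G2 = a' / \<gamma>"
  have AG: "A2 \<noteq> 0" "G2 \<noteq> 0" using nz z a' by (auto simp: A2_def G2_def)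
  have d': "dual_d q a b c d = a * d / a'" by (simp add: dual_d_def a'_def)
  have e: "Q / d = a / r" "Q / dual_d q a b c d = a' / r"
    using nz a' by (simp_all add: r_def d')
  have e1: "Q / d * z = A1 / r" "Q / d / z = A2 / r" "Q / dual_d q a b c d * \<gamma> = G1 / r" "Q / dual_d q a b c d / \<gamma> = G2 / r"
    unfolding e by (simp_all add: A1_def A2_def G1_def G2_def)
  have e2: "Q * b / d = u / r" "Q * c / d = v / r" "Q / (a * d) = 1 / r" "a * d = Q * r" "Q ^ 2 / (a * d) = Q * (1 / r)" "Q * r / Q = r"
    using nz by (simp_all add: u_def v_def r_def power2_eq_square)
  have e3: "Q * a * b * c / d = sp u v r * Q"
    using nz by (simp add: u_def v_def r_def sp_def)
  have wz: "A1 * A2 / r = Q * a / d"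
    using nz z by (simp add: A1_def A2_def r_def)
  have wg: "G1 * G2 / r = b * c"
  proof -
    have "G1 * G2 = a' * a'" using z by (simp add: G1_def G2_def)
    then show ?thesis using nz by (simp add: a'(2) r_def)
  qed
  have Ez: "aw_poly_plus q m z a b c (Q / d) = awp u v r A1 A2 m / po (Q * a / d) m" for m
  proof -
    have 1: "a / (Q / d) = r" "a * (Q / d) = Q * a / d" by (simp_all add: r_def)
    show ?thesis
      using aw_poly_plus_awp[of a "Q / d" z m b c] nz z ae unfolding 1 by (simp add: u_def v_def A1_def A2_def)
  qed
  have Eg: "aw_poly_plus q m \<gamma> a' (dual_b q a b c d) (dual_c q a b c d) (Q / dual_d q a b c d) = awp u v r G1 G2 m / po (b * c) m" for m
  proof -
    have 1: "a' / (Q / dual_d q a b c d) = r" unfolding e using a' D by simp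
    have 2: "a' * (Q / dual_d q a b c d) = b * c"
    proof -
      have "a' * (Q / dual_d q a b c d) = a' * a' / r" unfolding e by simp
      then show ?thesis using nz by (simp add: a'(2) r_def)
    qed
    have 3: "a' * dual_b q a b c d = u" "a' * dual_c q a b c d = v"
      using a' by (simp_all add: dual_b_def dual_c_def a'_def[symmetric] u_def v_def)
    have 4: "Q / dual_d q a b c d \<noteq> 0" unfolding e using a' D by simp
    show ?thesis
      using aw_poly_plus_awp[of a' "Q / dual_d q a b c d" \<gamma> m "dual_b q a b c d" "dual_c q a b c d"] a'(1) 4 z(2) bc
      unfolding 1 2 3 by (simp add: G1_def G2_def)
  qed
  have pair: "aw_pair \<gamma> z a b c d m = (awp u v r A1 A2 m / po (Q * a / d) m) * (awp u v r G1 G2 m / po (b * c) m)" for m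
    unfolding aw_pair_def Ez Eg[unfolded a'_def] ..
  have "exp_bd (\<lambda>m. (awp u v r A1 A2 m / po (Q * a / d) m) * (awp u v r G1 G2 m / po (b * c) m))"
    by (intro exp_bd_mult exp_bd_divide_po exp_bd_awp adm AG ae bc)
  then have sum: "summable (\<lambda>m. wt u v r m * aw_pair \<gamma> z a b c d m)"
    unfolding pair by (rule wt_summable[OF adm])
  then show "summable (\<lambda>m. wt (a * b) (a * c) (a * d / Q) m * aw_pair \<gamma> z a b c d m)"
    by (simp only: u_def v_def r_def)
  define S where "S = (\<Sum>m. wt u v r m * aw_pair \<gamma> z a b c d m)"
  define N where "N = poi (A1 / r) * poi (A2 / r) * poi (G1 / r) * poi (G2 / r)"
  have "poi x \<noteq> 0" if "x \<in> {Q / d * z, Q / d / z, Q / dual_d q a b c d * \<gamma>, Q / dual_d q a b c d / \<gamma>}" for x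
    using reg that unfolding aw_regular_point_def by (intro poi_nz) blast
  then have N0: "N \<noteq> 0" unfolding N_def e1[symmetric] by simp
  have pnz: "poi u \<noteq> 0" "poi v \<noteq> 0" "poi r \<noteq> 0" "poi (u / r) \<noteq> 0" "poi (v / r) \<noteq> 0" "poi (1 / r) \<noteq> 0" "poi (sp u v r * Q) \<noteq> 0"
    using poi_nz[OF D(5)] poi_nz[OF D(6)] poi_nz[OF D(7)] poi_nz[OF D(8)] poi_nz[OF D(9)] poi_nz[OF D(10)]
      poi_nz[of "sp u v r * Q"] D(11)[of "Suc _"] by (simp_all add: mult_ac)
  have kp: "ker u v r A1 A2 G1 G2 = poi (Q * a / d) * poi (b * c) * S"
  proof -
    have *: "wt u v r m * (awp u v r A1 A2 m * poi (A1 * A2 / r * Q ^ m) * (awp u v r G1 G2 m * poi (G1 * G2 / r * Q ^ m)))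
       = poi (Q * a / d) * poi (b * c) * (wt u v r m * aw_pair \<gamma> z a b c d m)" for m
    proof -
      have "po (Q * a / d) m \<noteq> 0" "po (b * c) m \<noteq> 0" using po_nz[OF ae] po_nz[OF bc] by auto
      then show ?thesis
        unfolding wz wg pair poi_split[of "Q * a / d" m] poi_split[of "b * c" m] by simp
    qed
    show ?thesis
      unfolding ker_def * S_def by (rule suminf_mult[OF sum])
  qed
  have "aw_fun_sym q \<gamma> z a b c d = phi u v r A1 A2 G1 G2 +
     poi A1 * poi A2 * poi G1 * poi G2 * (poi (u / r) * poi (v / r) * poi (1 / r)) / (N * (poi u * poi v * poi r))
       * phi (u / r) (v / r) (1 / r) (A1 / r) (A2 / r) (G1 / r) (G2 / r)"
  proof -
    have "aw_fun_sym q \<gamma> z a b c d = phi43 q [A1, A2, G1, G2] [u, v, Q * r]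
       + qpochs_inf q [A1, A2, G1, G2, u / r, v / r, 1 / r] / qpochs_inf q [A1 / r, A2 / r, G1 / r, G2 / r, u, v, r]
         * phi43 q [A1 / r, A2 / r, G1 / r, G2 / r] [u / r, v / r, Q * (1 / r)]"
      unfolding aw_fun_sym_def Let_def e1 e2(1-3) e2(5) unfolding e2(4) e2(6)
      by (simp only: A1_def A2_def G1_def G2_def a'_def u_def v_def)
    also have "\<dots> = phi u v r A1 A2 G1 G2 +
     poi A1 * poi A2 * poi G1 * poi G2 * (poi (u / r) * poi (v / r) * poi (1 / r)) / (N * (poi u * poi v * poi r))
       * phi (u / r) (v / r) (1 / r) (A1 / r) (A2 / r) (G1 / r) (G2 / r)"
      by (simp add: phi43_def phi_def qpochs_def qpochs_inf_def N_def mult_ac)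
    finally show ?thesis .
  qed
  also have "\<dots> = poi (u / r) * poi (v / r) * poi (1 / r) / (N * poi (sp u v r * Q)) * ker_sum u v r A1 A2 G1 G2"
  proof -
    have h1: "half u v r A1 A2 G1 G2 = N / (poi (u / r) * poi (v / r) * poi (1 / r)) * phi u v r A1 A2 G1 G2"
      by (simp add: half_def N_def)
    have h2: "half (u / r) (v / r) (1 / r) (A1 / r) (A2 / r) (G1 / r) (G2 / r) =
      poi A1 * poi A2 * poi G1 * poi G2 / (poi u * poi v * poi r) * phi (u / r) (v / r) (1 / r) (A1 / r) (A2 / r) (G1 / r) (G2 / r)"
      using D(3) by (simp add: half_def)
    show ?thesis unfolding ker_sum_def h1 h2 using N0 pnz by (simp add: field_simps)
  qed
  also have "\<dots> = poi (u / r) * poi (v / r) * poi (1 / r) / (N * poi (sp u v r * Q)) * (poi (Q * a / d) * poi (b * c) * S)"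
    unfolding ker_eq[OF adm AG, symmetric] kp ..
  also have "\<dots> = aw_prefactor \<gamma> z a b c d * S"
    unfolding aw_prefactor_def e1 e2(1-3) e3 by (simp add: qpochs_inf_def N_def mult_ac)
  finally show "aw_fun_sym q \<gamma> z a b c d = aw_prefactor \<gamma> z a b c d *
      (\<Sum>m. wt (a * b) (a * c) (a * d / Q) m * aw_pair \<gamma> z a b c d m)"
    by (simp only: S_def u_def v_def r_def)
qed

text \<open>The relation a' b' = a b equates the coefficients of P R', and likewise of R P', in the
  two products, with opposite signs. The products R R' combine to the same factor Y - a b X that
  multiplies P P'.\<close>

lemma nonsym_bracket:
  fixes a b a' b' p D D' X Y P R P' R' :: complex
  assumes "a' * b' = a * b" "b \<noteq> 0" "b' \<noteq> 0" "p \<noteq> 0" "D \<noteq> 0" "D' \<noteq> 0"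
  shows "- a * b * X * (P - Y / (p * b * D) * R) * (P' - Y / (p * b' * D') * R')
       + Y * (P - a * X / (p * D) * R) * (P' - a' * X / (p * D') * R')
     = (Y - a * b * X) * (P * P' - X * Y * a' / (b * p ^ 2 * D * D') * (R * R'))"
proof -
  define x x' where "x = R / (p * D)" and "x' = R' / (p * D')"
  have a': "a' = a * b / b'" using assms by (simp add: eq_divide_eq)
  have e: "Y / (p * b * D) * R = Y / b * x" "Y / (p * b' * D') * R' = Y / b' * x'"
    "a * X / (p * D) * R = a * X * x" "a' * X / (p * D') * R' = a' * X * x'"
    "X * Y * a' / (b * p ^ 2 * D * D') * (R * R') = X * Y * (a' / b) * (x * x')"
    by (simp_all add: x_def x'_def power2_eq_square)
  show ?thesis
    unfolding e unfolding a' using assms(2,3) by (simp add: field_simps)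
qed

lemma aw_parameters_admissible:
  assumes "aw_parameters q a b c d"
  shows "admissible (a * b) (a * c) (a * d / Q)" "admissible (Q * a * (Q * b)) (Q * a * c) (Q * a * d / Q)"
    "Q * a / d * Q ^ k \<noteq> 1" "b * c * Q ^ k \<noteq> 1" "Q * (Q * a) / d * Q ^ k \<noteq> 1" "Q * b * c * Q ^ k \<noteq> 1"
proof -
  have nz: "a \<noteq> 0" "b \<noteq> 0" "c \<noteq> 0" "d \<noteq> 0" using assms by (auto simp: aw_parameters_def)
  have g: "a * b * Q ^ k \<noteq> 1" "a * c * Q ^ k \<noteq> 1" "b * c * Q ^ k \<noteq> 1" "a * d / Q * Q ^ k \<noteq> 1"
    "Q ^ 2 / (a * d) * Q ^ k \<noteq> 1" "Q * a / d * Q ^ k \<noteq> 1" "Q * b / d * Q ^ k \<noteq> 1" "Q * c / d * Q ^ k \<noteq> 1"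
    "a * b * c / d * Q ^ k \<noteq> 1" for k
    using assms unfolding aw_parameters_def aw_generic_def by blast+
  show "Q * a / d * Q ^ k \<noteq> 1" "b * c * Q ^ k \<noteq> 1" by (rule g)+
  show "Q * (Q * a) / d * Q ^ k \<noteq> 1" "Q * b * c * Q ^ k \<noteq> 1"
    using g(6)[of "Suc k"] g(3)[of "Suc k"] by (simp_all add: mult_ac)
  have ad: "1 / (a * d) * Q ^ k \<noteq> 1" for k
  proof -
    \<comment> \<open>Genericity speaks of ad/q and q^2/(ad). The powers k = 0 and k = 1 come from
      the former, all larger ones from the latter.\<close>
    consider "k = 0" | "k = 1" | j where "k = 2 + j" by (metis One_nat_def add_2_eq_Suc not0_implies_Suc)
    then show ?thesis
    proof cases
      case 1
      then show ?thesis using g(4)[of 1] by simp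
    next
      case 2
      then show ?thesis using g(4)[of 0] nz by (auto simp: field_simps)
    next
      case 3
      then show ?thesis using g(5)[of j] by (simp add: power_add power2_eq_square mult.assoc)
    qed
  qed
  define u v r where "u = a * b" and "v = a * c" and "r = a * d / Q"
  have e: "u / r = Q * b / d" "v / r = Q * c / d" "1 / r * Q ^ k = 1 / (a * d) * Q ^ Suc k"
    "sp u v r = a * b * c / d" for k
    using nz by (simp_all add: u_def v_def r_def sp_def)
  show "admissible (a * b) (a * c) (a * d / Q)"
    unfolding u_def[symmetric] v_def[symmetric] r_def[symmetric]
    unfolding admissible_def ball_simps e
    using nz g ad[of "Suc _"] by (simp add: u_def v_def r_def)
  define u' v' r' where "u' = Q * a * (Q * b)" and "v' = Q * a * c" and "r' = Q * a * d / Q"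
  have u': "u' * Q ^ k = a * b * Q ^ (k + 2)" and v': "v' * Q ^ k = a * c * Q ^ Suc k" and r': "r' * Q ^ k = a * d / Q * Q ^ Suc k" for k
    by (simp_all add: u'_def v'_def r'_def power_add power2_eq_square)
  have e': "u' / r' * Q ^ k = Q * b / d * Q ^ Suc k" "v' / r' = Q * c / d" "1 / r' = 1 / (a * d)"
    "sp u' v' r' * Q ^ k = a * b * c / d * Q ^ (k + 2)" for k
    using nz by (simp_all add: u'_def v'_def r'_def sp_def power_add power2_eq_square)
  have "u' \<noteq> 0" "v' \<noteq> 0" "r' \<noteq> 0" using nz by (simp_all add: u'_def v'_def r'_def)
  then show "admissible (Q * a * (Q * b)) (Q * a * c) (Q * a * d / Q)"
    unfolding u'_def[symmetric] v'_def[symmetric] r'_def[symmetric]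
    unfolding admissible_def ball_simps u' v' r' e'
    using g ad by (simp del: power_Suc)
qed

text \<open>The passage from m = n + 1 to n amounts to (a, b) -> (qa, qb), that is to q^2 u, q v, q
  r. The factors on the left are X and Y of \<open>nonsym_bracket\<close>, with v/r = qc/d.\<close>

lemma wt_Suc:
  assumes adm: "admissible u v r" and s1: "1 - Q ^ 2 * sp u v r \<noteq> 0"
  shows "wt u v r (Suc n) *
      ((1 - Q ^ Suc n) * (1 - Q ^ n * (v / r)) * ((1 - Q ^ Suc n * u) * (1 - Q ^ Suc n * sp u v r)))
    = - ((Q ^ n) ^ 2 / r) * ((1 - Q * sp u v r) * (1 - Q ^ 2 * sp u v r) * (1 - u) * (1 - Q * u) * (1 - v) / (1 - u / r))
      * wt (Q ^ 2 * u) (Q * v) (Q * r) n"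
proof -
  define s where "s = sp u v r"
  note D = admissibleD[OF adm, folded s_def]
  define x where "x = Q ^ n"
  have s': "sp (Q ^ 2 * u) (Q * v) (Q * r) = Q ^ 2 * s"
    using D by (simp add: s_def sp_def power2_eq_square)
  have ur: "Q ^ 2 * u / (Q * r) = u / r * Q" "Q * v / (Q * r) = v / r"
    by (simp_all add: power2_eq_square)
  have e: "s * Q ^ (2 * Suc n) = Q ^ 2 * s * Q ^ (2 * n)" by (simp add: power2_eq_square)
  have n1: "1 - s \<noteq> 0" "1 - u / r \<noteq> 0" using D(11)[of 0] D(7)[of 0] by auto
  have n2: "1 - Q * x \<noteq> 0" "1 - v / r * x \<noteq> 0"
    using Q_Q_pow_neq_1[of n] D(8)[of n] by (auto simp: x_def)
  have pu: "po u (Suc n) * (1 - Q * x * u) = (1 - u) * (1 - Q * u) * po (Q ^ 2 * u) n"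
    using po_Suc[of u "Suc n"] po_rec[of u "Suc n"] po_rec[of "u * Q" n] by (simp add: x_def power2_eq_square mult_ac)
  have ps: "po s (Suc n) * (1 - Q * x * s) = (1 - s) * (1 - Q * s) * po (Q ^ 2 * s) n"
    using po_Suc[of s "Suc n"] po_rec[of s "Suc n"] po_rec[of "s * Q" n] by (simp add: x_def power2_eq_square mult_ac)
  have "wt u v r (Suc n) * ((1 - Q ^ Suc n) * (1 - Q ^ n * (v / r)) * ((1 - Q ^ Suc n * u) * (1 - Q ^ Suc n * s)))
     = (-1) ^ Suc n * Q ^ tri (Suc n) / r ^ Suc n * ((1 - s * Q ^ (2 * Suc n)) / (1 - s))
      * ((po u (Suc n) * (1 - Q * x * u)) * po v (Suc n) * (po s (Suc n) * (1 - Q * x * s))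
        / (po (u / r) (Suc n) * (po (v / r) (Suc n) / (1 - v / r * x)) * (po Q (Suc n) / (1 - Q * x))))" (is "?l = _")
    unfolding wt_def s_def[symmetric] by (simp add: x_def mult_ac)
  also have "po (v / r) (Suc n) / (1 - v / r * x) = po (v / r) n"
    using n2 by (simp add: po_Suc x_def)
  also have "po Q (Suc n) / (1 - Q * x) = po Q n"
    using n2 by (simp add: po_Suc x_def)
  also have "po (u / r) (Suc n) = (1 - u / r) * po (u / r * Q) n" by (rule po_rec)
  also have "po v (Suc n) = (1 - v) * po (Q * v) n" by (simp add: po_rec mult_ac)
  finally have "?l
     = (-1) ^ Suc n * Q ^ tri (Suc n) / r ^ Suc n * ((1 - s * Q ^ (2 * Suc n)) / (1 - s))
      * (((1 - u) * (1 - Q * u) * po (Q ^ 2 * u) n) * ((1 - v) * po (Q * v) n) * ((1 - s) * (1 - Q * s) * po (Q ^ 2 * s) n)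
        / (((1 - u / r) * po (u / r * Q) n) * po (v / r) n * po Q n))"
    unfolding pu ps .
  also have "\<dots> = (-1) ^ Suc n * (Q ^ tri n * x) / r ^ Suc n * (1 - Q ^ 2 * s * Q ^ (2 * n))
      * ((1 - u) * (1 - Q * u) * (1 - v) * (1 - Q * s) / (1 - u / r))
      * (po (Q ^ 2 * u) n * po (Q * v) n * po (Q ^ 2 * s) n / (po (u / r * Q) n * po (v / r) n * po Q n))"
    using n1 unfolding e tri_Suc power_add x_def[symmetric] by (simp add: mult_ac)
  also have "\<dots> = - (x ^ 2 / r) * ((1 - Q * s) * (1 - Q ^ 2 * s) * (1 - u) * (1 - Q * u) * (1 - v) / (1 - u / r))
      * wt (Q ^ 2 * u) (Q * v) (Q * r) n"
    unfolding wt_def s' ur using s1[folded s_def] D(3)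
    by (simp add: power_mult_distrib x_def[symmetric] power2_eq_square mult_ac)
  finally show ?thesis by (simp only: s_def x_def)
qed

text \<open>Only the product a b c e enters. It equals q s for the parameters in z as well as for
  the dual ones, so one formula serves both.\<close>

lemma aw_poly_neg:
  assumes "a * b * c * e = Q * s"
  shows "aw_poly q (- int (Suc n)) z a b c e = aw_poly_plus q (Suc n) z a b c e
     - (1 - Q ^ Suc n * (a * b)) * (1 - Q ^ Suc n * s) / (Q ^ n * b * ((1 - a * b) * (1 - Q * a * b) * (1 - a * c) * (1 - a * e)))
       * (inverse z * (1 - a * z) * (1 - b * z) * aw_poly_plus q n z (Q * a) (Q * b) c e)"
proof -
  have "Q ^ n * a * b * c * e = Q ^ Suc n * s"
    using assms by (simp add: mult_ac)
  moreover have "nat \<bar>- int (Suc n)\<bar> = Suc n" by simp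
  ultimately show ?thesis
    unfolding aw_poly_def Let_def aw_poly_minus_def by (simp add: mult.assoc)
qed

lemma aw_poly_pos:
  assumes "c * e = Q * t"
  shows "aw_poly q (int (Suc n)) z a b c e = aw_poly_plus q (Suc n) z a b c e
     - a * ((1 - Q ^ Suc n) * (1 - Q ^ Suc n * t)) / (Q ^ n * ((1 - a * b) * (1 - Q * a * b) * (1 - a * c) * (1 - a * e)))
       * (inverse z * (1 - a * z) * (1 - b * z) * aw_poly_plus q n z (Q * a) (Q * b) c e)"
proof -
  have "Q ^ n * c * e = Q ^ Suc n * t"
    using assms by (simp add: mult_ac)
  moreover have "nat \<bar>int (Suc n)\<bar> = Suc n" by simp
  ultimately show ?thesis
    unfolding aw_poly_def Let_def aw_poly_minus_def by (simp add: mult.assoc)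
qed

lemma aw_poly_plus_0: "aw_poly_plus q 0 z a b c d = 1"
proof -
  have "aw_poly_plus q 0 z a b c d = (\<Sum>k\<in>{0}. qpochs q [Q powi (- int 0), Q powi (int 0 - 1) * a * b * c * d, a * z, a / z] k
      / qpochs q ([a * b, a * c, a * d] @ [Q]) k * Q ^ k)"
    unfolding aw_poly_plus_def phi43_def
    by (rule suminf_finite) (use po_minus_pow_eq_0[of 0] in \<open>auto simp: qpochs_def\<close>)
  then show ?thesis by (simp add: qpochs_def)
qed

text \<open>The factors depending on z and \<gamma> contain only d and its dual, which the shift
  leaves unchanged; only constant products change.\<close>

lemma aw_prefactor_shift:
  assumes nz: "a \<noteq> 0" "b \<noteq> 0" "c \<noteq> 0" "d \<noteq> 0"
    and s: "1 - Q * (a * b * c / d) \<noteq> 0" "1 - Q ^ 2 * (a * b * c / d) \<noteq> 0" and ad: "1 - 1 / (a * d) \<noteq> 0"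
  shows "aw_prefactor \<gamma> z a b c d * ((1 - Q * (a * b * c / d)) * (1 - Q ^ 2 * (a * b * c / d)))
    = aw_prefactor \<gamma> z (Q * a) (Q * b) c d * ((1 - b * c) * (1 - Q * a / d) * (1 - Q * b / d) / (1 - 1 / (a * d)))"
proof -
  define S where "S = a * b * c / d"
  have dd: "dual_d q (Q * a) (Q * b) c d = dual_d q a b c d"
    by (simp add: dual_d_def dual_a_shift)
  have rec: "poi x = (1 - x) * poi (x * Q)" for x
    using poi_split[of x 1] by (simp add: po_rec[of x 0, simplified])
  have p: "poi (b * c) = (1 - b * c) * poi (Q * b * c)"
    "poi (Q * a / d) = (1 - Q * a / d) * poi (Q * (Q * a) / d)"
    "poi (Q * b / d) = (1 - Q * b / d) * poi (Q * (Q * b) / d)"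
    "poi (1 / (a * d)) = (1 - 1 / (a * d)) * poi (Q / (a * d))"
    "poi (Q * S) = (1 - Q * S) * ((1 - Q ^ 2 * S) * poi (Q * (Q * (Q * S))))"
    using rec[of "b * c"] rec[of "Q * a / d"] rec[of "Q * b / d"] rec[of "1 / (a * d)"] rec[of "Q * S"] rec[of "Q * (Q * S)"]
    by (simp_all add: mult_ac power2_eq_square)
  have e: "Q * a * b * c / d = Q * S" "Q * (Q * a) * (Q * b) * c / d = Q * (Q * (Q * S))" "Q / (Q * a * d) = 1 / (a * d)"
    by (simp_all add: S_def mult_ac)
  show ?thesis
    unfolding aw_prefactor_def dd e S_def[symmetric] using s ad nz unfolding S_def[symmetric]
    by (simp add: qpochs_inf_def p)
qed

theorem aw_fun_eq:
  assumes par: "aw_parameters q a b c d" and reg: "aw_regular_point q a b c d \<gamma> z"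
  shows "aw_fun q \<gamma> z a b c d =
    aw_fun_sym q \<gamma> z a b c d
    - csqrt (Q * a * inverse b * c * d)
        / ((1 - a * b) * (1 - Q * a * b) * (1 - a * c) * (1 - a * d))
      * (inverse \<gamma> * (1 - dual_a q a b c d * \<gamma>) * (1 - dual_b q a b c d * \<gamma>))
      * (inverse z * (1 - a * z) * (1 - b * z))
      * aw_fun_sym q \<gamma> z (Q * a) (Q * b) c d"
proof -
  have nz: "a \<noteq> 0" "b \<noteq> 0" "c \<noteq> 0" "d \<noteq> 0" using par by (auto simp: aw_parameters_def)
  note adm = aw_parameters_admissible[OF par]
  define u v r where "u = a * b" and "v = a * c" and "r = a * d / Q"
  define s where "s = a * b * c / d"
  note D = admissibleD[OF adm(1), folded u_def v_def r_def]
  have sp: "sp u v r = s" using nz by (simp add: u_def v_def r_def s_def sp_def)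
  define a' b' c' d' where "a' = dual_a q a b c d" and "b' = dual_b q a b c d"
    and "c' = dual_c q a b c d" and "d' = dual_d q a b c d"
  have a': "a' \<noteq> 0" "a' * a' = a * b * c * d / Q"
    using dual_a_nz[OF nz] dual_a_square[of a b c d] by (auto simp: a'_def power2_eq_square)
  have bcd': "b' = a * b / a'" "c' = a * c / a'" "d' = a * d / a'"
    by (simp_all add: b'_def c'_def d'_def a'_def dual_b_def dual_c_def dual_d_def)
  have b': "b' \<noteq> 0" "a' * b' = a * b" "a' * c' = a * c" using nz a' by (simp_all add: bcd')
  have ae': "a' * (Q / d') = b * c"
  proof -
    have "a' * (Q / d') = a' * a' * Q / (a * d)" by (simp add: bcd')
    then show ?thesis using nz by (simp add: a'(2))
  qed
  have ce': "c' * (Q / d') = Q * (c / d)" using nz a' by (simp add: bcd')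
  have abce': "a' * b' * c' * (Q / d') = Q * s"
    unfolding b'(2) mult.assoc[of "a * b"] ce' by (simp add: s_def)
  have ce: "c * (Q / d) = Q * (c / d)" by simp
  have abce: "a * b * c * (Q / d) = Q * s" by (simp add: s_def)
  \<comment> \<open>The shift acts on the dual parameters in the same way, so the E^- parts in z and
    \<gamma> combine to the pair for (qa, qb, c, d).\<close>
  have dual': "dual_a q (Q * a) (Q * b) c d = Q * a'" "dual_b q (Q * a) (Q * b) c d = Q * b'"
    "dual_c q (Q * a) (Q * b) c d = c'" "dual_d q (Q * a) (Q * b) c d = d'"
    by (simp_all add: dual_b_def dual_c_def dual_d_def dual_a_shift bcd' a'_def)
  define zz where "zz = inverse z * (1 - a * z) * (1 - b * z)"
  define gg where "gg = inverse \<gamma> * (1 - a' * \<gamma>) * (1 - b' * \<gamma>)"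
  define D1 where "D1 = (1 - a * b) * (1 - Q * a * b) * (1 - a * c) * (1 - a * (Q / d))"
  define D2 where "D2 = (1 - a' * b') * (1 - Q * a' * b') * (1 - a' * c') * (1 - a' * (Q / d'))"
  have n: "1 - u \<noteq> 0" "1 - Q * u \<noteq> 0" "1 - v \<noteq> 0" "1 - Q * a / d \<noteq> 0" "1 - b * c \<noteq> 0" "1 - Q * b / d \<noteq> 0"
    "1 - 1 / (a * d) \<noteq> 0" "1 - Q * s \<noteq> 0" "1 - Q ^ 2 * s \<noteq> 0"
  proof -
    show "1 - u \<noteq> 0" "1 - Q * u \<noteq> 0" "1 - v \<noteq> 0"
      using D(5)[of 0] D(5)[of 1] D(6)[of 0] by (auto simp: mult_ac)
    show "1 - Q * a / d \<noteq> 0" "1 - b * c \<noteq> 0" using adm(3)[of 0] adm(4)[of 0] by auto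
    have "Q * b / d = u / r" using nz by (simp add: u_def r_def)
    then show "1 - Q * b / d \<noteq> 0" using D(7)[of 0] by auto
    have "1 / (Q * a * d / Q) * Q ^ 0 \<noteq> 1" using admissibleD(10)[OF adm(2)] by blast
    then show "1 - 1 / (a * d) \<noteq> 0" by auto
    show "1 - Q * s \<noteq> 0" "1 - Q ^ 2 * s \<noteq> 0"
      using D(11)[of 1] D(11)[of 2] by (auto simp: sp mult_ac)
  qed
  have D1: "D1 = (1 - u) * (1 - Q * u) * (1 - v) * (1 - Q * a / d)"
    by (simp add: D1_def u_def v_def mult_ac)
  have D2: "D2 = (1 - u) * (1 - Q * u) * (1 - v) * (1 - b * c)"
    unfolding D2_def mult.assoc[of Q] b' ae' by (simp add: u_def v_def)
  have D0: "D1 \<noteq> 0" "D2 \<noteq> 0" using n by (simp_all add: D1 D2)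
  have reg': "aw_regular_point q (Q * a) (Q * b) c d \<gamma> z"
    using reg unfolding aw_regular_point_def dual'(4) d'_def .
  define P where "P m = aw_pair \<gamma> z a b c d m" for m
  define P' where "P' m = aw_pair \<gamma> z (Q * a) (Q * b) c d m" for m
  define w' where "w' = wt (Q * a * (Q * b)) (Q * a * c) (Q * a * d / Q)"
  note E = aw_fun_sym_expansion[OF nz adm(1) adm(3) adm(4) reg, folded u_def v_def r_def, folded P_def]
  have E': "summable (\<lambda>m. w' m * P' m)"
    "aw_fun_sym q \<gamma> z (Q * a) (Q * b) c d = aw_prefactor \<gamma> z (Q * a) (Q * b) c d * (\<Sum>m. w' m * P' m)"
    unfolding w'_def P'_def using nz reg' adm(2,5,6) by (intro aw_fun_sym_expansion; simp)+
  \<comment> \<open>The weight ratio of \<open>wt_Suc\<close> times the coefficient of R R' in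
    \<open>nonsym_bracket\<close>. The powers q^(2n) cancel, so it does not depend on n.\<close>
  define \<kappa> where "\<kappa> = - (1 / r) * ((1 - Q * s) * (1 - Q ^ 2 * s) * (1 - u) * (1 - Q * u) * (1 - v) / (1 - Q * b / d))
     * (a' / (b * D1 * D2)) * (zz * gg)"
  define B where "B m = - a * b * (1 - Q ^ m) * (1 - Q ^ m * c / d)
                 * aw_poly q (- int m) z a b c (Q / d)
                 * aw_poly q (- int m) \<gamma> a' b' c' (Q / d')
               + (1 - Q ^ m * a * b) * (1 - Q ^ m * a * b * c / d)
                 * aw_poly q (int m) z a b c (Q / d)
                 * aw_poly q (int m) \<gamma> a' b' c' (Q / d')" for m
  define C where "C m = (- 1) ^ m * (a * d) powi (- int m) * Q ^ (m * (m + 1) div 2)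
            / ((1 - a * b) * (1 - a * b * c / d))
            * (qpochs q [a * b, a * c, a * b * c / d] m
               / qpochs q [Q * b / d, Q * c / d, Q] m)" for m
  have expand: "aw_fun q \<gamma> z a b c d = aw_prefactor \<gamma> z a b c d * (\<Sum>m. C m * B m)"
    unfolding aw_fun_def Let_def aw_prefactor_def C_def B_def a'_def b'_def c'_def d'_def ..
  \<comment> \<open>The factor (1 - u)(1 - s q^(2m)) is Y - abX of the bracket, by
    \<open>YX\<close>; it turns the non-symmetric coefficient into the symmetric weight.\<close>
  have CW: "C m * ((1 - u) * (1 - s * Q ^ (2 * m)) * x) = wt u v r m * x" for m x
  proof -
    have "m * (m + 1) div 2 = tri m + m"
      unfolding tri_Suc[symmetric] by (simp add: tri_def mult.commute)
    moreover have "(a * d) powi (- int m) = 1 / (Q ^ m * r ^ m)"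
    proof -
      have "(a * d) ^ m = Q ^ m * r ^ m"
        by (simp add: r_def power_mult_distrib power_divide)
      then show ?thesis by (simp add: power_int_minus divide_inverse)
    qed
    moreover have "Q * b / d = u / r" "Q * c / d = v / r" using nz by (simp_all add: u_def v_def r_def)
    ultimately show ?thesis
      unfolding C_def wt_def sp s_def[symmetric] unfolding u_def[symmetric] v_def[symmetric] using n(1)
      by (simp add: qpochs_def power_add mult_ac)
  qed
  have YX: "(1 - x * u) * (1 - x * s) - a * b * ((1 - x) * (1 - x * (c / d))) = (1 - u) * (1 - s * x ^ 2)" for x
  proof -
    have "(1 - x * u) * (1 - x * (u * t)) - u * ((1 - x) * (1 - x * t)) = (1 - u) * (1 - u * t * x ^ 2)" for t
      by (simp add: algebra_simps power2_eq_square)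
    from this[of "c / d"] show ?thesis by (simp add: u_def s_def)
  qed
  have T0: "C 0 * B 0 = wt u v r 0 * P 0"
  proof -
    have "B 0 = (1 - u) * (1 - s * Q ^ (2 * 0)) * P 0"
      by (simp add: B_def P_def aw_pair_def aw_poly_plus_0 aw_poly_def u_def s_def)
    then show ?thesis by (simp only: CW)
  qed
  have TS: "C (Suc n) * B (Suc n) = wt u v r (Suc n) * P (Suc n) - \<kappa> * (w' n * P' n)" for n
  proof -
    define X where "X = (1 - Q ^ Suc n) * (1 - Q ^ Suc n * (c / d))"
    define Y where "Y = (1 - Q ^ Suc n * u) * (1 - Q ^ Suc n * s)"
    define p where "p = Q ^ n"
    define E1 E2 where "E1 = aw_poly_plus q (Suc n) z a b c (Q / d)" and "E2 = aw_poly_plus q (Suc n) \<gamma> a' b' c' (Q / d')"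
    define F1 F2 where "F1 = zz * aw_poly_plus q n z (Q * a) (Q * b) c (Q / d)"
      and "F2 = gg * aw_poly_plus q n \<gamma> (Q * a') (Q * b') c' (Q / d')"
    have P: "P (Suc n) = E1 * E2"
      by (simp add: P_def aw_pair_def E1_def E2_def a'_def b'_def c'_def d'_def)
    have F: "F1 * F2 = zz * gg * P' n"
      by (simp add: P'_def aw_pair_def F1_def F2_def dual')
    have e1: "aw_poly q (- int (Suc n)) z a b c (Q / d) = E1 - Y / (p * b * D1) * F1"
      unfolding aw_poly_neg[OF abce] E1_def Y_def p_def D1_def F1_def zz_def u_def ..
    have e2: "aw_poly q (- int (Suc n)) \<gamma> a' b' c' (Q / d') = E2 - Y / (p * b' * D2) * F2"
      unfolding aw_poly_neg[OF abce'] E2_def Y_def p_def D2_def F2_def gg_def u_def b'(2) ..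
    have e3: "aw_poly q (int (Suc n)) z a b c (Q / d) = E1 - a * X / (p * D1) * F1"
      unfolding aw_poly_pos[OF ce] E1_def X_def p_def D1_def F1_def zz_def ..
    have e4: "aw_poly q (int (Suc n)) \<gamma> a' b' c' (Q / d') = E2 - a' * X / (p * D2) * F2"
      unfolding aw_poly_pos[OF ce'] E2_def X_def p_def D2_def F2_def gg_def ..
    have "B (Suc n) = - a * b * X * (E1 - Y / (p * b * D1) * F1) * (E2 - Y / (p * b' * D2) * F2)
       + Y * (E1 - a * X / (p * D1) * F1) * (E2 - a' * X / (p * D2) * F2)"
      unfolding B_def e1 e2 e3 e4 by (simp add: X_def Y_def u_def s_def mult.assoc)
    also have "\<dots> = (Y - a * b * X) * (E1 * E2 - X * Y * a' / (b * p ^ 2 * D1 * D2) * (F1 * F2))"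
      using b' nz D0 by (intro nonsym_bracket) (auto simp: p_def)
    also have "Y - a * b * X = (1 - u) * (1 - s * Q ^ (2 * Suc n))"
      using YX[of "Q ^ Suc n"] unfolding X_def Y_def power_mult[symmetric] by (simp only: mult.commute)
    finally have "C (Suc n) * B (Suc n) = wt u v r (Suc n) * (E1 * E2 - X * Y * a' / (b * p ^ 2 * D1 * D2) * (F1 * F2))"
      by (simp only: CW)
    also have "\<dots> = wt u v r (Suc n) * P (Suc n) - (wt u v r (Suc n) * (X * Y)) * (a' / (b * p ^ 2 * D1 * D2) * (zz * gg * P' n))"
      unfolding P F by (simp add: right_diff_distrib)
    also have "wt u v r (Suc n) * (X * Y) = - (p ^ 2 / r) * ((1 - Q * s) * (1 - Q ^ 2 * s) * (1 - u) * (1 - Q * u) * (1 - v) / (1 - Q * b / d)) * w' n"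
    proof -
      have "Q ^ Suc n * (c / d) = Q ^ n * (v / r)" "u / r = Q * b / d" using nz by (simp_all add: u_def v_def r_def)
      moreover have "Q * a * (Q * b) = Q ^ 2 * u" "Q * a * c = Q * v" "Q * a * d / Q = Q * r"
        by (simp_all add: u_def v_def r_def power2_eq_square)
      ultimately show ?thesis
        using wt_Suc[OF adm(1)[folded u_def v_def r_def], unfolded sp, OF n(9), of n]
        by (simp only: X_def Y_def p_def w'_def)
    qed
    also have "- (p ^ 2 / r) * ((1 - Q * s) * (1 - Q ^ 2 * s) * (1 - u) * (1 - Q * u) * (1 - v) / (1 - Q * b / d)) * w' n
       * (a' / (b * p ^ 2 * D1 * D2) * (zz * gg * P' n)) = \<kappa> * (w' n * P' n)"
      by (simp add: \<kappa>_def p_def mult_ac)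
    finally show ?thesis .
  qed
  have "(\<Sum>m. C m * B m) = (\<Sum>m. wt u v r m * P m) - \<kappa> * (\<Sum>n. w' n * P' n)"
  proof -
    have s1: "summable (\<lambda>n. wt u v r (Suc n) * P (Suc n))"
      using E(1) by (subst summable_Suc_iff)
    have s2: "summable (\<lambda>n. \<kappa> * (w' n * P' n))" by (intro summable_mult E')
    have "summable (\<lambda>n. C (Suc n) * B (Suc n))" unfolding TS by (intro summable_diff s1 s2)
    then have "summable (\<lambda>m. C m * B m)" by (subst (asm) summable_Suc_iff)
    from suminf_split_head[OF this] have "(\<Sum>m. C m * B m) = C 0 * B 0 + (\<Sum>n. C (Suc n) * B (Suc n))"
      by simp
    also have "(\<Sum>n. C (Suc n) * B (Suc n)) = (\<Sum>n. wt u v r (Suc n) * P (Suc n)) - \<kappa> * (\<Sum>n. w' n * P' n)"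
      unfolding TS suminf_diff[OF s1 s2, symmetric] suminf_mult[OF E'(1)] ..
    also have "(\<Sum>n. wt u v r (Suc n) * P (Suc n)) = (\<Sum>m. wt u v r m * P m) - wt u v r 0 * P 0"
      by (rule suminf_split_head[OF E(1)])
    finally show ?thesis by (simp add: T0)
  qed
  then have "aw_fun q \<gamma> z a b c d = aw_fun_sym q \<gamma> z a b c d - aw_prefactor \<gamma> z a b c d * \<kappa> * (\<Sum>n. w' n * P' n)"
    unfolding expand E(2) by (simp add: right_diff_distrib)
  also have "aw_prefactor \<gamma> z a b c d * \<kappa> = Q * a' / b / ((1 - a * b) * (1 - Q * a * b) * (1 - a * c) * (1 - a * d)) * gg * zz
     * aw_prefactor \<gamma> z (Q * a) (Q * b) c d"
  proof -
    \<comment> \<open>The factor 1 - ad of the final constant arises here. The factors 1 - qa/d and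
      1 - bc of D1 and D2 cancel against the shift of the prefactor.\<close>
    have ad: "- (1 / r) / (1 - 1 / (a * d)) = Q / (1 - a * d)"
    proof -
      have "1 - a * d \<noteq> 0" using n(7) by auto
      then show ?thesis using nz n(7) by (simp add: r_def field_simps)
    qed
    have "aw_prefactor \<gamma> z a b c d * \<kappa> =
       (aw_prefactor \<gamma> z a b c d * ((1 - Q * s) * (1 - Q ^ 2 * s)))
        * (- (1 / r) * ((1 - u) * (1 - Q * u) * (1 - v) / (1 - Q * b / d)) * (a' / (b * D1 * D2)) * (zz * gg))"
      by (simp add: \<kappa>_def mult_ac)
    also have "aw_prefactor \<gamma> z a b c d * ((1 - Q * s) * (1 - Q ^ 2 * s)) =
       aw_prefactor \<gamma> z (Q * a) (Q * b) c d * ((1 - b * c) * (1 - Q * a / d) * (1 - Q * b / d) / (1 - 1 / (a * d)))"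
      unfolding s_def by (rule aw_prefactor_shift[OF nz n(8,9)[unfolded s_def] n(7)])
    also have "\<dots> * (- (1 / r) * ((1 - u) * (1 - Q * u) * (1 - v) / (1 - Q * b / d)) * (a' / (b * D1 * D2)) * (zz * gg))
      = (- (1 / r) / (1 - 1 / (a * d))) * (aw_prefactor \<gamma> z (Q * a) (Q * b) c d * (a' / b / ((1 - u) * (1 - Q * u) * (1 - v))) * (zz * gg))"
    proof -
      have gen: "pf * (x1 * x2 * x3 / x4) * (R * (y1 * y2 * y3 / x3) * (a' / (b * (y1 * y2 * y3 * x2) * (y1 * y2 * y3 * x1))) * zg)
         = R / x4 * (pf * (a' / b / (y1 * y2 * y3)) * zg)"
        if "x1 \<noteq> 0" "x2 \<noteq> 0" "x3 \<noteq> 0" "y1 \<noteq> 0" "y2 \<noteq> 0" "y3 \<noteq> 0" for pf x1 x2 x3 x4 R y1 y2 y3 zg :: complex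
        using that by (simp add: mult_ac)
      show ?thesis unfolding D1 D2 by (rule gen) (rule n)+
    qed
    also have "\<dots> = Q * a' / b / ((1 - a * b) * (1 - Q * a * b) * (1 - a * c) * (1 - a * d)) * gg * zz
     * aw_prefactor \<gamma> z (Q * a) (Q * b) c d"
      unfolding ad by (simp add: u_def v_def mult_ac)
    finally show ?thesis .
  qed
  also have "Q * a' / b = csqrt (Q * a * inverse b * c * d)"
    unfolding a'_def using par by (intro csqrt_dual_a[symmetric]) (auto simp: aw_parameters_def)
  finally show ?thesis
    unfolding E'(2) gg_def zz_def a'_def b'_def by (simp only: mult.assoc)
qed

end

theorem theorem7p4:
  fixes q :: real and a b c d \<gamma> z :: complex
  assumes "0 < q" and "q < 1"
    and "aw_parameters q a b c d"
    and "aw_regular_point q a b c d \<gamma> z"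
  shows "aw_fun q \<gamma> z a b c d =
    aw_fun_sym q \<gamma> z a b c d
    - csqrt (of_real q * a * inverse b * c * d)
        / ((1 - a * b) * (1 - of_real q * a * b) * (1 - a * c) * (1 - a * d))
      * (inverse \<gamma> * (1 - dual_a q a b c d * \<gamma>) * (1 - dual_b q a b c d * \<gamma>))
      * (inverse z * (1 - a * z) * (1 - b * z))
      * aw_fun_sym q \<gamma> z (of_real q * a) (of_real q * b) c d"
proof -
  interpret q_series q by unfold_locales fact+
  show ?thesis using assms(3,4) by (rule aw_fun_eq)
qed

end
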